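(* Let $\alpha>0$ and let $S(t)$, $t\ge0$, be the $C_0$-semigroup on $L^2(\mathbb{A}_f)$ generated by the operator $-D^\alpha$. Let $T(0)$ be the identity operator on $L^2(\mathbb{A}_f)$ and, for $t>0$, let $T(t)f=Z(\cdot,t)*f$ for $f\in L^2(\mathbb{A}_f)$. Then $S(t)=T(t)$ for each $t\ge0$. In other words, for $f\in\mathrm{Dom}(D^\alpha)$ and for $t>0$ the solution of the abstract Cauchy problem $$\frac{\partial u(x,t)}{\partial t}+D^\alpha u(x,t)=0,\quad x\in\mathbb{A}_f,\ t\ge0,\qquad u(x,0)=f(x),$$ is given by $u(x,t)=(Z(\cdot,t)*f)(x)=\int_{\mathbb{A}_f}Z(x-y,t)f(y)\,dy$.
   Context: Fix a strictly increasing sequence of natural numbers $\{e^{\psi(n)}\}_{n\ge 0}$ with $e^{\psi(0)}=1$, totally ordered by divisibility (so $e^{\psi(n)}\mid e^{\psi(n+1)}$) and cofinal in $\mathbb{N}$ for divisibility (every natural number divides some $e^{\psi(n)}$). Here $\psi(n)=\log(e^{\psi(n)})$, extended to $n\in\mathbb{Z}$ by $\psi(-n)=-\psi(n)$. Put $e^{\Lambda(n)}=e^{\psi(n)}/e^{\psi(n-1)}$, $n\in\mathbb{Z}$. For $x\in\mathbb{Q}$ let $\mathrm{ord}(x)=\max\{n\in\mathbb{Z}:x\in e^{\psi(n)}\mathbb{Z}\}$ if $x\ne0$, and $\mathrm{ord}(0)=\infty$. The ring of finite adeles $\mathbb{A}_f$ is the completion of $\mathbb{Q}$ for the ultrametric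 $d(x,y)=e^{-\psi(\mathrm{ord}(x-y))}$; $\mathrm{ord}$ extends to $\mathbb{A}_f$, and $\|x\|=e^{-\psi(\mathrm{ord}(x))}$, $\|0\|=0$. Every nonzero $x\in\mathbb{A}_f$ is uniquely a convergent series $x=\sum_{l\ge\gamma}x_le^{\psi(l)}$ with $x_l\in\{0,\dots,e^{\Lambda(l+1)}-1\}$, $x_\gamma\neq0$, $\gamma=\mathrm{ord}(x)$; its fractional part is $\{x\}=\sum_{l=\gamma}^{-1}x_le^{\psi(l)}\in\mathbb{Q}$ if $\gamma<0$ and $\{x\}=0$ otherwise. The canonical character of $\mathbb{A}_f$ is $\chi(x)=\exp(2\pi i\{x\})$. The Haar measure $dx$ on $\mathbb{A}_f$ is normalized so that the unit ball $\widehat{\mathbb{Z}}=\{\|x\|\le1\}$ has measure $1$. The Fourier transform is $\mathcal{F}[\phi](\xi)=\widehat\phi(\xi)=\int_{\mathbb{A}_f}\phi(x)\chi(\xi x)\,dx$, extended to a unitary operator on $L^2(\mathbb{A}_f)$. For $\alpha>0$, $D^\alpha$ is the positive selfadjoint operator on $L^2(\mathbb{A}_f)$ given by $D^\alpha\phi=\mathcal{F}^{-1}\big[\|\xi\|^\alpha\mathcal{F}[\phi](\xi)\big]$ with domain $\mathrm{Dom}(D^\alpha)=\{f\in L^2(\mathbb{A}_f):\|\xi\|^\alpha\widehat f(\xi)\in L^2(\mathbb{A}_f)\}$. The heat kernel is $Z(x,t)=\int_{\mathbb{A}_f}\chi(-x\xi)\exp(-t\|\xi\|^\alpha)\,d\xi$,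 $t>0$, $x\in\mathbb{A}_f$. A solution of the abstract Cauchy problem is a function $u:\mathbb{A}_f\times[0,\infty)\to\mathbb{C}$ such that $t\mapsto u(\cdot,t)$ is a continuously differentiable function $[0,\infty)\to L^2(\mathbb{A}_f)$, $u(\cdot,t)\in\mathrm{Dom}(D^\alpha)$ for all $t\ge0$, and $u$ satisfies the initial value problem (in $L^2(\mathbb{A}_f)$). *)

theory Defs
  imports "HOL-Analysis.Analysis"
begin

section \<open>The filtration of the rationals\<close>

text \<open>The number \<open>E n\<close> stands for $e^{\psi(n)}$, $n \ge 0$.\<close>

definition adelic_sequence :: "(nat \<Rightarrow> nat) \<Rightarrow> bool" where
  "adelic_sequence E \<longleftrightarrow>
     strict_mono E \<and> E 0 = 1 \<and> (\<forall>n. E n dvd E (Suc n)) \<and> (\<forall>m>0. \<exists>n. m dvd E n)"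

text \<open>$e^{\psi(n)}$ for every integer $n$, where $\psi(-n) = -\psi(n)$.\<close>

definition exp_psi :: "(nat \<Rightarrow> nat) \<Rightarrow> int \<Rightarrow> rat" where
  "exp_psi E n = (if n \<ge> 0 then of_nat (E (nat n)) else 1 / of_nat (E (nat (- n))))"

definition exp_Lambda :: "(nat \<Rightarrow> nat) \<Rightarrow> int \<Rightarrow> rat" where
  "exp_Lambda E n = exp_psi E n / exp_psi E (n - 1)"

text \<open>Only meaningful for \<open>x \<noteq> 0\<close>; the value $\mathrm{ord}(0) = \infty$ is accounted for
  wherever \<open>rat_ord\<close> is used.\<close>

definition rat_ord :: "(nat \<Rightarrow> nat) \<Rightarrow> rat \<Rightarrow> int" where
  "rat_ord E x = (GREATEST n. \<exists>k::int. x = of_int k * exp_psi E n)"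

definition rat_dist :: "(nat \<Rightarrow> nat) \<Rightarrow> rat \<Rightarrow> rat \<Rightarrow> real" where
  "rat_dist E x y = (if x = y then 0 else 1 / of_rat (exp_psi E (rat_ord E (x - y))))"


section \<open>The ring of finite adeles\<close>

text \<open>
  The ring of finite adeles is rendered as an arbitrary completion of the rationals for
  \<open>rat_dist E\<close>: a complete metric space that is a topological commutative ring (both expressed by
  the sort of \<open>'a\<close>), together with an isometric ring homomorphism \<open>\<iota>\<close> with dense image. These data
  are unique up to a unique isometric ring isomorphism compatible with \<open>\<iota>\<close>.
\<close>

definition finite_adeles ::
  "(nat \<Rightarrow> nat) \<Rightarrow> (rat \<Rightarrow> 'a::{comm_ring_1, topological_ab_group_add,
     topological_semigroup_mult, complete_space}) \<Rightarrow> bool" where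
  "finite_adeles E \<iota> \<longleftrightarrow>
     \<iota> 1 = 1 \<and> (\<forall>x y. \<iota> (x + y) = \<iota> x + \<iota> y) \<and> (\<forall>x y. \<iota> (x * y) = \<iota> x * \<iota> y) \<and>
     (\<forall>x y. dist (\<iota> x) (\<iota> y) = rat_dist E x y) \<and> closure (range \<iota>) = UNIV"

text \<open>The extension of the order from the rationals, for \<open>x \<noteq> 0\<close>: the order is eventually constant
  along every sequence of rationals that converges to \<open>x\<close>.\<close>

definition adele_ord ::
  "(nat \<Rightarrow> nat) \<Rightarrow> (rat \<Rightarrow> 'a::{topological_space, zero}) \<Rightarrow> 'a \<Rightarrow> int" where
  "adele_ord E \<iota> x =
     (THE n. \<forall>q. (\<lambda>k. \<iota> (q k)) \<longlonglongrightarrow> x \<longrightarrow> (\<forall>\<^sub>F k in sequentially. rat_ord E (q k) = n))"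

definition adele_norm ::
  "(nat \<Rightarrow> nat) \<Rightarrow> (rat \<Rightarrow> 'a::{topological_space, zero}) \<Rightarrow> 'a \<Rightarrow> real" where
  "adele_norm E \<iota> x = (if x = 0 then 0 else 1 / of_rat (exp_psi E (adele_ord E \<iota> x)))"

text \<open>\<open>c l\<close> is the digit $x_l$ of \<open>x \<noteq> 0\<close>; the digits below the order are set to \<open>0\<close>, so that the
  sequence of digits is unique as a function on the integers.\<close>

definition adele_digits ::
  "(nat \<Rightarrow> nat) \<Rightarrow> (rat \<Rightarrow> 'a::{topological_space, comm_monoid_add}) \<Rightarrow> 'a \<Rightarrow> int \<Rightarrow> nat" where
  "adele_digits E \<iota> x =
     (THE c. (\<forall>l < adele_ord E \<iota> x. c l = 0) \<and> c (adele_ord E \<iota> x) \<noteq> 0 \<and>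
        (\<forall>l. of_nat (c l) < exp_Lambda E (l + 1)) \<and>
        (\<lambda>k. \<iota> (of_nat (c (adele_ord E \<iota> x + int k)) * exp_psi E (adele_ord E \<iota> x + int k))) sums x)"

definition fractional_part ::
  "(nat \<Rightarrow> nat) \<Rightarrow> (rat \<Rightarrow> 'a::{topological_space, comm_monoid_add}) \<Rightarrow> 'a \<Rightarrow> rat" where
  "fractional_part E \<iota> x =
     (if x \<noteq> 0 \<and> adele_ord E \<iota> x < 0
      then (\<Sum>l = adele_ord E \<iota> x..-1. of_nat (adele_digits E \<iota> x l) * exp_psi E l) else 0)"

definition adele_char ::
  "(nat \<Rightarrow> nat) \<Rightarrow> (rat \<Rightarrow> 'a::{topological_space, comm_monoid_add}) \<Rightarrow> 'a \<Rightarrow> complex" where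
  "adele_char E \<iota> x = exp (2 * of_real pi * \<i> * of_rat (fractional_part E \<iota> x))"

text \<open>The group is locally compact and second countable, so regularity of the Borel measure is
  automatic.\<close>

definition normalized_haar ::
  "(nat \<Rightarrow> nat) \<Rightarrow> (rat \<Rightarrow> 'a::{topological_space, ab_group_add}) \<Rightarrow> 'a measure \<Rightarrow> bool" where
  "normalized_haar E \<iota> M \<longleftrightarrow>
     sets M = sets borel \<and> (\<forall>K. compact K \<longrightarrow> emeasure M K < \<infinity>) \<and>
     (\<forall>a. \<forall>B\<in>sets M. emeasure M ((\<lambda>x. a + x) ` B) = emeasure M B) \<and>
     emeasure M {x. adele_norm E \<iota> x \<le> 1} = 1"


section \<open>Square integrable functions\<close>

text \<open>Elements of $L^2$ are represented by square integrable functions; equality in $L^2$ is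
  equality almost everywhere.\<close>

definition L2 :: "'a measure \<Rightarrow> ('a \<Rightarrow> complex) set" where
  "L2 M = {f \<in> borel_measurable M. integrable M (\<lambda>x. (cmod (f x))\<^sup>2)}"

definition L2_eq :: "'a measure \<Rightarrow> ('a \<Rightarrow> complex) \<Rightarrow> ('a \<Rightarrow> complex) \<Rightarrow> bool" where
  "L2_eq M f g \<longleftrightarrow> (AE x in M. f x = g x)"

definition L2_norm :: "'a measure \<Rightarrow> ('a \<Rightarrow> complex) \<Rightarrow> real" where
  "L2_norm M f = sqrt (\<integral>x. (cmod (f x))\<^sup>2 \<partial>M)"

text \<open>Membership in \<open>L2\<close> is part of convergence, because the Bochner integral of a function that is
  not integrable is \<open>0\<close>.\<close>

definition L2_tendsto ::
  "'a measure \<Rightarrow> ('s \<Rightarrow> 'a \<Rightarrow> complex) \<Rightarrow> ('a \<Rightarrow> complex) \<Rightarrow> 's filter \<Rightarrow> bool" where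
  "L2_tendsto M X f F \<longleftrightarrow>
     f \<in> L2 M \<and> (\<forall>\<^sub>F s in F. X s \<in> L2 M) \<and> ((\<lambda>s. L2_norm M (\<lambda>x. X s x - f x)) \<longlongrightarrow> 0) F"

definition L2_bounded_operator ::
  "'a measure \<Rightarrow> (('a \<Rightarrow> complex) \<Rightarrow> ('a \<Rightarrow> complex)) \<Rightarrow> bool" where
  "L2_bounded_operator M A \<longleftrightarrow>
     (\<forall>f\<in>L2 M. A f \<in> L2 M) \<and>
     (\<forall>f\<in>L2 M. \<forall>g\<in>L2 M. L2_eq M f g \<longrightarrow> L2_eq M (A f) (A g)) \<and>
     (\<forall>f\<in>L2 M. \<forall>g\<in>L2 M. L2_eq M (A (\<lambda>x. f x + g x)) (\<lambda>x. A f x + A g x)) \<and>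
     (\<forall>f\<in>L2 M. \<forall>c. L2_eq M (A (\<lambda>x. c * f x)) (\<lambda>x. c * A f x)) \<and>
     (\<exists>C. \<forall>f\<in>L2 M. L2_norm M (A f) \<le> C * L2_norm M f)"

definition C0_semigroup ::
  "'a measure \<Rightarrow> (real \<Rightarrow> ('a \<Rightarrow> complex) \<Rightarrow> ('a \<Rightarrow> complex)) \<Rightarrow> bool" where
  "C0_semigroup M S \<longleftrightarrow>
     (\<forall>t\<ge>0. L2_bounded_operator M (S t)) \<and>
     (\<forall>f\<in>L2 M. L2_eq M (S 0 f) f) \<and>
     (\<forall>s\<ge>0. \<forall>t\<ge>0. \<forall>f\<in>L2 M. L2_eq M (S (s + t) f) (S s (S t f))) \<and>
     (\<forall>f\<in>L2 M. L2_tendsto M (\<lambda>t. S t f) f (at_right 0))"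

text \<open>The operator \<open>A\<close> with domain \<open>D\<close> is the infinitesimal generator of \<open>S\<close>: both operators have the
  same graph.\<close>

definition generated_by ::
  "'a measure \<Rightarrow> (real \<Rightarrow> ('a \<Rightarrow> complex) \<Rightarrow> ('a \<Rightarrow> complex)) \<Rightarrow>
   ('a \<Rightarrow> complex) set \<Rightarrow> (('a \<Rightarrow> complex) \<Rightarrow> ('a \<Rightarrow> complex)) \<Rightarrow> bool" where
  "generated_by M S D A \<longleftrightarrow>
     (\<forall>f\<in>L2 M. \<forall>g\<in>L2 M.
        L2_tendsto M (\<lambda>t x. (S t f x - f x) / of_real t) g (at_right 0) \<longleftrightarrow>
        f \<in> D \<and> L2_eq M g (A f))"


section \<open>Fourier transform, fractional derivative and heat kernel\<close>

definition fourier ::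
  "(nat \<Rightarrow> nat) \<Rightarrow> (rat \<Rightarrow> 'a::{topological_space, comm_ring_1}) \<Rightarrow> 'a measure \<Rightarrow>
   ('a \<Rightarrow> complex) \<Rightarrow> 'a \<Rightarrow> complex" where
  "fourier E \<iota> M f \<xi> = (\<integral>x. f x * adele_char E \<iota> (\<xi> * x) \<partial>M)"

text \<open>The extension by continuity from $L^1 \cap L^2$ to $L^2$, determined up to equality almost
  everywhere.\<close>

definition fourier_L2 ::
  "(nat \<Rightarrow> nat) \<Rightarrow> (rat \<Rightarrow> 'a::{topological_space, comm_ring_1}) \<Rightarrow> 'a measure \<Rightarrow>
   ('a \<Rightarrow> complex) \<Rightarrow> 'a \<Rightarrow> complex" where
  "fourier_L2 E \<iota> M f =
     (SOME g. \<exists>\<phi>::nat \<Rightarrow> 'a \<Rightarrow> complex.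
        (\<forall>n. integrable M (\<phi> n) \<and> \<phi> n \<in> L2 M) \<and> L2_tendsto M \<phi> f sequentially \<and>
        L2_tendsto M (\<lambda>n. fourier E \<iota> M (\<phi> n)) g sequentially)"

definition inverse_fourier_L2 ::
  "(nat \<Rightarrow> nat) \<Rightarrow> (rat \<Rightarrow> 'a::{topological_space, comm_ring_1}) \<Rightarrow> 'a measure \<Rightarrow>
   ('a \<Rightarrow> complex) \<Rightarrow> 'a \<Rightarrow> complex" where
  "inverse_fourier_L2 E \<iota> M g = (SOME f. f \<in> L2 M \<and> L2_eq M (fourier_L2 E \<iota> M f) g)"

definition Dom_D ::
  "(nat \<Rightarrow> nat) \<Rightarrow> (rat \<Rightarrow> 'a::{topological_space, comm_ring_1}) \<Rightarrow> 'a measure \<Rightarrow> real \<Rightarrow>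
   ('a \<Rightarrow> complex) set" where
  "Dom_D E \<iota> M \<alpha> =
     {f \<in> L2 M. (\<lambda>\<xi>. of_real (adele_norm E \<iota> \<xi> powr \<alpha>) * fourier_L2 E \<iota> M f \<xi>) \<in> L2 M}"

definition D_op ::
  "(nat \<Rightarrow> nat) \<Rightarrow> (rat \<Rightarrow> 'a::{topological_space, comm_ring_1}) \<Rightarrow> 'a measure \<Rightarrow> real \<Rightarrow>
   ('a \<Rightarrow> complex) \<Rightarrow> 'a \<Rightarrow> complex" where
  "D_op E \<iota> M \<alpha> f =
     inverse_fourier_L2 E \<iota> M
       (\<lambda>\<xi>. of_real (adele_norm E \<iota> \<xi> powr \<alpha>) * fourier_L2 E \<iota> M f \<xi>)"

definition heat_kernel ::
  "(nat \<Rightarrow> nat) \<Rightarrow> (rat \<Rightarrow> 'a::{topological_space, comm_ring_1}) \<Rightarrow> 'a measure \<Rightarrow> real \<Rightarrow>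
   'a \<Rightarrow> real \<Rightarrow> complex" where
  "heat_kernel E \<iota> M \<alpha> x t =
     (\<integral>\<xi>. adele_char E \<iota> (- x * \<xi>) * of_real (exp (- t * adele_norm E \<iota> \<xi> powr \<alpha>)) \<partial>M)"

definition convolution ::
  "'a::ab_group_add measure \<Rightarrow> ('a \<Rightarrow> complex) \<Rightarrow> ('a \<Rightarrow> complex) \<Rightarrow> 'a \<Rightarrow> complex" where
  "convolution M g f x = (\<integral>y. g (x - y) * f y \<partial>M)"

definition heat_operator ::
  "(nat \<Rightarrow> nat) \<Rightarrow> (rat \<Rightarrow> 'a::{topological_space, comm_ring_1}) \<Rightarrow> 'a measure \<Rightarrow> real \<Rightarrow>
   real \<Rightarrow> ('a \<Rightarrow> complex) \<Rightarrow> 'a \<Rightarrow> complex" where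
  "heat_operator E \<iota> M \<alpha> t f =
     (if t = 0 then f else convolution M (\<lambda>x. heat_kernel E \<iota> M \<alpha> x t) f)"


section \<open>The abstract Cauchy problem\<close>

text \<open>\<open>v t\<close> is the derivative of \<open>u(\<cdot>, t)\<close> in $L^2$, one-sided at \<open>t = 0\<close>. Values of \<open>u\<close> at negative
  times are irrelevant.\<close>

definition cauchy_solution ::
  "(nat \<Rightarrow> nat) \<Rightarrow> (rat \<Rightarrow> 'a::{topological_space, comm_ring_1}) \<Rightarrow> 'a measure \<Rightarrow> real \<Rightarrow>
   ('a \<Rightarrow> complex) \<Rightarrow> ('a \<Rightarrow> real \<Rightarrow> complex) \<Rightarrow> bool" where
  "cauchy_solution E \<iota> M \<alpha> f u \<longleftrightarrow>
     (\<exists>v :: real \<Rightarrow> 'a \<Rightarrow> complex.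
        (\<forall>t\<ge>0. L2_tendsto M (\<lambda>s x. (u x s - u x t) / of_real (s - t)) (v t) (at t within {0..})) \<and>
        (\<forall>t\<ge>0. L2_tendsto M v (v t) (at t within {0..})) \<and>
        (\<forall>t\<ge>0. (\<lambda>x. u x t) \<in> Dom_D E \<iota> M \<alpha>) \<and>
        (\<forall>t\<ge>0. L2_eq M (\<lambda>x. v t x + D_op E \<iota> M \<alpha> (\<lambda>x. u x t) x) (\<lambda>x. 0)) \<and>
        L2_eq M (\<lambda>x. u x 0) f)"

end

theory Submission
  imports Defs "HOL-Real_Asymp.Real_Asymp"
begin

text \<open>
  On the Fourier side everything is multiplication: the Fourier transform is unitary on \<open>L2\<close>, it turns
  $D^\alpha$ into multiplication by $m = \|\xi\|^\alpha$, and it turns convolution with the heat kernel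
  into multiplication by $e^{-tm}$.  The theorem is therefore the statement that $e^{-tm}$ is the
  semigroup generated by $-m$, together with the uniqueness of that semigroup and of the solutions of the
  Cauchy problem.

  The proof separates the two ingredients.  The locale \<open>heat_representation\<close> isolates what is used of
  the adeles: a linear isometry of \<open>L2\<close> onto itself, up to equality almost everywhere, that conjugates
  given operators to $e^{-tm}$.  Generation and differentiability follow from dominated convergence.  Uniqueness
  of solutions (\<open>flow_unique\<close>) rests on the positivity of $m$: since $|1 + hm| \ge 1$, a step backwards in
  time along the tangent does not decrease the norm, so the norm of a solution cannot increase.  An
  arbitrary semigroup with the same generator has differentiable orbits on the domain
  (\<open>semigroup_flow\<close>) and thus agrees there with $e^{-tm}$; the left derivative needs a local bound on the
  norms of the semigroup, which is the uniform boundedness principle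
  (\<open>uniform_boundedness_sequence\<close>), for which \<open>L2\<close> has to be complete.

  On the adeles, the balls around \<open>0\<close> are the groups $G_n$ with $\|x\| \le e^{-\psi(n)}$.  The fractional part
  is a rational number that represents $x$ modulo $G_0 = \widehat{\mathbb{Z}}$, which makes $\chi$ a character
  that is trivial exactly on $G_0$; because of $\psi(-n) = -\psi(n)$, the annihilator of $G_n$ is $G_{-n}$.
  Hence the transform of the indicator of a ball is a character times the indicator of the dual ball, and
  Plancherel for ball indicators is the fact that two balls are nested or disjoint.  Ball indicators span a
  space that is dense in mean and in mean square simultaneously, which yields the unitary transform on
  \<open>L2\<close> as the definition describes it.

  The convolution is computed without Fubini's theorem on the adeles.  Cutting $e^{-t\|\xi\|^\alpha}$ into
  its layers writes it as an increasing limit of finite combinations of indicators of the $G_{-n}$;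
  integrating term by term writes the heat kernel as the corresponding limit of positive combinations of
  normalized indicators of the $G_n$.  For the indicator of a ball the convolution is then explicit, and its
  transform can be compared layer by layer (\<open>T_ind\<close>).  The general case follows by density, because
  the kernel is square integrable and the convolution is thus continuous pointwise (\<open>T_L2_F2\<close>).
\<close>


section \<open>Square integrable functions\<close>

lemma L2_measurable [measurable_dest]: "f \<in> L2 M \<Longrightarrow> f \<in> borel_measurable M"
  by (simp add: L2_def)

lemma L2_integrable: "f \<in> L2 M \<Longrightarrow> integrable M (\<lambda>x. (cmod (f x))\<^sup>2)"
  by (simp add: L2_def)

lemma L2_dominated_sq:
  assumes "f \<in> borel_measurable M" "integrable M g" "AE x in M. (cmod (f x))\<^sup>2 \<le> g x"
  shows "f \<in> L2 M"
  unfolding L2_def using assms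
  by (auto intro!: Bochner_Integration.integrable_bound[OF assms(2)])

lemma L2_dominated:
  assumes "f \<in> borel_measurable M" "g \<in> L2 M" "AE x in M. cmod (f x) \<le> cmod (g x)"
  shows "f \<in> L2 M"
  using assms(3) by (intro L2_dominated_sq[OF assms(1) L2_integrable[OF assms(2)]]) (auto intro: power_mono)

lemma L2_cong_AE:
  assumes "f \<in> L2 M" "g \<in> borel_measurable M" "AE x in M. f x = g x"
  shows "g \<in> L2 M"
  by (rule L2_dominated[OF assms(2,1)]) (use assms(3) in auto)

lemma L2_zero [simp]: "(\<lambda>x. 0) \<in> L2 M"
  by (simp add: L2_def)

lemma L2_add:
  assumes "f \<in> L2 M" "g \<in> L2 M"
  shows "(\<lambda>x. f x + g x) \<in> L2 M"
proof (rule L2_dominated_sq)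
  show "(\<lambda>x. f x + g x) \<in> borel_measurable M"
    using assms by (auto dest: L2_measurable)
  show "integrable M (\<lambda>x. 2 * (cmod (f x))\<^sup>2 + 2 * (cmod (g x))\<^sup>2)"
    by (intro Bochner_Integration.integrable_add integrable_mult_right L2_integrable assms)
  have "(cmod (f x + g x))\<^sup>2 \<le> 2 * (cmod (f x))\<^sup>2 + 2 * (cmod (g x))\<^sup>2" for x
  proof -
    have "(cmod (f x + g x))\<^sup>2 \<le> (cmod (f x) + cmod (g x))\<^sup>2"
      by (intro power_mono norm_triangle_ineq) auto
    also have "\<dots> \<le> 2 * (cmod (f x))\<^sup>2 + 2 * (cmod (g x))\<^sup>2"
      using sum_squares_bound[of "cmod (f x)" "cmod (g x)"] by (simp add: power2_sum)
    finally show ?thesis .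
  qed
  then show "AE x in M. (cmod (f x + g x))\<^sup>2 \<le> 2 * (cmod (f x))\<^sup>2 + 2 * (cmod (g x))\<^sup>2"
    by simp
qed

lemma L2_cmult:
  assumes "f \<in> L2 M"
  shows "(\<lambda>x. c * f x) \<in> L2 M"
  using L2_integrable[OF assms] L2_measurable[OF assms]
  by (auto simp: L2_def norm_mult power_mult_distrib)

lemma L2_uminus: "f \<in> L2 M \<Longrightarrow> (\<lambda>x. - f x) \<in> L2 M"
  using L2_cmult[of f M "-1"] by simp

lemma L2_diff: "f \<in> L2 M \<Longrightarrow> g \<in> L2 M \<Longrightarrow> (\<lambda>x. f x - g x) \<in> L2 M"
  using L2_add[OF _ L2_uminus, of f M g] by simp

lemma L2_divide: "f \<in> L2 M \<Longrightarrow> (\<lambda>x. f x / c) \<in> L2 M"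
  using L2_cmult[of f M "inverse c"] by (simp add: field_simps)

lemma L2_sum: "(\<And>i. i \<in> I \<Longrightarrow> f i \<in> L2 M) \<Longrightarrow> (\<lambda>x. \<Sum>i\<in>I. f i x) \<in> L2 M"
  by (induction I rule: infinite_finite_induct) (auto intro: L2_add)

lemma L2_eq_refl [simp]: "L2_eq M f f"
  by (simp add: L2_eq_def)

lemma L2_eq_sym: "L2_eq M f g \<Longrightarrow> L2_eq M g f"
  unfolding L2_eq_def by (rule AE_mp, assumption) auto

lemma L2_norm_nonneg [simp]: "L2_norm M f \<ge> 0"
  by (simp add: L2_norm_def)

lemma L2_norm_zero [simp]: "L2_norm M (\<lambda>x. 0) = 0"
  by (simp add: L2_norm_def)

lemma L2_norm_sq: "(L2_norm M f)\<^sup>2 = (\<integral>x. (cmod (f x))\<^sup>2 \<partial>M)"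
  by (simp add: L2_norm_def)

lemma nn_integral_L2:
  assumes "f \<in> L2 M"
  shows "(\<integral>\<^sup>+x. ennreal ((cmod (f x))\<^sup>2) \<partial>M) = ennreal ((L2_norm M f)\<^sup>2)"
  unfolding L2_norm_sq using L2_integrable[OF assms] by (intro nn_integral_eq_integral) auto

lemma L2_nn_bounded:
  assumes "f \<in> borel_measurable M" "C \<ge> 0"
    and "(\<integral>\<^sup>+x. ennreal ((cmod (f x))\<^sup>2) \<partial>M) \<le> ennreal (C\<^sup>2)"
  shows "f \<in> L2 M" "L2_norm M f \<le> C"
proof -
  show f: "f \<in> L2 M"
    unfolding L2_def using assms(1) le_less_trans[OF assms(3) ennreal_less_top]
    by (auto intro!: integrableI_bounded)
  have "(L2_norm M f)\<^sup>2 \<le> C\<^sup>2"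
    using assms(2,3) unfolding nn_integral_L2[OF f] by (subst (asm) ennreal_le_iff) auto
  then show "L2_norm M f \<le> C"
    using assms(2) power2_le_imp_le by blast
qed

lemma L2_norm_mono:
  assumes "g \<in> L2 M" "AE x in M. cmod (f x) \<le> cmod (g x)"
  shows "L2_norm M f \<le> L2_norm M g"
  unfolding L2_norm_def real_sqrt_le_iff using assms(2)
  by (intro integral_mono_AE' L2_integrable[OF assms(1)]) (auto intro: power_mono)

lemma L2_norm_cong_AE:
  assumes "f \<in> L2 M" "g \<in> L2 M" "AE x in M. f x = g x"
  shows "L2_norm M f = L2_norm M g"
  by (rule antisym; rule L2_norm_mono) (use assms in auto)

lemma L2_norm_eq: "f \<in> L2 M \<Longrightarrow> g \<in> L2 M \<Longrightarrow> L2_eq M f g \<Longrightarrow> L2_norm M f = L2_norm M g"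
  unfolding L2_eq_def by (rule L2_norm_cong_AE)

lemma L2_norm_cmult: "L2_norm M (\<lambda>x. c * f x) = cmod c * L2_norm M f"
  by (simp add: L2_norm_def norm_mult power_mult_distrib real_sqrt_mult)

lemma L2_norm_divide: "L2_norm M (\<lambda>x. f x / c) = L2_norm M f / cmod c"
  using L2_norm_cmult[of M "inverse c" f] by (simp add: divide_inverse norm_inverse mult.commute)

lemma L2_norm_uminus: "L2_norm M (\<lambda>x. - f x) = L2_norm M f"
  by (simp add: L2_norm_def)

lemma L2_norm_minus_commute: "L2_norm M (\<lambda>x. f x - g x) = L2_norm M (\<lambda>x. g x - f x)"
  by (simp add: L2_norm_def norm_minus_commute)

lemma L2_norm_eq_0_AE:
  assumes "f \<in> L2 M" "L2_norm M f = 0"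
  shows "AE x in M. f x = 0"
proof -
  have "(\<integral>x. (cmod (f x))\<^sup>2 \<partial>M) = 0"
    using assms(2) L2_norm_sq[of M f] by simp
  then show ?thesis
    using integral_nonneg_eq_0_iff_AE[OF L2_integrable[OF assms(1)]] by simp
qed

lemma L2_eqI_norm:
  assumes "f \<in> L2 M" "g \<in> L2 M" "L2_norm M (\<lambda>x. f x - g x) = 0"
  shows "L2_eq M f g"
  using L2_norm_eq_0_AE[OF L2_diff[OF assms(1,2)] assms(3)] by (simp add: L2_eq_def)

lemma L2_mult_integrable:
  assumes "f \<in> L2 M" "g \<in> L2 M"
  shows "integrable M (\<lambda>x. f x * g x)"
proof (rule Bochner_Integration.integrable_bound)
  show "integrable M (\<lambda>x. (cmod (f x))\<^sup>2 + (cmod (g x))\<^sup>2)"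
    by (intro Bochner_Integration.integrable_add L2_integrable assms)
  show "(\<lambda>x. f x * g x) \<in> borel_measurable M"
    using assms by (auto dest: L2_measurable)
  have "cmod (f x * g x) \<le> norm ((cmod (f x))\<^sup>2 + (cmod (g x))\<^sup>2)" for x
  proof -
    have "0 \<le> cmod (f x) * cmod (g x)" by simp
    moreover have "2 * (cmod (f x) * cmod (g x)) \<le> (cmod (f x))\<^sup>2 + (cmod (g x))\<^sup>2"
      using sum_squares_bound[of "cmod (f x)" "cmod (g x)"] by simp
    ultimately show ?thesis unfolding norm_mult real_norm_def by linarith
  qed
  then show "AE x in M. cmod (f x * g x) \<le> norm ((cmod (f x))\<^sup>2 + (cmod (g x))\<^sup>2)"
    by simp
qed

lemma L2_Cauchy_Schwarz:
  assumes "f \<in> L2 M" "g \<in> L2 M"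
  shows "(\<integral>x. cmod (f x) * cmod (g x) \<partial>M) \<le> L2_norm M f * L2_norm M g"
proof -
  let ?I = "\<integral>x. cmod (f x) * cmod (g x) \<partial>M"
  have int: "integrable M (\<lambda>x. cmod (f x) * cmod (g x))"
    using integrable_norm[OF L2_mult_integrable[OF assms]] by (simp add: norm_mult)
  have "(ennreal ?I)\<^sup>2 = (\<integral>\<^sup>+x. ennreal (cmod (f x)) * ennreal (cmod (g x)) \<partial>M)\<^sup>2"
    by (subst nn_integral_eq_integral[symmetric, OF int]) (auto simp: ennreal_mult)
  also have "\<dots> \<le> (\<integral>\<^sup>+x. (ennreal (cmod (f x)))\<^sup>2 \<partial>M) * (\<integral>\<^sup>+x. (ennreal (cmod (g x)))\<^sup>2 \<partial>M)"
    using assms by (intro Cauchy_Schwarz_nn_integral) (auto dest: L2_measurable)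
  also have "\<dots> = ennreal ((L2_norm M f * L2_norm M g)\<^sup>2)"
    using assms by (simp add: ennreal_power nn_integral_L2 ennreal_mult power_mult_distrib)
  finally have "?I\<^sup>2 \<le> (L2_norm M f * L2_norm M g)\<^sup>2"
    by (simp add: ennreal_power)
  then show ?thesis
    by (meson L2_norm_nonneg mult_nonneg_nonneg power2_le_imp_le)
qed

lemma norm_integral_mult_le_L2:
  assumes "f \<in> L2 M" "g \<in> L2 M"
  shows "cmod (\<integral>x. f x * g x \<partial>M) \<le> L2_norm M f * L2_norm M g"
  using order_trans[OF integral_norm_bound L2_Cauchy_Schwarz[OF assms, unfolded norm_mult[symmetric]]] .

lemma L2_norm_triangle:
  assumes "f \<in> L2 M" "g \<in> L2 M"
  shows "L2_norm M (\<lambda>x. f x + g x) \<le> L2_norm M f + L2_norm M g"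
proof (rule power2_le_imp_le)
  have int: "integrable M (\<lambda>x. cmod (f x) * cmod (g x))"
    using integrable_norm[OF L2_mult_integrable[OF assms]] by (simp add: norm_mult)
  have "(L2_norm M (\<lambda>x. f x + g x))\<^sup>2
      \<le> (\<integral>x. ((cmod (f x))\<^sup>2 + (cmod (g x))\<^sup>2) + 2 * (cmod (f x) * cmod (g x)) \<partial>M)"
    unfolding L2_norm_sq
  proof (rule integral_mono[OF L2_integrable[OF L2_add[OF assms]]])
    show "integrable M (\<lambda>x. ((cmod (f x))\<^sup>2 + (cmod (g x))\<^sup>2) + 2 * (cmod (f x) * cmod (g x)))"
      by (intro Bochner_Integration.integrable_add integrable_mult_right L2_integrable assms int)
    show "(cmod (f x + g x))\<^sup>2 \<le> ((cmod (f x))\<^sup>2 + (cmod (g x))\<^sup>2) + 2 * (cmod (f x) * cmod (g x))" for x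
      using power_mono[OF norm_triangle_ineq norm_ge_zero, of "f x" "g x" 2] by (simp add: power2_sum)
  qed
  also have "\<dots> = (L2_norm M f)\<^sup>2 + (L2_norm M g)\<^sup>2 + 2 * (\<integral>x. cmod (f x) * cmod (g x) \<partial>M)"
    using int assms by (simp add: L2_norm_sq L2_integrable)
  also have "\<dots> \<le> (L2_norm M f)\<^sup>2 + (L2_norm M g)\<^sup>2 + 2 * (L2_norm M f * L2_norm M g)"
    using L2_Cauchy_Schwarz[OF assms] by simp
  also have "\<dots> = (L2_norm M f + L2_norm M g)\<^sup>2"
    by (simp add: power2_sum)
  finally show "(L2_norm M (\<lambda>x. f x + g x))\<^sup>2 \<le> (L2_norm M f + L2_norm M g)\<^sup>2" .
qed simp

lemma L2_norm_triangle_diff: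
  assumes "f \<in> L2 M" "g \<in> L2 M"
  shows "L2_norm M (\<lambda>x. f x - g x) \<le> L2_norm M f + L2_norm M g"
  using L2_norm_triangle[OF assms(1) L2_uminus[OF assms(2)]] by (simp add: L2_norm_uminus)

lemma L2_norm_triangle_mid:
  assumes "f \<in> L2 M" "g \<in> L2 M" "h \<in> L2 M"
  shows "L2_norm M (\<lambda>x. f x - h x) \<le> L2_norm M (\<lambda>x. f x - g x) + L2_norm M (\<lambda>x. g x - h x)"
  using L2_norm_triangle[OF L2_diff[OF assms(1,2)] L2_diff[OF assms(2,3)]] by simp

lemma L2_norm_diff_ge:
  assumes "f \<in> L2 M" "g \<in> L2 M"
  shows "\<bar>L2_norm M f - L2_norm M g\<bar> \<le> L2_norm M (\<lambda>x. f x - g x)"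
  using L2_norm_triangle_mid[of f M g "\<lambda>_. 0"] L2_norm_triangle_mid[of g M f "\<lambda>_. 0"] assms
    L2_norm_minus_commute[of M f g]
  by auto

lemma L2_norm_sum_le:
  assumes "\<And>i. i \<in> I \<Longrightarrow> f i \<in> L2 M"
  shows "L2_norm M (\<lambda>x. \<Sum>i\<in>I. f i x) \<le> (\<Sum>i\<in>I. L2_norm M (f i))"
  using assms
proof (induction I rule: infinite_finite_induct)
  case (insert i I)
  then have "L2_norm M (\<lambda>x. f i x + (\<Sum>i\<in>I. f i x)) \<le> L2_norm M (f i) + L2_norm M (\<lambda>x. \<Sum>i\<in>I. f i x)"
    by (intro L2_norm_triangle L2_sum) auto
  with insert show ?case by force
qed auto

subsection \<open>Convergence and completeness\<close>

lemma L2_tendstoD: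
  assumes "L2_tendsto M X f F"
  shows "f \<in> L2 M" "\<forall>\<^sub>F s in F. X s \<in> L2 M" "((\<lambda>s. L2_norm M (\<lambda>x. X s x - f x)) \<longlongrightarrow> 0) F"
  using assms by (auto simp: L2_tendsto_def)

lemma L2_tendsto_le:
  assumes "f \<in> L2 M" "\<forall>\<^sub>F s in F. X s \<in> L2 M"
    and "\<forall>\<^sub>F s in F. L2_norm M (\<lambda>x. X s x - f x) \<le> b s" "(b \<longlongrightarrow> 0) F"
  shows "L2_tendsto M X f F"
  unfolding L2_tendsto_def using assms
  by (auto intro: tendsto_sandwich[OF _ assms(3) tendsto_const assms(4)])

lemma L2_tendsto_const: "f \<in> L2 M \<Longrightarrow> L2_tendsto M (\<lambda>_. f) f F"
  by (simp add: L2_tendsto_def)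

lemma L2_tendsto_add:
  assumes "L2_tendsto M X f F" "L2_tendsto M Y g F"
  shows "L2_tendsto M (\<lambda>s x. X s x + Y s x) (\<lambda>x. f x + g x) F"
proof (rule L2_tendsto_le)
  note X = L2_tendstoD[OF assms(1)] and Y = L2_tendstoD[OF assms(2)]
  show "(\<lambda>x. f x + g x) \<in> L2 M" using X Y by (intro L2_add)
  show "\<forall>\<^sub>F s in F. (\<lambda>x. X s x + Y s x) \<in> L2 M"
    using X(2) Y(2) by eventually_elim (rule L2_add)
  show "\<forall>\<^sub>F s in F. L2_norm M (\<lambda>x. X s x + Y s x - (f x + g x))
      \<le> L2_norm M (\<lambda>x. X s x - f x) + L2_norm M (\<lambda>x. Y s x - g x)"
    using X(2) Y(2)
  proof eventually_elim
    case (elim s)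
    show ?case
      using L2_norm_triangle[OF L2_diff[OF elim(1) X(1)] L2_diff[OF elim(2) Y(1)]]
      by (simp add: algebra_simps)
  qed
  show "((\<lambda>s. L2_norm M (\<lambda>x. X s x - f x) + L2_norm M (\<lambda>x. Y s x - g x)) \<longlongrightarrow> 0) F"
    using tendsto_add[OF X(3) Y(3)] by simp
qed

lemma L2_tendsto_cmult:
  assumes "L2_tendsto M X f F"
  shows "L2_tendsto M (\<lambda>s x. c * X s x) (\<lambda>x. c * f x) F"
proof (rule L2_tendsto_le)
  note X = L2_tendstoD[OF assms(1)]
  show "(\<lambda>x. c * f x) \<in> L2 M" using X by (intro L2_cmult)
  show "\<forall>\<^sub>F s in F. (\<lambda>x. c * X s x) \<in> L2 M"
    using X(2) by eventually_elim (rule L2_cmult)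
  show "\<forall>\<^sub>F s in F. L2_norm M (\<lambda>x. c * X s x - c * f x) \<le> cmod c * L2_norm M (\<lambda>x. X s x - f x)"
    by (simp add: L2_norm_cmult flip: right_diff_distrib)
  show "((\<lambda>s. cmod c * L2_norm M (\<lambda>x. X s x - f x)) \<longlongrightarrow> 0) F"
    using tendsto_mult_right_zero[OF X(3)] by simp
qed

lemma L2_tendsto_diff:
  assumes "L2_tendsto M X f F" "L2_tendsto M Y g F"
  shows "L2_tendsto M (\<lambda>s x. X s x - Y s x) (\<lambda>x. f x - g x) F"
  using L2_tendsto_add[OF assms(1) L2_tendsto_cmult[OF assms(2), of "-1"]] by simp

lemma L2_tendsto_norm:
  assumes "L2_tendsto M X f F"
  shows "((\<lambda>s. L2_norm M (X s)) \<longlongrightarrow> L2_norm M f) F"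
proof -
  note X = L2_tendstoD[OF assms]
  have "\<forall>\<^sub>F s in F. norm (L2_norm M (X s) - L2_norm M f) \<le> L2_norm M (\<lambda>x. X s x - f x)"
    using X(2) by eventually_elim (use L2_norm_diff_ge X(1) in auto)
  then have "((\<lambda>s. L2_norm M (X s) - L2_norm M f) \<longlongrightarrow> 0) F"
    by (rule Lim_null_comparison[OF _ X(3)])
  then show ?thesis
    by (simp add: LIM_zero_iff)
qed

lemma L2_tendsto_cong:
  assumes "L2_tendsto M X f F" "\<forall>\<^sub>F s in F. Y s \<in> L2 M \<and> L2_eq M (X s) (Y s)"
    and "g \<in> L2 M" "L2_eq M f g"
  shows "L2_tendsto M Y g F"
proof (rule L2_tendsto_le[OF assms(3)])
  note X = L2_tendstoD[OF assms(1)]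
  show "\<forall>\<^sub>F s in F. Y s \<in> L2 M" using assms(2) by eventually_elim simp
  show "\<forall>\<^sub>F s in F. L2_norm M (\<lambda>x. Y s x - g x) \<le> L2_norm M (\<lambda>x. X s x - f x)"
    using X(2) assms(2)
  proof eventually_elim
    case (elim s)
    then have "AE x in M. Y s x - g x = X s x - f x"
      using assms(4) unfolding L2_eq_def by auto
    then show ?case using elim X(1) assms(3)
      by (intro eq_refl L2_norm_cong_AE L2_diff) auto
  qed
  show "((\<lambda>s. L2_norm M (\<lambda>x. X s x - f x)) \<longlongrightarrow> 0) F" by (rule X)
qed

lemma L2_tendsto_unique:
  assumes "L2_tendsto M X f F" "L2_tendsto M X g F" "F \<noteq> bot"
  shows "L2_eq M f g"
proof -
  have "L2_tendsto M (\<lambda>s x. X s x - X s x) (\<lambda>x. f x - g x) F"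
    by (intro L2_tendsto_diff assms)
  then have "((\<lambda>s. 0) \<longlongrightarrow> L2_norm M (\<lambda>x. f x - g x)) F"
    using L2_tendsto_norm by force
  then have "L2_norm M (\<lambda>x. f x - g x) = 0"
    using assms(3) tendsto_const tendsto_unique by blast
  then show ?thesis
    using assms by (intro L2_eqI_norm) (auto dest: L2_tendstoD)
qed

text \<open>Dominated convergence is a statement about sequences; this carries it to limits in a real parameter.\<close>

lemma L2_tendsto_within_sequentially:
  fixes X :: "'b::first_countable_topology \<Rightarrow> 'a \<Rightarrow> complex"
  assumes "f \<in> L2 M" "\<And>s. s \<in> S \<Longrightarrow> X s \<in> L2 M"
    and "\<And>r. (\<And>n. r n \<in> S - {a}) \<Longrightarrow> r \<longlonglongrightarrow> a \<Longrightarrow> L2_tendsto M (\<lambda>n. X (r n)) f sequentially"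
  shows "L2_tendsto M X f (at a within S)"
  unfolding L2_tendsto_def
proof (intro conjI)
  show "\<forall>\<^sub>F s in at a within S. X s \<in> L2 M"
    using assms(2) by (auto simp: eventually_at_filter)
  show "((\<lambda>s. L2_norm M (\<lambda>x. X s x - f x)) \<longlongrightarrow> 0) (at a within S)"
    unfolding tendsto_at_iff_sequentially comp_def
  proof (intro allI impI)
    fix r :: "nat \<Rightarrow> 'b" assume "\<forall>i. r i \<in> S - {a}" "r \<longlonglongrightarrow> a"
    then show "(\<lambda>n. L2_norm M (\<lambda>x. X (r n) x - f x)) \<longlonglongrightarrow> 0"
      by (intro L2_tendstoD(3) assms(3)) auto
  qed
qed (rule assms)

lemma L2_tendsto_dominated:
  fixes g :: "'a \<Rightarrow> real"
  assumes f: "f \<in> borel_measurable M" and X: "\<And>n. X n \<in> borel_measurable M"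
    and g: "integrable M (\<lambda>x. (g x)\<^sup>2)"
    and lim: "AE x in M. (\<lambda>n. X n x) \<longlonglongrightarrow> f x"
    and bound: "\<And>n. AE x in M. cmod (X n x) \<le> g x"
  shows "L2_tendsto M X f sequentially"
proof -
  have X2: "X n \<in> L2 M" for n
    by (rule L2_dominated_sq[OF X g], rule eventually_mono[OF bound[of n]]) (auto intro: power_mono)
  have bound': "AE x in M. \<forall>n. cmod (X n x) \<le> g x"
    using bound by (simp add: AE_all_countable)
  have fg: "AE x in M. cmod (f x) \<le> g x"
    using lim bound'
  proof eventually_elim
    case (elim x)
    then show ?case by (intro LIMSEQ_le_const2[OF tendsto_norm[OF elim(1)]]) auto
  qed
  have f2: "f \<in> L2 M"
    by (rule L2_dominated_sq[OF f g], rule eventually_mono[OF fg]) (auto intro: power_mono)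
  have "(\<lambda>n. \<integral>x. (cmod (X n x - f x))\<^sup>2 \<partial>M) \<longlonglongrightarrow> (\<integral>x. 0 \<partial>M)"
  proof (rule integral_dominated_convergence)
    show "integrable M (\<lambda>x. 4 * (g x)\<^sup>2)" using g by simp
    show "AE x in M. (\<lambda>n. (cmod (X n x - f x))\<^sup>2) \<longlonglongrightarrow> 0"
      using lim
    proof eventually_elim
      case (elim x)
      then have "(\<lambda>n. X n x - f x) \<longlonglongrightarrow> 0" by (simp add: LIM_zero)
      then show ?case using tendsto_power[OF tendsto_norm_zero, of _ _ 2] by fastforce
    qed
    show "AE x in M. norm ((cmod (X n x - f x))\<^sup>2) \<le> 4 * (g x)\<^sup>2" for n
      using bound[of n] fg
    proof eventually_elim
      case (elim x)
      then have "cmod (X n x - f x) \<le> 2 * g x" using norm_triangle_ineq4[of "X n x" "f x"] by linarith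
      then have "(cmod (X n x - f x))\<^sup>2 \<le> (2 * g x)\<^sup>2" by (intro power_mono) auto
      then show ?case by simp
    qed
  qed (use f X in auto)
  then have "(\<lambda>n. L2_norm M (\<lambda>x. X n x - f x)) \<longlonglongrightarrow> 0"
    unfolding L2_norm_def using tendsto_real_sqrt by fastforce
  then show ?thesis using X2 f2 by (simp add: L2_tendsto_def)
qed

lemma L2_Fatou:
  assumes f: "f \<in> borel_measurable M" and X: "\<forall>\<^sub>F n in sequentially. X n \<in> L2 M \<and> L2_norm M (X n) \<le> C"
    and lim: "AE x in M. (\<lambda>n. X n x) \<longlonglongrightarrow> f x" 
  shows "f \<in> L2 M" "L2_norm M f \<le> C"
proof -
  obtain N where N: "\<And>n. X (n + N) \<in> L2 M" "\<And>n. L2_norm M (X (n + N)) \<le> C"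
    using X unfolding eventually_sequentially by (metis le_add2)
  have C: "C \<ge> 0" using order_trans[OF L2_norm_nonneg N(2)] .
  have "(\<integral>\<^sup>+x. ennreal ((cmod (f x))\<^sup>2) \<partial>M)
      = (\<integral>\<^sup>+x. liminf (\<lambda>n. ennreal ((cmod (X (n + N) x))\<^sup>2)) \<partial>M)"
  proof (rule nn_integral_cong_AE, use lim in eventually_elim)
    case (elim x)
    have "(\<lambda>n. ennreal ((cmod (X (n + N) x))\<^sup>2)) \<longlonglongrightarrow> ennreal ((cmod (f x))\<^sup>2)"
      by (intro tendsto_ennrealI tendsto_intros LIMSEQ_ignore_initial_segment elim)
    then show ?case using lim_imp_Liminf[OF sequentially_bot] by metis
  qed
  also have "\<dots> \<le> liminf (\<lambda>n. \<integral>\<^sup>+x. ennreal ((cmod (X (n + N) x))\<^sup>2) \<partial>M)"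
    using N by (intro nn_integral_liminf) (auto dest: L2_measurable)
  also have "\<dots> \<le> liminf (\<lambda>n. ennreal (C\<^sup>2))"
    by (intro Liminf_mono always_eventually allI)
       (use N in \<open>auto simp: nn_integral_L2 intro!: ennreal_leI power_mono\<close>)
  also have "\<dots> = ennreal (C\<^sup>2)"
    by (rule Liminf_const) simp
  finally show "f \<in> L2 M" "L2_norm M f \<le> C"
    using L2_nn_bounded[OF f C] by blast+
qed

definition L2_Cauchy :: "'a measure \<Rightarrow> (nat \<Rightarrow> 'a \<Rightarrow> complex) \<Rightarrow> bool" where
  "L2_Cauchy M X \<longleftrightarrow> (\<forall>n. X n \<in> L2 M) \<and>
     (\<forall>e>0. \<exists>N. \<forall>m\<ge>N. \<forall>n\<ge>N. L2_norm M (\<lambda>x. X m x - X n x) \<le> e)"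

lemma L2_tendsto_imp_Cauchy:
  assumes "L2_tendsto M X f sequentially" "\<And>n. X n \<in> L2 M"
  shows "L2_Cauchy M X"
  unfolding L2_Cauchy_def
proof (intro conjI allI impI)
  fix e :: real assume "e > 0"
  note X = L2_tendstoD[OF assms(1)]
  have "\<forall>\<^sub>F n in sequentially. L2_norm M (\<lambda>x. X n x - f x) < e / 2"
    using order_tendstoD(2)[OF X(3), of "e / 2"] \<open>e > 0\<close> by simp
  then obtain N where N: "\<And>n. n \<ge> N \<Longrightarrow> L2_norm M (\<lambda>x. X n x - f x) < e / 2"
    by (auto simp: eventually_sequentially)
  show "\<exists>N. \<forall>m\<ge>N. \<forall>n\<ge>N. L2_norm M (\<lambda>x. X m x - X n x) \<le> e"
  proof (intro exI allI impI)
    fix m n assume "m \<ge> N" "n \<ge> N"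
    then show "L2_norm M (\<lambda>x. X m x - X n x) \<le> e"
      using L2_norm_triangle_mid[OF assms(2)[of m] X(1) assms(2)[of n]] N[of m] N[of n]
        L2_norm_minus_commute[of M f "X n"] by simp
  qed
qed (rule assms)

text \<open>Fatou's lemma upgrades pointwise convergence of a Cauchy sequence to norm convergence.\<close>

lemma L2_Cauchy_pointwise:
  assumes X: "L2_Cauchy M X" and f: "f \<in> borel_measurable M"
    and lim: "AE x in M. (\<lambda>n. X n x) \<longlonglongrightarrow> f x"
  shows "L2_tendsto M X f sequentially"
proof -
  have X2: "\<And>n. X n \<in> L2 M" using X by (simp add: L2_Cauchy_def)
  have main: "\<exists>N. \<forall>m\<ge>N. (\<lambda>x. X m x - f x) \<in> L2 M \<and> L2_norm M (\<lambda>x. X m x - f x) \<le> e" if "e > 0" for e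
  proof -
    obtain N where N: "\<And>m n. m \<ge> N \<Longrightarrow> n \<ge> N \<Longrightarrow> L2_norm M (\<lambda>x. X m x - X n x) \<le> e"
      using X \<open>e > 0\<close> unfolding L2_Cauchy_def by blast
    have "(\<lambda>x. X m x - f x) \<in> L2 M \<and> L2_norm M (\<lambda>x. X m x - f x) \<le> e" if "m \<ge> N" for m
    proof (intro conjI L2_Fatou[where X = "\<lambda>n x. X m x - X n x"])
      show "\<forall>\<^sub>F n in sequentially. (\<lambda>x. X m x - X n x) \<in> L2 M \<and> L2_norm M (\<lambda>x. X m x - X n x) \<le> e"
        using N that X2 unfolding eventually_sequentially by (intro exI[of _ N]) (auto intro: L2_diff)
      then show "\<forall>\<^sub>F n in sequentially. (\<lambda>x. X m x - X n x) \<in> L2 M \<and> L2_norm M (\<lambda>x. X m x - X n x) \<le> e" .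
      show "AE x in M. (\<lambda>n. X m x - X n x) \<longlonglongrightarrow> X m x - f x"
        using lim by eventually_elim (intro tendsto_intros)
      then show "AE x in M. (\<lambda>n. X m x - X n x) \<longlonglongrightarrow> X m x - f x" .
    qed (use f X2[of m] in \<open>auto dest: L2_measurable\<close>)
    then show ?thesis by blast
  qed
  obtain N where "(\<lambda>x. X N x - f x) \<in> L2 M" using main[of 1] by auto
  from L2_diff[OF X2[of N] this] have f2: "f \<in> L2 M" by simp
  have "(\<lambda>n. L2_norm M (\<lambda>x. X n x - f x)) \<longlonglongrightarrow> 0"
  proof (rule LIMSEQ_I)
    fix e :: real assume "e > 0"
    then show "\<exists>N. \<forall>n\<ge>N. norm (L2_norm M (\<lambda>x. X n x - f x) - 0) < e"
      using main[of "e/2"] by force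
  qed
  then show ?thesis using X2 f2 by (simp add: L2_tendsto_def)
qed

text \<open>Riesz--Fischer.  Along a subsequence whose increments have summable norms, the sum of the
  absolute increments is square integrable, hence finite almost everywhere, so that the subsequence
  converges almost everywhere.\<close>

theorem L2_complete:
  assumes X: "L2_Cauchy M X"
  obtains f r where "L2_tendsto M X f sequentially" "strict_mono (r :: nat \<Rightarrow> nat)"
    "AE x in M. (\<lambda>n. X (r n) x) \<longlonglongrightarrow> f x"
proof -
  have X2: "\<And>n. X n \<in> L2 M" using X by (simp add: L2_Cauchy_def)
  have "\<exists>r. strict_mono r \<and> (\<forall>k. \<forall>m\<ge>r k. L2_norm M (\<lambda>x. X m x - X (r k) x) \<le> (1/2)^k)"
  proof -
    have "\<exists>N. \<forall>m\<ge>N. \<forall>n\<ge>N. L2_norm M (\<lambda>x. X m x - X n x) \<le> (1/2)^k" for k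
      using X unfolding L2_Cauchy_def by simp
    then obtain N where N: "\<And>k m n. m \<ge> N k \<Longrightarrow> n \<ge> N k \<Longrightarrow> L2_norm M (\<lambda>x. X m x - X n x) \<le> (1/2)^k"
      by metis
    define r where "r k = (\<Sum>i\<le>k. Suc (N i))" for k
    have "strict_mono r" by (rule strict_monoI_Suc) (simp add: r_def)
    moreover have "r k \<ge> N k" for k
    proof -
      have "Suc (N k) \<le> r k" unfolding r_def by (rule member_le_sum) auto
      then show ?thesis by simp
    qed
    ultimately show ?thesis by (metis N order_trans)
  qed
  then obtain r where r: "strict_mono r" "\<And>k m. m \<ge> r k \<Longrightarrow> L2_norm M (\<lambda>x. X m x - X (r k) x) \<le> (1/2)^k"
    by blast
  \<comment> \<open>\<open>G n\<close> is complex valued only so that the lemmas on \<open>L2\<close> apply to it.\<close>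
  define d where "d k x = X (r (Suc k)) x - X (r k) x" for k x
  have d2: "d k \<in> L2 M" for k unfolding d_def by (intro L2_diff X2)
  have dm: "(\<lambda>x. complex_of_real (cmod (d k x))) \<in> L2 M" for k
    by (rule L2_dominated[OF _ d2[of k]]) (use d2[of k] in \<open>auto dest: L2_measurable\<close>)
  have dn: "L2_norm M (d k) \<le> (1/2)^k" for k
    unfolding d_def using r by (simp add: strict_mono_leD)
  define G where "G n x = (\<Sum>k<n. complex_of_real (cmod (d k x)))" for n x
  have G2: "G n \<in> L2 M" for n unfolding G_def by (intro L2_sum dm)
  have Gn: "L2_norm M (G n) \<le> 2" for n
  proof -
    have "L2_norm M (G n) \<le> (\<Sum>k<n. L2_norm M (\<lambda>x. complex_of_real (cmod (d k x))))"
      unfolding G_def by (rule L2_norm_sum_le[OF dm])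
    also have "\<dots> = (\<Sum>k<n. L2_norm M (d k))"
      by (simp add: L2_norm_def)
    also have "\<dots> \<le> (\<Sum>k<n. (1/2)^k)"
      by (intro sum_mono dn)
    also have "\<dots> \<le> 2"
      using geometric_sum[of "1/2::real" n] by simp
    finally show ?thesis .
  qed
  have Gre: "G n x = complex_of_real (\<Sum>k<n. cmod (d k x))" for n x
    by (simp add: G_def)
  have cmodG: "cmod (G n x) = (\<Sum>k<n. cmod (d k x))" for n x
    unfolding Gre by (simp add: sum_nonneg del: of_real_sum)
  have Gmeas: "(\<lambda>x. ennreal ((cmod (G n x))\<^sup>2)) \<in> borel_measurable M" for n
    using L2_measurable[OF G2[of n]] by measurable
  have Gmono: "cmod (G n x) \<le> cmod (G m x)" if "n \<le> m" for n m x
    unfolding cmodG using that by (intro sum_mono2) auto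
  have "(\<integral>\<^sup>+x. (SUP n. ennreal ((cmod (G n x))\<^sup>2)) \<partial>M) = (SUP n. \<integral>\<^sup>+x. ennreal ((cmod (G n x))\<^sup>2) \<partial>M)"
    by (intro nn_integral_monotone_convergence_SUP Gmeas incseq_SucI le_funI ennreal_leI power_mono Gmono) auto
  also have "\<dots> \<le> ennreal (2\<^sup>2)"
    unfolding nn_integral_L2[OF G2] by (intro SUP_least ennreal_leI power_mono Gn L2_norm_nonneg)
  finally have "(\<integral>\<^sup>+x. (SUP n. ennreal ((cmod (G n x))\<^sup>2)) \<partial>M) \<noteq> \<infinity>"
    using le_less_trans[OF _ ennreal_less_top] by (metis infinity_ennreal_def less_irrefl)
  then have "AE x in M. (SUP n. ennreal ((cmod (G n x))\<^sup>2)) \<noteq> \<infinity>"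
    by (intro nn_integral_PInf_AE) (use Gmeas in measurable)
  then have conv: "AE x in M. convergent (\<lambda>n. X (r n) x)"
  proof eventually_elim
    case (elim x)
    define s where "s = (SUP n. ennreal ((cmod (G n x))\<^sup>2))"
    have "(\<Sum>k<n. cmod (d k x)) \<le> sqrt (enn2real s)" for n
    proof (rule real_le_rsqrt)
      have "ennreal ((cmod (G n x))\<^sup>2) \<le> s" unfolding s_def by (rule SUP_upper) simp
      then have "(cmod (G n x))\<^sup>2 \<le> enn2real s"
        using elim unfolding s_def[symmetric] 
        by (metis enn2real_ennreal enn2real_mono infinity_ennreal_def less_top zero_le_power2)
      then show "(\<Sum>k<n. cmod (d k x))\<^sup>2 \<le> enn2real s" unfolding cmodG .
    qed
    then have "summable (\<lambda>k. cmod (d k x))"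
      by (intro summableI_nonneg_bounded[where x = "sqrt (enn2real s)"]) auto
    then have "summable (\<lambda>k. d k x)" by (rule summable_norm_cancel)
    then have "convergent (\<lambda>n. \<Sum>k<n. d k x)" by (simp add: summable_iff_convergent)
    then have "convergent (\<lambda>n. X (r n) x - X (r 0) x)"
      unfolding d_def by (subst (asm) sum_lessThan_telescope)
    then show ?case
      using convergent_add[OF _ convergent_const[of "X (r 0) x"], of "\<lambda>n. X (r n) x - X (r 0) x"] by simp
  qed
  define f where "f x = lim (\<lambda>n. X (r n) x)" for x
  have f: "f \<in> borel_measurable M"
    unfolding f_def using X2 by (intro borel_measurable_lim_metric) (auto dest: L2_measurable)
  have lim: "AE x in M. (\<lambda>n. X (r n) x) \<longlonglongrightarrow> f x"
    using conv unfolding f_def by eventually_elim (simp add: convergent_LIMSEQ_iff)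
  have rge: "n \<le> r n" for n using r(1) by (simp add: strict_mono_imp_increasing)
  have "L2_Cauchy M (\<lambda>n. X (r n))"
    using X rge unfolding L2_Cauchy_def by (meson order_trans)
  from L2_Cauchy_pointwise[OF this f lim]
  have sub: "L2_tendsto M (\<lambda>n. X (r n)) f sequentially" .
  note sub' = L2_tendstoD[OF sub]
  have "L2_tendsto M X f sequentially"
  proof (rule L2_tendsto_le)
    have "L2_norm M (\<lambda>x. X n x - f x) \<le> sup 0 (L2_norm M (\<lambda>x. X n x - X (r n) x)) + L2_norm M (\<lambda>x. X (r n) x - f x)" for n
      using L2_norm_triangle_mid[OF X2 X2 sub'(1)] by (simp add: sup_absorb2)
    then show "\<forall>\<^sub>F n in sequentially. L2_norm M (\<lambda>x. X n x - f x)
        \<le> L2_norm M (\<lambda>x. X n x - X (r n) x) + L2_norm M (\<lambda>x. X (r n) x - f x)"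
      by (simp add: sup_absorb2)
    have "(\<lambda>n. L2_norm M (\<lambda>x. X n x - X (r n) x)) \<longlonglongrightarrow> 0"
    proof (rule LIMSEQ_I)
      fix e :: real assume "e > 0"
      then obtain N where N: "\<And>m n. m \<ge> N \<Longrightarrow> n \<ge> N \<Longrightarrow> L2_norm M (\<lambda>x. X m x - X n x) \<le> e / 2"
        using X unfolding L2_Cauchy_def by (meson half_gt_zero)
      show "\<exists>N. \<forall>n\<ge>N. norm (L2_norm M (\<lambda>x. X n x - X (r n) x) - 0) < e"
      proof (intro exI[of _ N] allI impI)
        fix n assume "n \<ge> N"
        then show "norm (L2_norm M (\<lambda>x. X n x - X (r n) x) - 0) < e"
          using N[of n "r n"] rge[of n] \<open>e > 0\<close> by simp
      qed
    qed
    from tendsto_add[OF this sub'(3)]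
    show "(\<lambda>n. L2_norm M (\<lambda>x. X n x - X (r n) x) + L2_norm M (\<lambda>x. X (r n) x - f x)) \<longlonglongrightarrow> 0" by simp
  qed (use X2 sub' in auto)
  then show ?thesis using that r(1) lim by blast
qed

lemma L2_tendsto_AE_subseq:
  assumes "L2_tendsto M X f sequentially" "\<And>n. X n \<in> L2 M"
  obtains r where "strict_mono (r :: nat \<Rightarrow> nat)" "AE x in M. (\<lambda>n. X (r n) x) \<longlonglongrightarrow> f x"
proof -
  obtain g r where g: "L2_tendsto M X g sequentially" "strict_mono (r :: nat \<Rightarrow> nat)"
    "AE x in M. (\<lambda>n. X (r n) x) \<longlonglongrightarrow> g x"
    by (rule L2_complete[OF L2_tendsto_imp_Cauchy[OF assms]])
  have "AE x in M. f x = g x"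
    using L2_tendsto_unique[OF assms(1) g(1)] by (simp add: L2_eq_def)
  with g(3) have "AE x in M. (\<lambda>n. X (r n) x) \<longlonglongrightarrow> f x"
    by eventually_elim simp
  then show ?thesis using that g(2) by blast
qed

section \<open>Multiplication semigroups\<close>

lemma L2_bounded_operatorD:
  assumes "L2_bounded_operator M A"
  shows "f \<in> L2 M \<Longrightarrow> A f \<in> L2 M"
    "f \<in> L2 M \<Longrightarrow> g \<in> L2 M \<Longrightarrow> L2_eq M f g \<Longrightarrow> L2_eq M (A f) (A g)"
    "f \<in> L2 M \<Longrightarrow> g \<in> L2 M \<Longrightarrow> L2_eq M (A (\<lambda>x. f x + g x)) (\<lambda>x. A f x + A g x)"
    "f \<in> L2 M \<Longrightarrow> L2_eq M (A (\<lambda>x. c * f x)) (\<lambda>x. c * A f x)"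
  using assms by (auto simp: L2_bounded_operator_def)

lemma L2_bounded_operator_bound:
  assumes "L2_bounded_operator M A"
  obtains C where "C \<ge> 0" "\<And>f. f \<in> L2 M \<Longrightarrow> L2_norm M (A f) \<le> C * L2_norm M f"
proof -
  obtain C where C: "\<And>f. f \<in> L2 M \<Longrightarrow> L2_norm M (A f) \<le> C * L2_norm M f"
    using assms unfolding L2_bounded_operator_def by blast
  have "L2_norm M (A f) \<le> max 0 C * L2_norm M f" if "f \<in> L2 M" for f
    using C[OF that] mult_right_mono[of C "max 0 C" "L2_norm M f"] by simp
  then show ?thesis using that[of "max 0 C"] by auto
qed

lemma L2_bounded_operator_diff:
  assumes A: "L2_bounded_operator M A" and f: "f \<in> L2 M" and g: "g \<in> L2 M"
  shows "L2_eq M (A (\<lambda>x. f x - g x)) (\<lambda>x. A f x - A g x)"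
proof -
  have "AE x in M. A (\<lambda>x. f x + - 1 * g x) x = A f x + A (\<lambda>x. - 1 * g x) x"
    using L2_bounded_operatorD(3)[OF A f L2_cmult[OF g]] unfolding L2_eq_def .
  moreover have "AE x in M. A (\<lambda>x. - 1 * g x) x = - 1 * A g x"
    using L2_bounded_operatorD(4)[OF A g] unfolding L2_eq_def .
  ultimately have "AE x in M. A (\<lambda>x. f x + - 1 * g x) x = A f x - A g x"
    by eventually_elim simp
  then show ?thesis unfolding L2_eq_def by simp
qed

lemma L2_bounded_operator_divide:
  assumes A: "L2_bounded_operator M A" and f: "f \<in> L2 M"
  shows "L2_eq M (A (\<lambda>x. f x / c)) (\<lambda>x. A f x / c)"
  using L2_bounded_operatorD(4)[OF A f, of "inverse c"] by (simp add: field_simps)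

lemma L2_tendsto_bounded_operator:
  assumes A: "L2_bounded_operator M A" and X: "L2_tendsto M X f F"
  shows "L2_tendsto M (\<lambda>s. A (X s)) (A f) F"
proof -
  note X = L2_tendstoD[OF X]
  obtain C where C: "\<And>f. f \<in> L2 M \<Longrightarrow> L2_norm M (A f) \<le> C * L2_norm M f"
    using L2_bounded_operator_bound[OF A] by metis
  show ?thesis
  proof (rule L2_tendsto_le)
    show "A f \<in> L2 M" by (rule L2_bounded_operatorD[OF A X(1)])
    show "\<forall>\<^sub>F s in F. A (X s) \<in> L2 M"
      using X(2) by eventually_elim (rule L2_bounded_operatorD[OF A])
    show "\<forall>\<^sub>F s in F. L2_norm M (\<lambda>x. A (X s) x - A f x) \<le> C * L2_norm M (\<lambda>x. X s x - f x)"
      using X(2)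
    proof eventually_elim
      case (elim s)
      have "L2_norm M (\<lambda>x. A (X s) x - A f x) = L2_norm M (A (\<lambda>x. X s x - f x))"
        using elim X(1) A
        by (intro L2_norm_eq[OF _ _ L2_eq_sym[OF L2_bounded_operator_diff]] L2_diff)
           (auto intro: L2_bounded_operatorD L2_diff)
      also have "\<dots> \<le> C * L2_norm M (\<lambda>x. X s x - f x)"
        by (intro C L2_diff elim X)
      finally show ?case .
    qed
    show "((\<lambda>s. C * L2_norm M (\<lambda>x. X s x - f x)) \<longlongrightarrow> 0) F"
      using tendsto_mult_right_zero[OF X(3)] by simp
  qed
qed

text \<open>A continuous function whose left difference quotients are asymptotically nonpositive cannot
  increase: for every \<open>d > 0\<close>, the set of points at which the graph lies on or above the line of slope \<open>d\<close>
  through its right end is closed, and its infimum cannot be larger than \<open>a\<close>.\<close>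

lemma left_Dini_nonincreasing:
  fixes \<phi> :: "real \<Rightarrow> real"
  assumes cont: "continuous_on {a..b} \<phi>" and "a \<le> b"
    and left: "\<And>t e. a < t \<Longrightarrow> t \<le> b \<Longrightarrow> e > 0 \<Longrightarrow> \<exists>s. a \<le> s \<and> s < t \<and> \<phi> t \<le> \<phi> s + e * (t - s)"
  shows "\<phi> b \<le> \<phi> a"
proof (rule field_le_epsilon)
  fix e :: real assume "e > 0"
  define d where "d = e / (b - a + 1)"
  have "d > 0" using \<open>e > 0\<close> \<open>a \<le> b\<close> by (simp add: d_def)
  define S where "S = {t \<in> {a..b}. \<phi> b - \<phi> t - d * (b - t) \<le> 0}"
  have "closed S"
    unfolding S_def
    by (intro continuous_on_closed_Collect_le continuous_intros cont)
  have "b \<in> S" using \<open>a \<le> b\<close> by (simp add: S_def)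
  have bdd: "bdd_below S" unfolding S_def by (rule bdd_belowI[of _ a]) auto
  have "Inf S \<in> S"
    using closed_contains_Inf[OF _ bdd \<open>closed S\<close>] \<open>b \<in> S\<close> by auto
  have "Inf S = a"
  proof (rule ccontr)
    assume "Inf S \<noteq> a"
    then have "a < Inf S" "Inf S \<le> b" using \<open>Inf S \<in> S\<close> by (auto simp: S_def)
    then obtain s where s: "a \<le> s" "s < Inf S" "\<phi> (Inf S) \<le> \<phi> s + d * (Inf S - s)"
      using left \<open>d > 0\<close> by blast
    have "s \<in> S"
      using s \<open>Inf S \<in> S\<close> by (auto simp: S_def algebra_simps)
    then have "Inf S \<le> s" using bdd by (rule cInf_lower)
    with s show False by simp
  qed
  with \<open>Inf S \<in> S\<close> have "\<phi> b \<le> \<phi> a + d * (b - a)" by (simp add: S_def)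
  also have "d * (b - a) \<le> e"
    unfolding d_def using \<open>e > 0\<close> \<open>a \<le> b\<close> by (simp add: field_simps)
  finally show "\<phi> b \<le> \<phi> a + e" by simp
qed

text \<open>By $1 - e^{-x} \le x$; the bound \<open>c\<close> is the dominating multiplier for difference quotients of the heat flow,
  uniformly down to time \<open>0\<close>.\<close>

lemma exp_minus_diff_quotient_bound:
  fixes c s t :: real
  assumes "c \<ge> 0" "s \<ge> 0" "t \<ge> 0"
  shows "\<bar>(exp (- s * c) - exp (- t * c)) / (s - t)\<bar> \<le> c"
proof -
  have *: "\<bar>exp (- x * c) - exp (- y * c)\<bar> \<le> c * (y - x)" if "0 \<le> x" "x \<le> y" for x y
  proof -
    have "exp (- x * c) - exp (- y * c) = exp (- x * c) * (1 - exp (- (y - x) * c))"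
      by (simp add: algebra_simps flip: exp_add)
    moreover have "1 - exp (- (y - x) * c) \<le> c * (y - x)"
      using exp_ge_add_one_self[of "- (y - x) * c"] by (simp add: algebra_simps)
    moreover have "0 \<le> (y - x) * c" using that assms by simp
    then have "0 \<le> 1 - exp (- (y - x) * c)" by (simp add: minus_mult_left[symmetric] del: minus_diff_eq)
    moreover have "exp (- x * c) \<le> 1" using that assms by simp
    ultimately show ?thesis
      using mult_left_le_one_le[of "1 - exp (- (y - x) * c)" "exp (- x * c)"] by simp
  qed
  have "\<bar>exp (- s * c) - exp (- t * c)\<bar> \<le> c * \<bar>s - t\<bar>"
    using *[of s t] *[of t s] assms by (cases "s \<le> t") (auto simp: abs_minus_commute)
  then show ?thesis
    using assms by (cases "s = t") (auto simp: abs_divide field_simps)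
qed

lemma exp_minus_diff_quotient_tendsto:
  fixes c t :: real
  shows "((\<lambda>s. (exp (- s * c) - exp (- t * c)) / (s - t)) \<longlongrightarrow> - c * exp (- t * c)) (at t)"
proof -
  have "((\<lambda>s. exp (- s * c)) has_real_derivative (- c * exp (- t * c))) (at t)"
    by (auto intro!: derivative_eq_intros)
  then show ?thesis by (simp add: has_field_derivative_iff)
qed

lemma mult_exp_minus_le_1: "x * exp (- x) \<le> (1::real)"
proof -
  have "x \<le> exp x" using exp_ge_add_one_self[of x] by linarith
  then show ?thesis by (simp add: exp_minus field_simps)
qed

text \<open>The setting of the spectral theorem for one positive operator: \<open>F\<close> is a unitary operator and \<open>m\<close> the
  symbol.  Functions stand for their classes, so \<open>F\<close> is linear and onto only up to equality almost everywhere.\<close>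

locale spectral_representation =
  fixes M :: "'a measure" and F :: "('a \<Rightarrow> complex) \<Rightarrow> 'a \<Rightarrow> complex" and m :: "'a \<Rightarrow> real"
  assumes m_measurable [measurable]: "m \<in> borel_measurable M" and m_nonneg: "\<And>x. m x \<ge> 0"
    and F_L2: "\<And>f. f \<in> L2 M \<Longrightarrow> F f \<in> L2 M"
    and F_add: "\<And>f g. f \<in> L2 M \<Longrightarrow> g \<in> L2 M \<Longrightarrow> L2_eq M (F (\<lambda>x. f x + g x)) (\<lambda>x. F f x + F g x)"
    and F_cmult: "\<And>f c. f \<in> L2 M \<Longrightarrow> L2_eq M (F (\<lambda>x. c * f x)) (\<lambda>x. c * F f x)"
    and F_norm: "\<And>f. f \<in> L2 M \<Longrightarrow> L2_norm M (F f) = L2_norm M f"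
    and F_surj: "\<And>g. g \<in> L2 M \<Longrightarrow> \<exists>f\<in>L2 M. L2_eq M (F f) g"
begin

definition Dom :: "('a \<Rightarrow> complex) set" where
  "Dom = {f \<in> L2 M. (\<lambda>\<xi>. of_real (m \<xi>) * F f \<xi>) \<in> L2 M}"

text \<open>The choice picks one representative of a class that is unique because \<open>F\<close> is isometric.\<close>

definition D :: "('a \<Rightarrow> complex) \<Rightarrow> 'a \<Rightarrow> complex" where
  "D f = (SOME h. h \<in> L2 M \<and> L2_eq M (F h) (\<lambda>\<xi>. of_real (m \<xi>) * F f \<xi>))"

lemma F_diff:
  assumes "f \<in> L2 M" "g \<in> L2 M"
  shows "L2_eq M (F (\<lambda>x. f x - g x)) (\<lambda>x. F f x - F g x)"
proof -
  have "L2_eq M (F (\<lambda>x. f x + -1 * g x)) (\<lambda>x. F f x + F (\<lambda>x. -1 * g x) x)"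
    by (intro F_add assms L2_cmult)
  moreover have "L2_eq M (F (\<lambda>x. -1 * g x)) (\<lambda>x. -1 * F g x)"
    by (intro F_cmult assms)
  ultimately have "AE x in M. F (\<lambda>x. f x + -1 * g x) x = F f x - F g x"
    unfolding L2_eq_def by eventually_elim simp
  then show ?thesis by (simp add: L2_eq_def)
qed

lemma F_divide: "f \<in> L2 M \<Longrightarrow> L2_eq M (F (\<lambda>x. f x / c)) (\<lambda>x. F f x / c)"
  using F_cmult[of f "inverse c"] by (simp add: field_simps)

lemma F_uminus: "f \<in> L2 M \<Longrightarrow> L2_eq M (F (\<lambda>x. - f x)) (\<lambda>x. - F f x)"
  using F_cmult[of f "-1"] by simp

lemma F_norm_diff:
  assumes "f \<in> L2 M" "g \<in> L2 M"
  shows "L2_norm M (\<lambda>x. F f x - F g x) = L2_norm M (\<lambda>x. f x - g x)"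
  using F_norm[OF L2_diff[OF assms]]
    L2_norm_eq[OF F_L2[OF L2_diff[OF assms]] L2_diff[OF F_L2 F_L2, OF assms] F_diff[OF assms]]
  by simp

lemma F_eq_iff:
  assumes "f \<in> L2 M" "g \<in> L2 M"
  shows "L2_eq M (F f) (F g) \<longleftrightarrow> L2_eq M f g"
proof
  assume "L2_eq M (F f) (F g)"
  then have "L2_eq M (\<lambda>x. F f x - F g x) (\<lambda>_. 0)"
    unfolding L2_eq_def by eventually_elim simp
  then have "L2_norm M (\<lambda>x. F f x - F g x) = 0"
    using L2_norm_eq[of "\<lambda>x. F f x - F g x" M "\<lambda>_. 0"] assms by (simp add: L2_diff F_L2)
  then show "L2_eq M f g"
    using assms F_norm_diff by (intro L2_eqI_norm) auto
next
  assume "L2_eq M f g"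
  then have "L2_eq M (\<lambda>x. f x - g x) (\<lambda>_. 0)"
    unfolding L2_eq_def by eventually_elim simp
  then have "L2_norm M (\<lambda>x. f x - g x) = 0"
    using L2_norm_eq[of "\<lambda>x. f x - g x" M "\<lambda>_. 0"] assms by (simp add: L2_diff)
  then show "L2_eq M (F f) (F g)"
    using assms F_norm_diff by (intro L2_eqI_norm F_L2) auto
qed

lemma tendsto_F_iff:
  assumes "f \<in> L2 M" "\<forall>\<^sub>F s in G. X s \<in> L2 M"
  shows "L2_tendsto M (\<lambda>s. F (X s)) (F f) G \<longleftrightarrow> L2_tendsto M X f G"
proof -
  have "\<forall>\<^sub>F s in G. L2_norm M (\<lambda>x. F (X s) x - F f x) = L2_norm M (\<lambda>x. X s x - f x)"
    using assms(2) by eventually_elim (rule F_norm_diff[OF _ assms(1)])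
  moreover have "\<forall>\<^sub>F s in G. F (X s) \<in> L2 M"
    using assms(2) by eventually_elim (rule F_L2)
  ultimately show ?thesis
    using assms F_L2 by (auto simp: L2_tendsto_def cong: tendsto_cong)
qed

lemma D_properties:
  assumes "f \<in> Dom"
  shows "f \<in> L2 M" "D f \<in> L2 M" "L2_eq M (F (D f)) (\<lambda>\<xi>. of_real (m \<xi>) * F f \<xi>)"
proof -
  show "f \<in> L2 M" using assms by (simp add: Dom_def)
  have "\<exists>h. h \<in> L2 M \<and> L2_eq M (F h) (\<lambda>\<xi>. of_real (m \<xi>) * F f \<xi>)"
    using F_surj[of "\<lambda>\<xi>. of_real (m \<xi>) * F f \<xi>"] assms by (auto simp: Dom_def)
  from someI_ex[OF this] show "D f \<in> L2 M" "L2_eq M (F (D f)) (\<lambda>\<xi>. of_real (m \<xi>) * F f \<xi>)"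
    by (auto simp: D_def)
qed

text \<open>On the spectral side, domain and value merge into one equation: if \<open>- m * F f\<close> agrees with the square
  integrable function \<open>F g\<close>, then it is itself square integrable.\<close>

lemma minus_D_iff:
  assumes "f \<in> L2 M" "g \<in> L2 M"
  shows "f \<in> Dom \<and> L2_eq M g (\<lambda>x. - D f x) \<longleftrightarrow> L2_eq M (F g) (\<lambda>\<xi>. - of_real (m \<xi>) * F f \<xi>)"
proof
  assume f: "f \<in> Dom \<and> L2_eq M g (\<lambda>x. - D f x)"
  then have "L2_eq M (F g) (F (\<lambda>x. - D f x))"
    using F_eq_iff[OF assms(2) L2_uminus] D_properties by blast
  moreover have "L2_eq M (F (\<lambda>x. - D f x)) (\<lambda>x. - F (D f) x)"
    using f by (intro F_uminus D_properties) auto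
  ultimately show "L2_eq M (F g) (\<lambda>\<xi>. - of_real (m \<xi>) * F f \<xi>)"
    using D_properties(3)[of f] f unfolding L2_eq_def by auto
next
  assume g: "L2_eq M (F g) (\<lambda>\<xi>. - of_real (m \<xi>) * F f \<xi>)"
  have "(\<lambda>\<xi>. of_real (m \<xi>) * F f \<xi>) \<in> L2 M"
    by (rule L2_cong_AE[OF L2_uminus[OF F_L2[OF assms(2)]]])
       (use g F_L2[OF assms(1)] in \<open>auto simp: L2_eq_def dest: L2_measurable\<close>)
  then have f: "f \<in> Dom" using assms by (simp add: Dom_def)
  have "L2_eq M (F g) (F (\<lambda>x. - D f x))"
    using F_uminus[OF D_properties(2)[OF f]] D_properties(3)[OF f] g unfolding L2_eq_def by auto
  then have "L2_eq M g (\<lambda>x. - D f x)"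
    using F_eq_iff[OF assms(2) L2_uminus] D_properties[OF f] by blast
  with f show "f \<in> Dom \<and> L2_eq M g (\<lambda>x. - D f x)" by simp
qed

text \<open>The equation is imposed on the spectral side, where it includes the requirement that the curve stay in
  the domain (lemma \<open>minus_D_iff\<close>).\<close>

definition flow :: "(real \<Rightarrow> 'a \<Rightarrow> complex) \<Rightarrow> (real \<Rightarrow> 'a \<Rightarrow> complex) \<Rightarrow> bool" where
  "flow w v \<longleftrightarrow> (\<forall>t\<ge>0. w t \<in> L2 M \<and>
     L2_tendsto M (\<lambda>s x. (w s x - w t x) / of_real (s - t)) (v t) (at t within {0..}) \<and>
     L2_eq M (F (v t)) (\<lambda>\<xi>. - of_real (m \<xi>) * F (w t) \<xi>))"

lemma flow_diff:
  assumes "flow w v" "flow w' v'"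
  shows "flow (\<lambda>t x. w t x - w' t x) (\<lambda>t x. v t x - v' t x)"
  unfolding flow_def
proof (intro allI impI conjI)
  fix t :: real assume "t \<ge> 0"
  then have w: "w t \<in> L2 M" "w' t \<in> L2 M"
    and q: "L2_tendsto M (\<lambda>s x. (w s x - w t x) / of_real (s - t)) (v t) (at t within {0..})"
      "L2_tendsto M (\<lambda>s x. (w' s x - w' t x) / of_real (s - t)) (v' t) (at t within {0..})"
    and e: "L2_eq M (F (v t)) (\<lambda>\<xi>. - of_real (m \<xi>) * F (w t) \<xi>)"
      "L2_eq M (F (v' t)) (\<lambda>\<xi>. - of_real (m \<xi>) * F (w' t) \<xi>)"
    using assms by (auto simp: flow_def)
  show "(\<lambda>x. w t x - w' t x) \<in> L2 M" using w by (rule L2_diff)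
  show "L2_tendsto M (\<lambda>s x. (w s x - w' s x - (w t x - w' t x)) / of_real (s - t))
      (\<lambda>x. v t x - v' t x) (at t within {0..})"
    using L2_tendsto_diff[OF q] by (simp add: diff_divide_distrib[symmetric] algebra_simps)
  have "L2_eq M (F (\<lambda>x. v t x - v' t x)) (\<lambda>x. F (v t) x - F (v' t) x)"
    using q by (intro F_diff) (auto dest: L2_tendstoD)
  moreover have "L2_eq M (F (\<lambda>x. w t x - w' t x)) (\<lambda>x. F (w t) x - F (w' t) x)"
    using w by (intro F_diff)
  ultimately show "L2_eq M (F (\<lambda>x. v t x - v' t x)) (\<lambda>\<xi>. - of_real (m \<xi>) * F (\<lambda>x. w t x - w' t x) \<xi>)"
    using e unfolding L2_eq_def
  proof eventually_elim
    case (elim x)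
    show ?case unfolding elim by (simp add: algebra_simps)
  qed
qed

text \<open>The symbol of \<open>1 + h * D\<close> has modulus at least \<open>1\<close>.\<close>

lemma resolvent_expanding:
  assumes w: "w \<in> L2 M" and v: "v \<in> L2 M" and e: "L2_eq M (F v) (\<lambda>\<xi>. - of_real (m \<xi>) * F w \<xi>)"
    and h: "h \<ge> 0"
  shows "L2_norm M w \<le> L2_norm M (\<lambda>x. w x - of_real h * v x)"
proof -
  have hv: "(\<lambda>x. of_real h * v x) \<in> L2 M" using v by (rule L2_cmult)
  have "L2_norm M w = L2_norm M (F w)" using F_norm[OF w] by simp
  also have "\<dots> \<le> L2_norm M (F (\<lambda>x. w x - of_real h * v x))"
  proof (rule L2_norm_mono[OF F_L2[OF L2_diff[OF w hv]]])
    have "AE x in M. F (\<lambda>x. w x - of_real h * v x) x = F w x - F (\<lambda>x. of_real h * v x) x"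
      "AE x in M. F (\<lambda>x. of_real h * v x) x = of_real h * F v x"
      using F_diff[OF w hv] F_cmult[OF v] by (auto simp: L2_eq_def)
    then show "AE x in M. cmod (F w x) \<le> cmod (F (\<lambda>x. w x - of_real h * v x) x)"
      using e[unfolded L2_eq_def]
    proof eventually_elim
      case (elim x)
      then have "F (\<lambda>x. w x - of_real h * v x) x = of_real (1 + h * m x) * F w x"
        by (simp add: algebra_simps)
      moreover have "1 * cmod (F w x) \<le> \<bar>1 + h * m x\<bar> * cmod (F w x)"
        using h m_nonneg[of x] by (intro mult_right_mono) auto
      ultimately show ?case by (simp add: norm_mult del: of_real_add of_real_mult)
    qed
  qed
  also have "\<dots> = L2_norm M (\<lambda>x. w x - of_real h * v x)"
    by (rule F_norm[OF L2_diff[OF w hv]])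
  finally show ?thesis .
qed

text \<open>Since \<open>D\<close> is positive, stepping backwards in time along the tangent does not decrease the norm,
  so the norm of a solution is nonincreasing.\<close>

lemma flow_norm_le:
  assumes "flow w v" "t \<ge> 0"
  shows "L2_norm M (w t) \<le> L2_norm M (w 0)"
proof (rule left_Dini_nonincreasing[of 0 t "\<lambda>t. L2_norm M (w t)"])
  have w: "w t \<in> L2 M" if "t \<ge> 0" for t
    using assms that by (auto simp: flow_def)
  have q: "L2_tendsto M (\<lambda>s x. (w s x - w t x) / of_real (s - t)) (v t) (at t within {0..})"
    if "t \<ge> 0" for t
    using assms that by (auto simp: flow_def)
  show "continuous_on {0..t} (\<lambda>t. L2_norm M (w t))"
  proof (rule continuous_on_subset)
    show "continuous_on {0..} (\<lambda>t. L2_norm M (w t))"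
      unfolding continuous_on_def
    proof
      fix t :: real assume "t \<in> {0..}"
      then have t: "t \<ge> 0" by simp
      let ?Q = "\<lambda>s. L2_norm M (\<lambda>x. (w s x - w t x) / of_real (s - t))"
      have "((\<lambda>s. \<bar>s - t\<bar> * ?Q s) \<longlongrightarrow> \<bar>t - t\<bar> * L2_norm M (v t)) (at t within {0..})"
        by (intro tendsto_intros L2_tendsto_norm q t)
      then have lim: "((\<lambda>s. \<bar>s - t\<bar> * ?Q s) \<longlongrightarrow> 0) (at t within {0..})" by simp
      have "\<forall>\<^sub>F s in at t within {0..}. norm (L2_norm M (w s) - L2_norm M (w t)) \<le> \<bar>s - t\<bar> * ?Q s"
        unfolding eventually_at_filter
      proof (intro always_eventually allI impI)
        fix s assume "s \<noteq> t" "s \<in> {0..}"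
        then show "norm (L2_norm M (w s) - L2_norm M (w t)) \<le> \<bar>s - t\<bar> * ?Q s"
          using L2_norm_diff_ge[OF w w, of s t] t
          by (simp add: L2_norm_divide flip: of_real_diff)
      qed
      from Lim_null_comparison[OF this lim]
      show "((\<lambda>t. L2_norm M (w t)) \<longlongrightarrow> L2_norm M (w t)) (at t within {0..})"
        by (simp add: LIM_zero_iff)
    qed
  qed auto
  fix t e :: real assume t: "0 < t" and "e > 0"
  have vt: "v t \<in> L2 M" "L2_eq M (F (v t)) (\<lambda>\<xi>. - of_real (m \<xi>) * F (w t) \<xi>)"
    using L2_tendstoD(1)[OF q] assms t by (auto simp: flow_def)
  have "\<forall>\<^sub>F s in at t within {0..}. L2_norm M (\<lambda>x. (w s x - w t x) / of_real (s - t) - v t x) < e"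
    using order_tendstoD(2)[OF L2_tendstoD(3)[OF q]] t \<open>e > 0\<close> by simp
  then obtain d where "d > 0" and d: "\<And>s. s \<ge> 0 \<Longrightarrow> s \<noteq> t \<Longrightarrow> dist s t < d \<Longrightarrow>
      L2_norm M (\<lambda>x. (w s x - w t x) / of_real (s - t) - v t x) < e"
    unfolding eventually_at by auto
  define s where "s = max 0 (t - d / 2)"
  have s: "0 \<le> s" "s < t" "dist s t < d"
    using t \<open>d > 0\<close> by (auto simp: s_def dist_real_def)
  have "L2_norm M (w t) \<le> L2_norm M (\<lambda>x. w t x - of_real (t - s) * v t x)"
    using s t by (intro resolvent_expanding w vt) auto
  also have "(\<lambda>x. w t x - of_real (t - s) * v t x)
      = (\<lambda>x. w s x - of_real (s - t) * ((w s x - w t x) / of_real (s - t) - v t x))"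
  proof
    fix x
    have "of_real (s - t) * ((w s x - w t x) / of_real (s - t)) = w s x - w t x"
      using s by (simp del: of_real_diff)
    then show "w t x - of_real (t - s) * v t x
        = w s x - of_real (s - t) * ((w s x - w t x) / of_real (s - t) - v t x)"
      unfolding right_diff_distrib by (simp add: algebra_simps)
  qed
  also have "L2_norm M \<dots> \<le> L2_norm M (w s) + L2_norm M (\<lambda>x. of_real (s - t) * ((w s x - w t x) / of_real (s - t) - v t x))"
    using s t by (intro L2_norm_triangle_diff w L2_cmult L2_diff L2_divide vt) auto
  also have "\<dots> = L2_norm M (w s) + (t - s) * L2_norm M (\<lambda>x. (w s x - w t x) / of_real (s - t) - v t x)"
    using s by (simp only: L2_norm_cmult norm_of_real) simp
  also have "\<dots> \<le> L2_norm M (w s) + e * (t - s)"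
    using d[of s] s by (simp add: mult.commute mult_left_mono)
  finally show "\<exists>s. 0 \<le> s \<and> s < t \<and> L2_norm M (w t) \<le> L2_norm M (w s) + e * (t - s)"
    using s by blast
qed (use assms in auto)

lemma flow_unique:
  assumes "flow w v" "flow w' v'" "L2_eq M (w 0) (w' 0)" "t \<ge> 0"
  shows "L2_eq M (w t) (w' t)"
proof -
  have w: "w t \<in> L2 M" "w' t \<in> L2 M" if "t \<ge> 0" for t
    using assms that by (auto simp: flow_def)
  have "L2_norm M (\<lambda>x. w t x - w' t x) \<le> L2_norm M (\<lambda>x. w 0 x - w' 0 x)"
    using flow_norm_le[OF flow_diff[OF assms(1,2)] assms(4)] .
  also have "\<dots> = L2_norm M (\<lambda>x. 0 :: complex)"
    using assms(3) by (intro L2_norm_eq L2_diff w) (auto simp: L2_eq_def)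
  finally have "L2_norm M (\<lambda>x. w t x - w' t x) = 0"
    using L2_norm_nonneg[of M "\<lambda>x. w t x - w' t x"] by simp
  then show ?thesis using w assms(4) by (intro L2_eqI_norm) auto
qed

end

subsection \<open>Uniform boundedness near the initial time\<close>

text \<open>\<open>K\<close> is the operator norm; the gliding hump below adds up multiples of its almost maximizing vectors.\<close>

lemma L2_bounded_operator_opnorm:
  assumes A: "L2_bounded_operator M A"
  obtains K where "K \<ge> 0" "\<And>f. f \<in> L2 M \<Longrightarrow> L2_norm M (A f) \<le> K * L2_norm M f"
    "\<And>c. c < K \<Longrightarrow> \<exists>f\<in>L2 M. L2_norm M f \<le> 1 \<and> L2_norm M (A f) > c"
proof -
  obtain C where C: "C \<ge> 0" "\<And>f. f \<in> L2 M \<Longrightarrow> L2_norm M (A f) \<le> C * L2_norm M f"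
    using L2_bounded_operator_bound[OF A] by blast
  define S where "S = (\<lambda>f. L2_norm M (A f)) ` {f \<in> L2 M. L2_norm M f \<le> 1}"
  have bdd: "bdd_above S"
  proof (rule bdd_aboveI[of _ C])
    fix y assume "y \<in> S"
    then obtain f where "f \<in> L2 M" "L2_norm M f \<le> 1" "y = L2_norm M (A f)" by (auto simp: S_def)
    then show "y \<le> C" using C(2)[of f] mult_left_le[of "L2_norm M f" C] C(1) by linarith
  qed
  have mem: "L2_norm M (A f) \<in> S" if "f \<in> L2 M" "L2_norm M f \<le> 1" for f
    using that by (auto simp: S_def)
  have "S \<noteq> {}" using mem[of "\<lambda>_. 0"] by auto
  show ?thesis
  proof (rule that[of "Sup S"])
    show "0 \<le> Sup S"
      by (rule order_trans[OF L2_norm_nonneg cSup_upper[OF mem[of "\<lambda>_. 0"] bdd]]) auto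
    show "L2_norm M (A f) \<le> Sup S * L2_norm M f" if f: "f \<in> L2 M" for f
    proof (cases "L2_norm M f = 0")
      case True
      then show ?thesis using C(2)[OF f] by simp
    next
      case False
      then have pos: "L2_norm M f > 0" using L2_norm_nonneg[of M f] by linarith
      let ?g = "\<lambda>x. f x / of_real (L2_norm M f)"
      have "L2_norm M (A ?g) = L2_norm M (\<lambda>x. A f x / of_real (L2_norm M f))"
        using A f by (intro L2_norm_eq L2_bounded_operator_divide)
          (auto intro: L2_bounded_operatorD(1) L2_divide)
      then have "L2_norm M (A f) / L2_norm M f = L2_norm M (A ?g)"
        using pos by (simp add: L2_norm_divide)
      also have "\<dots> \<le> Sup S"
        using pos by (intro cSup_upper mem bdd L2_divide f) (simp add: L2_norm_divide)
      finally show ?thesis using pos by (simp add: field_simps)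
    qed
    show "\<exists>f\<in>L2 M. L2_norm M f \<le> 1 \<and> L2_norm M (A f) > c" if "c < Sup S" for c
      using that less_cSup_iff[OF \<open>S \<noteq> {}\<close> bdd, of c] by (auto simp: S_def)
  qed
qed

text \<open>\<open>A x + A f\<close> and \<open>A x - A f\<close> differ by \<open>2 * A f\<close>, so they cannot both be shorter than \<open>A f\<close>.\<close>

lemma bounded_operator_perturb_sign:
  assumes A: "L2_bounded_operator M A" and x: "x \<in> L2 M" and f: "f \<in> L2 M"
  obtains \<sigma> :: complex where "cmod \<sigma> = 1"
    "L2_norm M (A (\<lambda>z. x z + \<sigma> * f z)) \<ge> L2_norm M (A f)"
proof -
  have Ax: "A x \<in> L2 M" "A f \<in> L2 M" using L2_bounded_operatorD(1)[OF A] x f by auto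
  have eq: "L2_norm M (A (\<lambda>z. x z + \<sigma> * f z)) = L2_norm M (\<lambda>z. A x z + \<sigma> * A f z)" for \<sigma>
  proof (rule L2_norm_eq)
    have "L2_eq M (A (\<lambda>z. x z + \<sigma> * f z)) (\<lambda>z. A x z + A (\<lambda>z. \<sigma> * f z) z)"
      by (intro L2_bounded_operatorD(3)[OF A] x L2_cmult f)
    then show "L2_eq M (A (\<lambda>z. x z + \<sigma> * f z)) (\<lambda>z. A x z + \<sigma> * A f z)"
      using L2_bounded_operatorD(4)[OF A f, of \<sigma>] unfolding L2_eq_def by eventually_elim simp
    show "A (\<lambda>z. x z + \<sigma> * f z) \<in> L2 M"
      by (intro L2_bounded_operatorD(1)[OF A] L2_add L2_cmult x f)
    show "(\<lambda>z. A x z + \<sigma> * A f z) \<in> L2 M"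
      by (intro L2_add L2_cmult Ax)
  qed
  have "2 * L2_norm M (A f) = L2_norm M (\<lambda>z. 2 * A f z)"
    using L2_norm_cmult[of M 2] by simp
  also have "\<dots> = L2_norm M (\<lambda>z. (A x z + 1 * A f z) - (A x z + - 1 * A f z))"
    by (simp add: algebra_simps)
  also have "\<dots> \<le> L2_norm M (\<lambda>z. A x z + 1 * A f z) + L2_norm M (\<lambda>z. A x z + - 1 * A f z)"
    by (intro L2_norm_triangle_diff L2_add L2_cmult Ax)
  finally have "L2_norm M (A f) \<le> L2_norm M (A (\<lambda>z. x z + 1 * f z))
      \<or> L2_norm M (A f) \<le> L2_norm M (A (\<lambda>z. x z + - 1 * f z))"
    unfolding eq by linarith
  then show ?thesis using that[of 1] that[of "-1"] by auto
qed

text \<open>The bound is the geometric tail $\sum_{k > n} 3^{-k} = 3^{-n}/2$.  It has to stay below the factor \<open>2/3\<close> by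
  which the gliding hump approaches the operator norm.\<close>

lemma geometric_increments_limit:
  assumes X: "\<And>n. X n \<in> L2 M" and step: "\<And>n. L2_norm M (\<lambda>z. X (Suc n) z - X n z) \<le> (1/3)^n"
  obtains x where "x \<in> L2 M" "\<And>n. L2_norm M (\<lambda>z. x z - X (Suc n) z) \<le> (1/3)^n / 2"
proof -
  have tele: "L2_norm M (\<lambda>z. X (n + k) z - X n z) \<le> 3/2 * (1/3)^n * (1 - (1/3)^k)" for n k
  proof (induction k)
    case (Suc k)
    have "L2_norm M (\<lambda>z. X (n + Suc k) z - X n z)
        \<le> L2_norm M (\<lambda>z. X (Suc (n + k)) z - X (n + k) z) + L2_norm M (\<lambda>z. X (n + k) z - X n z)"
      using L2_norm_triangle_mid[OF X[of "Suc (n + k)"] X[of "n + k"] X[of n]] by simp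
    also have "\<dots> \<le> (1/3)^(n + k) + 3/2 * (1/3)^n * (1 - (1/3)^k)"
      by (intro add_mono step Suc)
    also have "\<dots> = 3/2 * (1/3)^n * (1 - (1/3)^Suc k)"
      by (simp add: power_add field_simps)
    finally show ?case .
  qed simp
  have bnd: "L2_norm M (\<lambda>z. X k z - X n z) \<le> 3/2 * (1/3)^n" if "k \<ge> n" for n k
  proof -
    have "3/2 * (1/3)^n * (1 - (1/3)^(k - n)) \<le> 3/2 * (1/3::real)^n * 1"
      by (intro mult_left_mono) auto
    with order_trans[OF tele[of n "k - n"] this] that show ?thesis by simp
  qed
  have "L2_Cauchy M X"
    unfolding L2_Cauchy_def
  proof (intro conjI allI impI X)
    fix e :: real assume "e > 0"
    have "(\<lambda>n. 3/2 * (1/3::real)^n) \<longlonglongrightarrow> 3/2 * 0"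
      by (intro tendsto_mult tendsto_const LIMSEQ_power_zero) simp
    then have "\<forall>\<^sub>F n in sequentially. 3/2 * (1/3::real)^n < e"
      using \<open>e > 0\<close> by (intro order_tendstoD(2)) auto
    then obtain N where N: "\<And>n. n \<ge> N \<Longrightarrow> 3/2 * (1/3::real)^n < e" by (auto simp: eventually_sequentially)
    show "\<exists>N. \<forall>k\<ge>N. \<forall>n\<ge>N. L2_norm M (\<lambda>z. X k z - X n z) \<le> e"
    proof (intro exI[of _ N] allI impI)
      fix k n assume kn: "N \<le> k" "N \<le> n"
      show "L2_norm M (\<lambda>z. X k z - X n z) \<le> e"
      proof (cases "k \<ge> n")
        case True
        then show ?thesis using bnd[OF True] N[of n] kn by linarith
      next
        case False
        then show ?thesis
          using bnd[of k n] N[of k] kn L2_norm_minus_commute[of M "X k" "X n"] by simp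
      qed
    qed
  qed
  then obtain x where x: "L2_tendsto M X x sequentially"
    using L2_complete by metis
  show ?thesis
  proof (rule that[of x])
    show "x \<in> L2 M" using x by (rule L2_tendstoD)
    fix n
    have "(\<lambda>k. L2_norm M (\<lambda>z. X k z - X (Suc n) z)) \<longlonglongrightarrow> L2_norm M (\<lambda>z. x z - X (Suc n) z)"
      by (intro L2_tendsto_norm L2_tendsto_diff x L2_tendsto_const X)
    then show "L2_norm M (\<lambda>z. x z - X (Suc n) z) \<le> (1/3)^n / 2"
      by (rule LIMSEQ_le_const2) (use bnd[of "Suc n"] in \<open>auto intro!: exI[of _ "Suc n"]\<close>)
  qed
qed

text \<open>The gliding hump of the uniform boundedness principle.  If the norm of \<open>A n\<close> exceeds \<open>4 ^ n\<close>, add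
  successively multiples of size \<open>3 ^ - n\<close> of almost maximizing vectors, each with the sign that does not
  shorten the image under \<open>A n\<close>.  The step of index \<open>n\<close> produces at least \<open>2/3\<close> of the norm of \<open>A n\<close> times
  \<open>3 ^ - n\<close>, all later steps together destroy at most \<open>1/2\<close> of it, and \<open>2/3 - 1/2 = 1/6\<close>.\<close>

lemma uniform_boundedness_sequence:
  assumes A: "\<And>n. L2_bounded_operator M (A n)"
    and big: "\<And>n. \<exists>f\<in>L2 M. L2_norm M (A n f) > 4^n * L2_norm M f"
  shows "\<exists>x\<in>L2 M. \<forall>n. L2_norm M (A n x) \<ge> (4/3)^n / 6"
proof -
  have "\<exists>K. K \<ge> 0 \<and> (\<forall>f\<in>L2 M. L2_norm M (A n f) \<le> K * L2_norm M f) \<and>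
      (\<forall>c<K. \<exists>f\<in>L2 M. L2_norm M f \<le> 1 \<and> L2_norm M (A n f) > c)" for n
    using L2_bounded_operator_opnorm[OF A[of n]] by metis
  then obtain K where K: "\<And>n. K n \<ge> 0" "\<And>n f. f \<in> L2 M \<Longrightarrow> L2_norm M (A n f) \<le> K n * L2_norm M f"
    "\<And>n c. c < K n \<Longrightarrow> \<exists>f\<in>L2 M. L2_norm M f \<le> 1 \<and> L2_norm M (A n f) > c"
    by metis
  have Kbig: "K n > 4^n" for n
  proof -
    obtain f where f: "f \<in> L2 M" "L2_norm M (A n f) > 4^n * L2_norm M f" using big by blast
    then have "4^n * L2_norm M f < K n * L2_norm M f" using K(2)[OF f(1), of n] by linarith
    then show ?thesis by (simp add: mult_less_cancel_right)
  qed
  then have Kpos: "K n > 0" for n by (rule less_trans[rotated]) simp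
  have "\<exists>f\<in>L2 M. L2_norm M f \<le> 1 \<and> L2_norm M (A n f) > 2/3 * K n" for n
    using Kpos[of n] by (intro K(3)) simp
  then obtain f where f: "\<And>n. f n \<in> L2 M" "\<And>n. L2_norm M (f n) \<le> 1" "\<And>n. L2_norm M (A n (f n)) > 2/3 * K n"
    by metis
  define P where "P n x y \<longleftrightarrow> y \<in> L2 M \<and> L2_norm M (\<lambda>z. y z - x z) \<le> (1/3)^n \<and>
      L2_norm M (A n y) \<ge> (1/3)^n * (2/3 * K n)" for n x y
  have ex: "\<exists>y. P n x y" if x: "x \<in> L2 M" for n x
  proof -
    let ?g = "\<lambda>z. (1/3)^n * f n z"
    have g: "?g \<in> L2 M" by (intro L2_cmult f)
    obtain \<sigma> where \<sigma>: "cmod \<sigma> = 1" "L2_norm M (A n (\<lambda>z. x z + \<sigma> * ?g z)) \<ge> L2_norm M (A n ?g)"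
      by (rule bounded_operator_perturb_sign[OF A x g])
    have "L2_norm M (A n ?g) = L2_norm M (\<lambda>z. (1/3)^n * A n (f n) z)"
      using g f by (intro L2_norm_eq L2_bounded_operatorD(1,4)[OF A] L2_cmult)
    also have "\<dots> = (1/3)^n * L2_norm M (A n (f n))"
      by (simp add: L2_norm_cmult norm_power norm_divide)
    also have "\<dots> \<ge> (1/3)^n * (2/3 * K n)"
      using f(3)[of n] by (intro mult_left_mono) auto
    finally have "(1/3)^n * (2/3 * K n) \<le> L2_norm M (A n (\<lambda>z. x z + \<sigma> * ?g z))" using \<sigma>(2) by linarith
    moreover have "L2_norm M (\<lambda>z. (x z + \<sigma> * ?g z) - x z) \<le> (1/3)^n"
      using \<sigma>(1) f(2)[of n] by (simp add: L2_norm_cmult norm_power norm_divide mult_left_le)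
    ultimately have "P n x (\<lambda>z. x z + \<sigma> * ?g z)"
      unfolding P_def by (intro conjI L2_add L2_cmult x f)
    then show ?thesis by blast
  qed
  define X where "X = rec_nat (\<lambda>z. 0) (\<lambda>n x. SOME y. P n x y)"
  have step: "P n (X n) (X (Suc n))" if "X n \<in> L2 M" for n
    using someI_ex[OF ex[OF that]] by (simp add: X_def)
  have X_L2: "X n \<in> L2 M" for n
  proof (induction n)
    case (Suc n)
    then show ?case using step by (simp add: P_def)
  qed (simp add: X_def)
  note X = X_L2 step[OF X_L2]
  obtain x where x: "x \<in> L2 M" "\<And>n. L2_norm M (\<lambda>z. x z - X (Suc n) z) \<le> (1/3)^n / 2"
    by (rule geometric_increments_limit[of X M]) (use X(1) in simp, use X(2) in \<open>auto simp: P_def\<close>)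
  have "L2_norm M (A n x) \<ge> (4/3)^n / 6" for n
  proof -
    have AX: "A n (X (Suc n)) \<in> L2 M" "A n x \<in> L2 M" using L2_bounded_operatorD(1)[OF A] x X by auto
    have "(1/3)^n * (2/3 * K n) \<le> L2_norm M (A n (X (Suc n)))"
      using X(2)[of n] by (simp add: P_def)
    also have "\<dots> \<le> L2_norm M (A n x) + L2_norm M (\<lambda>z. A n x z - A n (X (Suc n)) z)"
      using L2_norm_diff_ge[OF AX(2,1)] by linarith
    also have "L2_norm M (\<lambda>z. A n x z - A n (X (Suc n)) z) = L2_norm M (A n (\<lambda>z. x z - X (Suc n) z))"
      by (intro L2_norm_eq[OF _ _ L2_eq_sym[OF L2_bounded_operator_diff[OF A]]] L2_diff AX x X
            L2_bounded_operatorD(1)[OF A])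
    also have "\<dots> \<le> K n * L2_norm M (\<lambda>z. x z - X (Suc n) z)"
      by (intro K L2_diff x X)
    also have "\<dots> \<le> K n * ((1/3)^n / 2)"
      by (intro mult_left_mono x K)
    finally have "K n * ((1/3)^n / 6) \<le> L2_norm M (A n x)" by (simp add: field_simps)
    moreover have "4^n * ((1/3)^n / 6) \<le> K n * ((1/3::real)^n / 6)"
      using Kbig[of n] by (intro mult_right_mono) auto
    ultimately show ?thesis by (simp add: power_mult_distrib[symmetric])
  qed
  with x(1) show ?thesis by blast
qed

lemma C0_semigroupD:
  assumes "C0_semigroup M S"
  shows "t \<ge> 0 \<Longrightarrow> L2_bounded_operator M (S t)"
    "f \<in> L2 M \<Longrightarrow> L2_eq M (S 0 f) f"
    "s \<ge> 0 \<Longrightarrow> t \<ge> 0 \<Longrightarrow> f \<in> L2 M \<Longrightarrow> L2_eq M (S (s + t) f) (S s (S t f))"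
    "f \<in> L2 M \<Longrightarrow> L2_tendsto M (\<lambda>t. S t f) f (at_right 0)"
    "t \<ge> 0 \<Longrightarrow> f \<in> L2 M \<Longrightarrow> S t f \<in> L2 M"
  using assms by (auto simp: C0_semigroup_def L2_bounded_operatorD(1))

text \<open>Without a bound, operators of norm above \<open>4 ^ n\<close> would occur at times that tend to \<open>0\<close>, and a vector with
  unbounded orbit would contradict strong continuity at \<open>0\<close>.\<close>

lemma C0_semigroup_bounded_near_0:
  assumes S: "C0_semigroup M S"
  obtains C d where "d > 0" "C \<ge> 1" "\<And>t f. 0 \<le> t \<Longrightarrow> t \<le> d \<Longrightarrow> f \<in> L2 M \<Longrightarrow> L2_norm M (S t f) \<le> C * L2_norm M f"
proof -
  note S = C0_semigroupD[OF S]
  have "\<exists>n::nat. \<forall>t\<in>{0..1 / Suc n}. \<forall>f\<in>L2 M. L2_norm M (S t f) \<le> 4^n * L2_norm M f"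
  proof (rule ccontr)
    assume "\<not> ?thesis"
    then have "\<forall>n. \<exists>t. t \<in> {0..1 / Suc n} \<and> (\<exists>f\<in>L2 M. L2_norm M (S t f) > 4^n * L2_norm M f)"
      by (metis linorder_not_le)
    then obtain \<tau> where \<tau>: "\<And>n. \<tau> n \<in> {0..1 / Suc n}"
      "\<And>n. \<exists>f\<in>L2 M. L2_norm M (S (\<tau> n) f) > 4^n * L2_norm M f" by metis
    have \<tau>_pos: "\<tau> n > 0" for n
    proof (rule ccontr)
      assume "\<not> \<tau> n > 0"
      then have "\<tau> n = 0" using \<tau>(1)[of n] by simp
      then obtain f where f: "f \<in> L2 M" "L2_norm M (S 0 f) > 4^n * L2_norm M f"
        using \<tau>(2)[of n] by auto
      moreover have "L2_norm M (S 0 f) = L2_norm M f"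
        using f S by (intro L2_norm_eq) auto
      moreover have "1 * L2_norm M f \<le> 4^n * L2_norm M f"
        by (intro mult_right_mono) auto
      ultimately show False by simp
    qed
    have "\<tau> \<longlonglongrightarrow> 0"
    proof (rule tendsto_sandwich[OF _ _ tendsto_const])
      show "(\<lambda>n. 1 / real (Suc n)) \<longlonglongrightarrow> 0" using LIMSEQ_inverse_real_of_nat by (simp add: inverse_eq_divide)
    qed (use \<tau>(1) in auto)
    then have lim: "filterlim \<tau> (at_right 0) sequentially"
      using \<tau>_pos by (intro tendsto_imp_filterlim_at_right) auto
    obtain x where x: "x \<in> L2 M" "\<And>n. L2_norm M (S (\<tau> n) x) \<ge> (4/3)^n / 6"
      using uniform_boundedness_sequence[of M "\<lambda>n. S (\<tau> n)"] \<tau>(2) S(1) \<tau>_pos by (metis less_imp_le)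
    have "(\<lambda>n. L2_norm M (S (\<tau> n) x)) \<longlonglongrightarrow> L2_norm M x"
      by (rule filterlim_compose[OF L2_tendsto_norm[OF S(4)[OF x(1)]] lim])
    then have "\<forall>\<^sub>F n in sequentially. L2_norm M (S (\<tau> n) x) < L2_norm M x + 1"
      by (intro order_tendstoD) auto
    then obtain N where N: "\<And>n. n \<ge> N \<Longrightarrow> L2_norm M (S (\<tau> n) x) < L2_norm M x + 1"
      by (auto simp: eventually_sequentially)
    obtain k where k: "6 * (L2_norm M x + 1) < (4/3)^k"
      using real_arch_pow[of "4/3"] by auto
    have "(4/3::real)^k \<le> (4/3)^(max N k)" by (intro power_increasing) auto
    with k x(2)[of "max N k"] N[of "max N k"] show False by simp
  qed
  then obtain n :: nat where "\<And>t f. t \<in> {0..1 / Suc n} \<Longrightarrow> f \<in> L2 M \<Longrightarrow> L2_norm M (S t f) \<le> 4^n * L2_norm M f"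
    by blast
  then show ?thesis
    by (intro that[of "1 / Suc n" "4^n"]) auto
qed

text \<open>The semigroup law propagates the bound in steps of length \<open>d\<close>.\<close>

lemma C0_semigroup_bounded:
  assumes S: "C0_semigroup M S"
  obtains C where "C \<ge> 0" "\<And>t f. 0 \<le> t \<Longrightarrow> t \<le> b \<Longrightarrow> f \<in> L2 M \<Longrightarrow> L2_norm M (S t f) \<le> C * L2_norm M f"
proof -
  obtain C d where d: "d > 0" "C \<ge> 1"
    and C: "\<And>t f. 0 \<le> t \<Longrightarrow> t \<le> d \<Longrightarrow> f \<in> L2 M \<Longrightarrow> L2_norm M (S t f) \<le> C * L2_norm M f"
    by (rule C0_semigroup_bounded_near_0[OF S]) blast
  note S = C0_semigroupD[OF S]
  have *: "\<forall>t f. 0 \<le> t \<longrightarrow> t \<le> of_nat k * d \<longrightarrow> f \<in> L2 M \<longrightarrow> L2_norm M (S t f) \<le> C^(Suc k) * L2_norm M f" for k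
  proof (induction k)
    case 0
    then show ?case using C[of 0] d by auto
  next
    case (Suc k)
    show ?case
    proof (intro allI impI)
      fix t f assume t: "0 \<le> t" "t \<le> of_nat (Suc k) * d" and f: "f \<in> L2 M"
      define s where "s = min d t"
      have s: "0 \<le> s" "s \<le> d" "0 \<le> t - s" "t - s \<le> of_nat k * d"
        using t d by (auto simp: s_def min_def algebra_simps)
      have "L2_norm M (S t f) = L2_norm M (S s (S (t - s) f))"
        using S(3)[OF s(1,3) f] s f S(5) t by (intro L2_norm_eq) auto
      also have "\<dots> \<le> C * L2_norm M (S (t - s) f)"
        using s f S(5) by (intro C) auto
      also have "\<dots> \<le> C * (C^(Suc k) * L2_norm M f)"
        using Suc s f d by (intro mult_left_mono) auto
      finally show "L2_norm M (S t f) \<le> C^(Suc (Suc k)) * L2_norm M f" by (simp add: mult.assoc)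
    qed
  qed
  obtain k :: nat where "b / d < of_nat k" using reals_Archimedean2 by blast
  then have "b \<le> of_nat k * d" using d by (simp add: field_simps)
  then show ?thesis
    using *[of k] d by (intro that[of "C^(Suc k)"]) auto
qed

context spectral_representation
begin

text \<open>Orbits of the domain under a semigroup generated by \<open>- D\<close> are differentiable from both sides; the
  left derivative needs the local boundedness of the semigroup.\<close>

lemma semigroup_flow:
  assumes S: "C0_semigroup M S" and gen: "generated_by M S Dom (\<lambda>f x. - D f x)" and f: "f \<in> Dom"
  shows "flow (\<lambda>t. S t f) (\<lambda>t. S t (\<lambda>x. - D f x))"
  unfolding flow_def
proof (intro allI impI conjI)
  fix t :: real assume t: "t \<ge> 0"
  note S' = C0_semigroupD[OF S]
  define g where "g x = - D f x" for x
  have g: "g \<in> L2 M" unfolding g_def by (intro L2_uminus D_properties f)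
  have f2: "f \<in> L2 M" by (rule D_properties[OF f])
  define q where "q h x = (S h f x - f x) / of_real h" for h x
  have q2: "q h \<in> L2 M" if "h \<ge> 0" for h
    unfolding q_def using that by (intro L2_divide L2_diff S' f2)
  have qg: "L2_tendsto M q g (at_right 0)"
    using gen f f2 g unfolding generated_by_def q_def g_def by auto
  show St: "S t f \<in> L2 M" by (rule S'(5)[OF t f2])
  have shift: "L2_eq M (\<lambda>x. (S (s + h) f x - S s f x) / of_real h) (S s (q h))" if "s \<ge> 0" "h > 0" for s h
  proof -
    have "L2_eq M (S s (q h)) (\<lambda>x. S s (\<lambda>x. S h f x - f x) x / of_real h)"
      unfolding q_def using that by (intro L2_bounded_operator_divide S' L2_diff f2) auto
    moreover have "L2_eq M (S s (\<lambda>x. S h f x - f x)) (\<lambda>x. S s (S h f) x - S s f x)"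
      using that by (intro L2_bounded_operator_diff S' f2) auto
    moreover have "L2_eq M (S (s + h) f) (S s (S h f))"
      using that by (intro S' f2) auto
    ultimately show ?thesis unfolding L2_eq_def by eventually_elim simp
  qed
  have "L2_tendsto M (\<lambda>h x. (S h (S t f) x - S t f x) / of_real h) (S t g) (at_right 0)"
  proof (rule L2_tendsto_cong[OF L2_tendsto_bounded_operator[OF S'(1)[OF t] qg]])
    show "\<forall>\<^sub>F h in at_right 0. (\<lambda>x. (S h (S t f) x - S t f x) / of_real h) \<in> L2 M \<and>
        L2_eq M (S t (q h)) (\<lambda>x. (S h (S t f) x - S t f x) / of_real h)"
      unfolding eventually_at_filter
    proof (intro always_eventually allI impI conjI)
      fix h :: real assume "h \<in> {0<..}"
      then have h: "h > 0" by simp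
      show "(\<lambda>x. (S h (S t f) x - S t f x) / of_real h) \<in> L2 M"
        using h by (intro L2_divide L2_diff S'(5) St) auto
      have "L2_eq M (S (h + t) f) (S h (S t f))"
        using h t by (intro S' f2) auto
      with shift[OF t h] show "L2_eq M (S t (q h)) (\<lambda>x. (S h (S t f) x - S t f x) / of_real h)"
        unfolding L2_eq_def add.commute[of t h] by eventually_elim simp
    qed
  qed (use S'(5)[OF t g] in auto)
  then have "S t f \<in> Dom \<and> L2_eq M (S t g) (\<lambda>x. - D (S t f) x)"
    using gen St S'(5)[OF t g] unfolding generated_by_def by blast
  then have "L2_eq M (F (S t g)) (\<lambda>\<xi>. - of_real (m \<xi>) * F (S t f) \<xi>)"
    using minus_D_iff[OF St S'(5)[OF t g]] by blast
  then show "L2_eq M (F (S t (\<lambda>x. - D f x))) (\<lambda>\<xi>. - of_real (m \<xi>) * F (S t f) \<xi>)"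
    by (simp add: g_def[abs_def])
  obtain C where C: "C \<ge> 0" "\<And>s f. 0 \<le> s \<Longrightarrow> s \<le> t \<Longrightarrow> f \<in> L2 M \<Longrightarrow> L2_norm M (S s f) \<le> C * L2_norm M f"
    by (rule C0_semigroup_bounded[OF S]) blast
  \<comment> \<open>One modulus for both sides: for \<open>s < t\<close> the quotient is \<open>S s\<close> applied to a forward quotient, and replacing
    \<open>S t g\<close> by \<open>S s g\<close> costs the second summand.\<close>
  define \<beta> where "\<beta> h = C * (L2_norm M (\<lambda>x. q h x - g x) + L2_norm M (\<lambda>x. S h g x - g x))" for h
  have \<beta>: "(\<beta> \<longlongrightarrow> 0) (at_right 0)"
    unfolding \<beta>_def
    using tendsto_mult_right_zero[OF tendsto_add_zero[OF L2_tendstoD(3)[OF qg] L2_tendstoD(3)[OF S'(4)[OF g]]]] .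
  have Sdiff: "L2_norm M (\<lambda>x. S s a x - S s b x) \<le> C * L2_norm M (\<lambda>x. a x - b x)"
    if "0 \<le> s" "s \<le> t" "a \<in> L2 M" "b \<in> L2 M" for s a b
  proof -
    have "L2_norm M (\<lambda>x. S s a x - S s b x) = L2_norm M (S s (\<lambda>x. a x - b x))"
      using that by (intro L2_norm_eq[OF _ _ L2_eq_sym[OF L2_bounded_operator_diff]] L2_diff S') auto
    also have "\<dots> \<le> C * L2_norm M (\<lambda>x. a x - b x)"
      by (intro C that L2_diff)
    finally show ?thesis .
  qed
  have bound: "L2_norm M (\<lambda>x. (S s f x - S t f x) / of_real (s - t) - S t g x) \<le> \<beta> \<bar>s - t\<bar>"
    if s: "s \<ge> 0" "s \<noteq> t" for s
  proof (cases "s < t")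
    case False
    then have st: "s > t" using s by simp
    have "L2_norm M (\<lambda>x. (S s f x - S t f x) / of_real (s - t) - S t g x) = L2_norm M (\<lambda>x. S t (q (s - t)) x - S t g x)"
    proof (rule L2_norm_cong_AE)
      show "AE x in M. (S s f x - S t f x) / of_real (s - t) - S t g x = S t (q (s - t)) x - S t g x"
        using shift[of t "s - t"] t st unfolding L2_eq_def by simp
    qed (use s t st in \<open>auto intro!: L2_diff L2_divide S' f2 g q2\<close>)
    also have "\<dots> \<le> C * L2_norm M (\<lambda>x. q (s - t) x - g x)"
      using st t by (intro Sdiff q2 g) auto
    also have "\<dots> \<le> \<beta> \<bar>s - t\<bar>"
      unfolding \<beta>_def using st by (intro mult_left_mono C) auto
    finally show ?thesis .
  next
    case True
    have "L2_norm M (\<lambda>x. (S s f x - S t f x) / of_real (s - t) - S t g x)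
        = L2_norm M (\<lambda>x. (S s (q (t - s)) x - S s g x) + (S s g x - S s (S (t - s) g) x))"
    proof (rule L2_norm_cong_AE)
      have sg: "L2_eq M (S (s + (t - s)) g) (S s (S (t - s) g))"
        using s True by (intro S'(3) g) auto
      have sf: "AE x in M. (S t f x - S s f x) / of_real (t - s) = S s (q (t - s)) x"
        using shift[of s "t - s"] s True by (simp add: L2_eq_def del: of_real_diff)
      have neg: "(S s f x - S t f x) / of_real (s - t) = (S t f x - S s f x) / of_real (t - s)" for x
        by (metis minus_diff_eq minus_divide_divide of_real_minus)
      show "AE x in M. (S s f x - S t f x) / of_real (s - t) - S t g x
          = (S s (q (t - s)) x - S s g x) + (S s g x - S s (S (t - s) g) x)"
        using sf sg unfolding L2_eq_def neg by eventually_elim (simp del: of_real_diff)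
    qed (use s t True in \<open>auto intro!: L2_add L2_diff L2_divide S' f2 g q2\<close>)
    also have "\<dots> \<le> L2_norm M (\<lambda>x. S s (q (t - s)) x - S s g x) + L2_norm M (\<lambda>x. S s g x - S s (S (t - s) g) x)"
      using s True by (intro L2_norm_triangle L2_diff S' q2 g) auto
    also have "\<dots> \<le> C * L2_norm M (\<lambda>x. q (t - s) x - g x) + C * L2_norm M (\<lambda>x. g x - S (t - s) g x)"
      using s True by (intro add_mono Sdiff S' q2 g) auto
    also have "\<dots> = \<beta> \<bar>s - t\<bar>"
      using True by (simp add: \<beta>_def distrib_left L2_norm_minus_commute[of M g])
    finally show ?thesis .
  qed
  have "filterlim (\<lambda>s. \<bar>s - t\<bar>) (at_right 0) (at t within {0..})"
  proof (rule tendsto_imp_filterlim_at_right)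
    have "((\<lambda>s. \<bar>s - t\<bar>) \<longlongrightarrow> \<bar>t - t\<bar>) (at t within {0..})" by (intro tendsto_intros)
    then show "((\<lambda>s. \<bar>s - t\<bar>) \<longlongrightarrow> 0) (at t within {0..})" by simp
  qed (auto simp: eventually_at_filter)
  then have \<beta>0: "((\<lambda>s. \<beta> \<bar>s - t\<bar>) \<longlongrightarrow> 0) (at t within {0..})"
    by (rule filterlim_compose[OF \<beta>])
  have "L2_tendsto M (\<lambda>s x. (S s f x - S t f x) / of_real (s - t)) (S t g) (at t within {0..})"
  proof (rule L2_tendsto_le[OF S'(5)[OF t g] _ _ \<beta>0])
    show "\<forall>\<^sub>F s in at t within {0..}. (\<lambda>x. (S s f x - S t f x) / of_real (s - t)) \<in> L2 M"
      unfolding eventually_at_filter using t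
      by (intro always_eventually allI impI L2_divide L2_diff S' f2) auto
    show "\<forall>\<^sub>F s in at t within {0..}. L2_norm M (\<lambda>x. (S s f x - S t f x) / of_real (s - t) - S t g x) \<le> \<beta> \<bar>s - t\<bar>"
      unfolding eventually_at_filter using bound by (intro always_eventually allI impI) auto
  qed
  then show "L2_tendsto M (\<lambda>s x. (S s f x - S t f x) / of_real (s - t)) (S t (\<lambda>x. - D f x)) (at t within {0..})"
    by (simp add: g_def[abs_def])
qed

end

lemma L2_tendsto_compose:
  assumes "L2_tendsto M X f F" "filterlim r F G"
  shows "L2_tendsto M (\<lambda>s. X (r s)) f G"
  using assms by (auto simp: L2_tendsto_def filterlim_iff dest: filterlim_compose[of _ _ _ r G])

lemma L2_multiplier_tendsto:
  fixes b :: "nat \<Rightarrow> 'a \<Rightarrow> real"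
  assumes [measurable]: "\<And>n. b n \<in> borel_measurable M" "b' \<in> borel_measurable M"
    and f: "f \<in> L2 M" and h: "h \<in> L2 M"
    and bound: "\<And>n x. \<bar>b n x\<bar> * cmod (f x) \<le> cmod (h x)"
    and lim: "\<And>x. (\<lambda>n. b n x) \<longlonglongrightarrow> b' x"
  shows "L2_tendsto M (\<lambda>n x. of_real (b n x) * f x) (\<lambda>x. of_real (b' x) * f x) sequentially"
proof (rule L2_tendsto_dominated[where g = "\<lambda>x. cmod (h x)"])
  have [measurable]: "f \<in> borel_measurable M" using f by (rule L2_measurable)
  show "(\<lambda>x. of_real (b' x) * f x) \<in> borel_measurable M" by measurable
  show "(\<lambda>x. of_real (b n x) * f x) \<in> borel_measurable M" for n by measurable
  show "integrable M (\<lambda>x. (cmod (h x))\<^sup>2)" using h by (rule L2_integrable)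
  show "AE x in M. (\<lambda>n. of_real (b n x) * f x) \<longlonglongrightarrow> of_real (b' x) * f x"
    by (intro always_eventually allI tendsto_intros lim)
  show "AE x in M. cmod (of_real (b n x) * f x) \<le> cmod (h x)" for n
    using bound by (simp add: norm_mult)
qed

text \<open>\<open>T t\<close> is unitarily equivalent to multiplication by \<open>exp (- t * m)\<close>.\<close>

locale heat_representation = spectral_representation M F m
  for M :: "'a measure" and F m +
  fixes T :: "real \<Rightarrow> ('a \<Rightarrow> complex) \<Rightarrow> 'a \<Rightarrow> complex"
  assumes T_0: "T 0 f = f"
    and T_L2: "\<And>t f. t \<ge> 0 \<Longrightarrow> f \<in> L2 M \<Longrightarrow> T t f \<in> L2 M"
    and F_T: "\<And>t f. t \<ge> 0 \<Longrightarrow> f \<in> L2 M \<Longrightarrow>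
      L2_eq M (F (T t f)) (\<lambda>\<xi>. of_real (exp (- t * m \<xi>)) * F f \<xi>)"
begin

lemma T_bounded:
  assumes t: "t \<ge> 0"
  shows "L2_bounded_operator M (T t)"
  unfolding L2_bounded_operator_def
proof (intro conjI ballI allI impI exI[of _ 1])
  note FT = F_T[OF t] and TL = T_L2[OF t]
  show "T t f \<in> L2 M" if "f \<in> L2 M" for f using that by (rule TL)
  fix f assume f: "f \<in> L2 M"
  show "L2_eq M (T t (\<lambda>x. c * f x)) (\<lambda>x. c * T t f x)" for c
  proof (subst F_eq_iff[symmetric])
    show "L2_eq M (F (T t (\<lambda>x. c * f x))) (F (\<lambda>x. c * T t f x))"
      using FT[OF L2_cmult[OF f, of c]] FT[OF f] F_cmult[OF f, of c] F_cmult[OF TL[OF f], of c]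
      unfolding L2_eq_def
    proof eventually_elim
      case (elim x)
      show ?case unfolding elim by simp
    qed
  qed (intro TL L2_cmult f)+
  show "L2_norm M (T t f) \<le> 1 * L2_norm M f"
  proof -
    have "L2_norm M (T t f) = L2_norm M (F (T t f))" using F_norm[OF TL[OF f]] by simp
    also have "\<dots> \<le> L2_norm M (F f)"
    proof (rule L2_norm_mono[OF F_L2[OF f]])
      show "AE x in M. cmod (F (T t f) x) \<le> cmod (F f x)"
        using FT[OF f] unfolding L2_eq_def
      proof eventually_elim
        case (elim x)
        have "exp (- t * m x) * cmod (F f x) \<le> 1 * cmod (F f x)"
          using t m_nonneg[of x] by (intro mult_right_mono) auto
        then show ?case unfolding elim by (simp add: norm_mult del: of_real_exp)
      qed
    qed
    finally show ?thesis using F_norm[OF f] by simp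
  qed
  fix g assume g: "g \<in> L2 M"
  show "L2_eq M (T t (\<lambda>x. f x + g x)) (\<lambda>x. T t f x + T t g x)"
  proof (subst F_eq_iff[symmetric])
    show "L2_eq M (F (T t (\<lambda>x. f x + g x))) (F (\<lambda>x. T t f x + T t g x))"
      using FT[OF L2_add[OF f g]] FT[OF f] FT[OF g] F_add[OF f g] F_add[OF TL[OF f] TL[OF g]]
      unfolding L2_eq_def
    proof eventually_elim
      case (elim x)
      show ?case unfolding elim by (simp add: algebra_simps)
    qed
  qed (intro TL L2_add f g)+
  assume "L2_eq M f g"
  then have "L2_eq M (F f) (F g)" using F_eq_iff[OF f g] by simp
  then have "L2_eq M (F (T t f)) (F (T t g))"
    using FT[OF f] FT[OF g] unfolding L2_eq_def by eventually_elim simp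
  then show "L2_eq M (T t f) (T t g)" using F_eq_iff[OF TL[OF f] TL[OF g]] by simp
qed

lemma T_continuous_at_0:
  assumes f: "f \<in> L2 M"
  shows "L2_tendsto M (\<lambda>t. T t f) f (at_right 0)"
proof (rule L2_tendsto_within_sequentially[OF f])
  show "T s f \<in> L2 M" if "s \<in> {0<..}" for s using that f by (intro T_L2) auto
  fix r :: "nat \<Rightarrow> real" assume r: "\<And>n. r n \<in> {0<..} - {0}" "r \<longlonglongrightarrow> 0"
  then have r0: "r n \<ge> 0" for n using less_imp_le[of 0 "r n"] by simp
  have "L2_tendsto M (\<lambda>n x. of_real (exp (- r n * m x)) * F f x) (\<lambda>x. of_real (exp (- 0 * m x)) * F f x) sequentially"
  proof (rule L2_multiplier_tendsto[OF _ _ F_L2[OF f] F_L2[OF f]])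
    show "\<bar>exp (- r n * m x)\<bar> * cmod (F f x) \<le> cmod (F f x)" for n x
      using r0 m_nonneg by (intro mult_left_le_one_le) auto
    show "(\<lambda>n. exp (- r n * m x)) \<longlonglongrightarrow> exp (- 0 * m x)" for x
      by (intro tendsto_intros r)
  qed measurable
  then have "L2_tendsto M (\<lambda>n. F (T (r n) f)) (F f) sequentially"
  proof (rule L2_tendsto_cong)
    show "\<forall>\<^sub>F n in sequentially. F (T (r n) f) \<in> L2 M \<and>
        L2_eq M (\<lambda>x. of_real (exp (- r n * m x)) * F f x) (F (T (r n) f))"
      by (intro always_eventually allI conjI F_L2 T_L2 f r0 L2_eq_sym[OF F_T])
  qed (use F_L2[OF f] in auto)
  then show "L2_tendsto M (\<lambda>n. T (r n) f) f sequentially"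
    using tendsto_F_iff[OF f, of "\<lambda>n. T (r n) f" sequentially] T_L2[OF r0 f] by simp
qed

lemma T_C0_semigroup: "C0_semigroup M T"
  unfolding C0_semigroup_def
proof (intro conjI allI impI ballI)
  fix s t :: real and f assume st: "s \<ge> 0" "t \<ge> 0" and f: "f \<in> L2 M"
  have "L2_eq M (F (T (s + t) f)) (F (T s (T t f)))"
    using F_T[OF add_nonneg_nonneg[OF st] f] F_T[OF st(1) T_L2[OF st(2) f]] F_T[OF st(2) f]
    unfolding L2_eq_def
  proof eventually_elim
    case (elim x)
    have "exp (- (s + t) * m x) = exp (- s * m x) * exp (- t * m x)"
      by (simp add: algebra_simps flip: exp_add)
    then show ?case unfolding elim by (simp del: of_real_exp)
  qed
  then show "L2_eq M (T (s + t) f) (T s (T t f))"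
    using st f by (subst (asm) F_eq_iff) (auto intro: T_L2)
qed (auto simp: T_0 intro: T_bounded T_continuous_at_0)

lemma F_T_quotient:
  assumes "s \<ge> 0" "t \<ge> 0" and f: "f \<in> L2 M"
  shows "L2_eq M (F (\<lambda>x. (T s f x - T t f x) / of_real (s - t)))
    (\<lambda>\<xi>. of_real ((exp (- s * m \<xi>) - exp (- t * m \<xi>)) / (s - t)) * F f \<xi>)"
  using F_divide[OF L2_diff[OF T_L2[OF assms(1) f] T_L2[OF assms(2) f]], of "of_real (s - t)"]
    F_diff[OF T_L2[OF assms(1) f] T_L2[OF assms(2) f]] F_T[OF assms(1) f] F_T[OF assms(2) f]
  unfolding L2_eq_def
proof eventually_elim
  case (elim x)
  show ?case unfolding elim by (simp add: left_diff_distrib)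
qed

lemma T_Dom:
  assumes "f \<in> Dom" "t \<ge> 0"
  shows "T t f \<in> Dom"
proof -
  note f = D_properties[OF assms(1)]
  have "(\<lambda>\<xi>. of_real (m \<xi>) * F (T t f) \<xi>) \<in> L2 M"
  proof (rule L2_dominated)
    show "(\<lambda>\<xi>. of_real (m \<xi>) * F (T t f) \<xi>) \<in> borel_measurable M"
      using F_L2[OF T_L2[OF assms(2) f(1)]] by (auto dest: L2_measurable)
    show "(\<lambda>\<xi>. of_real (m \<xi>) * F f \<xi>) \<in> L2 M" using assms by (simp add: Dom_def)
    show "AE x in M. cmod (of_real (m x) * F (T t f) x) \<le> cmod (of_real (m x) * F f x)"
      using F_T[OF assms(2) f(1)] unfolding L2_eq_def
    proof eventually_elim
      case (elim x)
      have "exp (- t * m x) * cmod (F f x) \<le> 1 * cmod (F f x)"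
        using assms m_nonneg[of x] by (intro mult_right_mono) auto
      then show ?case unfolding elim by (simp add: norm_mult m_nonneg mult_left_mono del: of_real_exp)
    qed
  qed
  then show ?thesis using T_L2[OF assms(2) f(1)] by (simp add: Dom_def)
qed

text \<open>Since $x e^{-x} \le 1$, the multiplier \<open>m * exp (- t * m)\<close> is bounded by \<open>1 / t\<close>.  This makes the domain dense.\<close>

lemma T_smoothing:
  assumes f: "f \<in> L2 M" and t: "t > 0"
  shows "T t f \<in> Dom"
proof -
  have t0: "t \<ge> 0" using t by simp
  have "(\<lambda>\<xi>. of_real (m \<xi>) * F (T t f) \<xi>) \<in> L2 M"
  proof (rule L2_dominated)
    show "(\<lambda>\<xi>. of_real (m \<xi>) * F (T t f) \<xi>) \<in> borel_measurable M"
      using F_L2[OF T_L2[OF t0 f]] by (auto dest: L2_measurable)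
    show "(\<lambda>\<xi>. of_real (1 / t) * F f \<xi>) \<in> L2 M" using f by (intro L2_cmult F_L2)
    show "AE x in M. cmod (of_real (m x) * F (T t f) x) \<le> cmod (of_real (1 / t) * F f x)"
      using F_T[OF t0 f] unfolding L2_eq_def
    proof eventually_elim
      case (elim x)
      have "m x * exp (- t * m x) \<le> 1 / t"
        using mult_exp_minus_le_1[of "t * m x"] t by (simp add: field_simps)
      then have "m x * exp (- t * m x) * cmod (F f x) \<le> 1 / t * cmod (F f x)"
        by (intro mult_right_mono) auto
      then show ?case unfolding elim using t by (simp add: norm_mult norm_divide m_nonneg mult.assoc del: of_real_exp)
    qed
  qed
  then show ?thesis using T_L2[OF t0 f] by (simp add: Dom_def)
qed

lemma F_minus_D_T:
  assumes "f \<in> Dom" "t \<ge> 0"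
  shows "L2_eq M (F (\<lambda>x. - D (T t f) x)) (\<lambda>\<xi>. of_real (- m \<xi> * exp (- t * m \<xi>)) * F f \<xi>)"
  using F_uminus[OF D_properties(2)[OF T_Dom[OF assms]]] D_properties(3)[OF T_Dom[OF assms]]
    F_T[OF assms(2) D_properties(1)[OF assms(1)]]
  unfolding L2_eq_def
proof eventually_elim
  case (elim x)
  show ?case unfolding elim by simp
qed

text \<open>Difference quotients are dominated by \<open>m * F f\<close>, which is square integrable for \<open>f\<close> in the domain.\<close>

lemma T_differentiable:
  assumes f: "f \<in> Dom" and t: "t \<ge> 0"
  shows "L2_tendsto M (\<lambda>s x. (T s f x - T t f x) / of_real (s - t)) (\<lambda>x. - D (T t f) x) (at t within {0..})"
proof (rule L2_tendsto_within_sequentially)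
  note f2 = D_properties(1)[OF f]
  show DT: "(\<lambda>x. - D (T t f) x) \<in> L2 M"
    by (intro L2_uminus D_properties T_Dom f t)
  show q: "(\<lambda>x. (T s f x - T t f x) / of_real (s - t)) \<in> L2 M" if "s \<in> {0..}" for s
    using that t by (intro L2_divide L2_diff T_L2 f2) auto
  fix r :: "nat \<Rightarrow> real" assume r: "\<And>n. r n \<in> {0..} - {t}" "r \<longlonglongrightarrow> t"
  then have r0: "r n \<ge> 0" "r n \<noteq> t" for n by auto
  have "L2_tendsto M (\<lambda>n \<xi>. of_real ((exp (- r n * m \<xi>) - exp (- t * m \<xi>)) / (r n - t)) * F f \<xi>)
      (\<lambda>\<xi>. of_real (- m \<xi> * exp (- t * m \<xi>)) * F f \<xi>) sequentially"
  proof (rule L2_multiplier_tendsto[OF _ _ F_L2[OF f2], where h = "\<lambda>\<xi>. of_real (m \<xi>) * F f \<xi>"])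
    show "(\<lambda>\<xi>. of_real (m \<xi>) * F f \<xi>) \<in> L2 M" using f by (simp add: Dom_def)
    show "\<bar>(exp (- r n * m x) - exp (- t * m x)) / (r n - t)\<bar> * cmod (F f x) \<le> cmod (of_real (m x) * F f x)" for n x
      using mult_right_mono[OF exp_minus_diff_quotient_bound[OF m_nonneg[of x] r0(1)[of n] t], of "cmod (F f x)"]
      by (simp add: norm_mult m_nonneg)
    show "(\<lambda>n. (exp (- r n * m x) - exp (- t * m x)) / (r n - t)) \<longlonglongrightarrow> - m x * exp (- t * m x)" for x
    proof (rule filterlim_compose[OF exp_minus_diff_quotient_tendsto])
      show "filterlim r (at t) sequentially"
        unfolding filterlim_at using r0 r by (intro conjI always_eventually allI) auto
    qed
  qed measurable
  then have "L2_tendsto M (\<lambda>n. F (\<lambda>x. (T (r n) f x - T t f x) / of_real (r n - t))) (F (\<lambda>x. - D (T t f) x)) sequentially"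
  proof (rule L2_tendsto_cong)
    show "\<forall>\<^sub>F n in sequentially. F (\<lambda>x. (T (r n) f x - T t f x) / of_real (r n - t)) \<in> L2 M \<and>
        L2_eq M (\<lambda>\<xi>. of_real ((exp (- r n * m \<xi>) - exp (- t * m \<xi>)) / (r n - t)) * F f \<xi>)
          (F (\<lambda>x. (T (r n) f x - T t f x) / of_real (r n - t)))"
      by (intro always_eventually allI conjI F_L2 q L2_eq_sym[OF F_T_quotient] r0 t f2) (use r0 in auto)
  qed (intro F_L2 DT L2_eq_sym[OF F_minus_D_T] f t)+
  then show "L2_tendsto M (\<lambda>n x. (T (r n) f x - T t f x) / of_real (r n - t)) (\<lambda>x. - D (T t f) x) sequentially"
    using tendsto_F_iff[OF DT, of "\<lambda>n x. (T (r n) f x - T t f x) / of_real (r n - t)" sequentially] q r0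
    by (simp del: of_real_diff)
qed

lemma T_derivative_continuous:
  assumes f: "f \<in> Dom" and t: "t \<ge> 0"
  shows "L2_tendsto M (\<lambda>s x. - D (T s f) x) (\<lambda>x. - D (T t f) x) (at t within {0..})"
proof (rule L2_tendsto_within_sequentially)
  show DT: "(\<lambda>x. - D (T s f) x) \<in> L2 M" if "s \<in> {0..}" for s
    using that by (intro L2_uminus D_properties T_Dom f) auto
  show DTt: "(\<lambda>x. - D (T t f) x) \<in> L2 M" using t by (intro DT) auto
  fix r :: "nat \<Rightarrow> real" assume r: "\<And>n. r n \<in> {0..} - {t}" "r \<longlonglongrightarrow> t"
  then have r0: "r n \<ge> 0" for n by auto
  have "L2_tendsto M (\<lambda>n \<xi>. of_real (- m \<xi> * exp (- r n * m \<xi>)) * F f \<xi>)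
      (\<lambda>\<xi>. of_real (- m \<xi> * exp (- t * m \<xi>)) * F f \<xi>) sequentially"
  proof (rule L2_multiplier_tendsto[OF _ _ F_L2[OF D_properties(1)[OF f]], where h = "\<lambda>\<xi>. of_real (m \<xi>) * F f \<xi>"])
    show "(\<lambda>\<xi>. of_real (m \<xi>) * F f \<xi>) \<in> L2 M" using f by (simp add: Dom_def)
    show "\<bar>- m x * exp (- r n * m x)\<bar> * cmod (F f x) \<le> cmod (of_real (m x) * F f x)" for n x
      using r0[of n] m_nonneg[of x]
      by (simp add: norm_mult abs_mult mult_right_mono mult_left_le)
    show "(\<lambda>n. - m x * exp (- r n * m x)) \<longlonglongrightarrow> - m x * exp (- t * m x)" for x
      by (intro tendsto_intros r)
  qed measurable
  then have "L2_tendsto M (\<lambda>n. F (\<lambda>x. - D (T (r n) f) x)) (F (\<lambda>x. - D (T t f) x)) sequentially"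
  proof (rule L2_tendsto_cong)
    show "\<forall>\<^sub>F n in sequentially. F (\<lambda>x. - D (T (r n) f) x) \<in> L2 M \<and>
        L2_eq M (\<lambda>\<xi>. of_real (- m \<xi> * exp (- r n * m \<xi>)) * F f \<xi>) (F (\<lambda>x. - D (T (r n) f) x))"
      by (intro always_eventually allI conjI F_L2 DT L2_eq_sym[OF F_minus_D_T] r0 f) (use r0 in auto)
  qed (intro F_L2 DTt L2_eq_sym[OF F_minus_D_T] f t)+
  then show "L2_tendsto M (\<lambda>n x. - D (T (r n) f) x) (\<lambda>x. - D (T t f) x) sequentially"
    using tendsto_F_iff[OF DTt, of "\<lambda>n x. - D (T (r n) f) x" sequentially] DT r0 by simp
qed

lemma T_flow:
  assumes f: "f \<in> Dom"
  shows "flow (\<lambda>t. T t f) (\<lambda>t x. - D (T t f) x)"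
  unfolding flow_def
proof (intro allI impI conjI T_differentiable f)
  fix t :: real assume t: "t \<ge> 0"
  show TL: "T t f \<in> L2 M" using t f by (intro T_L2 D_properties)
  have DT: "(\<lambda>x. - D (T t f) x) \<in> L2 M"
    by (intro L2_uminus D_properties T_Dom f t)
  show "L2_eq M (F (\<lambda>x. - D (T t f) x)) (\<lambda>\<xi>. - of_real (m \<xi>) * F (T t f) \<xi>)"
    using minus_D_iff[OF TL DT] T_Dom[OF f t] by simp
qed auto

text \<open>If the quotients at time \<open>0\<close> converge in mean square, then a subsequence converges almost everywhere on the
  spectral side, where the pointwise limit is \<open>- m * F f\<close>; so the limit determines the domain and the value.\<close>

lemma T_generated_by: "generated_by M T Dom (\<lambda>f x. - D f x)"
  unfolding generated_by_def
proof (intro ballI)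
  fix f g assume f: "f \<in> L2 M" and g: "g \<in> L2 M"
  let ?Q = "\<lambda>t x. (T t f x - f x) / of_real t"
  show "L2_tendsto M ?Q g (at_right 0) \<longleftrightarrow> f \<in> Dom \<and> L2_eq M g (\<lambda>x. - D f x)"
  proof
    assume fD: "f \<in> Dom \<and> L2_eq M g (\<lambda>x. - D f x)"
    have "L2_tendsto M ?Q (\<lambda>x. - D f x) (at 0 within {0..})"
      using T_differentiable[of f 0] fD by (simp add: T_0)
    then have "L2_tendsto M ?Q (\<lambda>x. - D f x) (at_right 0)"
      by (rule L2_tendsto_compose) (auto simp: filterlim_at_within_If intro!: filterlim_mono[OF filterlim_ident] at_le)
    then show "L2_tendsto M ?Q g (at_right 0)"
      by (rule L2_tendsto_cong)
         (use fD g f in \<open>auto simp: eventually_at_filter intro!: always_eventually L2_divide L2_diff T_L2 intro: L2_eq_sym\<close>)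
  next
    assume lim: "L2_tendsto M ?Q g (at_right 0)"
    define r where "r n = inverse (real (Suc n))" for n
    have r: "r n > 0" "r n \<ge> 0" for n by (simp_all add: r_def)
    have r_lim: "filterlim r (at_right 0) sequentially"
      using r LIMSEQ_inverse_real_of_nat unfolding r_def[symmetric]
      by (intro tendsto_imp_filterlim_at_right) auto
    have Q2: "?Q (r n) \<in> L2 M" for n
      using r by (intro L2_divide L2_diff T_L2 f) auto
    define Y where "Y n \<xi> = of_real ((exp (- r n * m \<xi>) - exp (- 0 * m \<xi>)) / (r n - 0)) * F f \<xi>" for n \<xi>
    have Y: "L2_eq M (F (?Q (r n))) (Y n)" for n
      using F_T_quotient[OF r(2) order_refl f, of n] by (simp add: T_0 Y_def[abs_def])
    have [measurable]: "F f \<in> borel_measurable M" using F_L2[OF f] by (rule L2_measurable)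
    have Y2: "Y n \<in> L2 M" for n
    proof (rule L2_cong_AE[OF F_L2[OF Q2[of n]]])
      show "Y n \<in> borel_measurable M" unfolding Y_def by measurable
    qed (use Y[of n] in \<open>simp add: L2_eq_def\<close>)
    have "L2_tendsto M (\<lambda>n. F (?Q (r n))) (F g) sequentially"
      using L2_tendsto_compose[OF lim r_lim] Q2 by (subst tendsto_F_iff[OF g]) auto
    then have YF: "L2_tendsto M Y (F g) sequentially"
      by (rule L2_tendsto_cong) (use Y Y2 F_L2[OF g] in auto)
    obtain k where k: "strict_mono (k :: nat \<Rightarrow> nat)" "AE x in M. (\<lambda>n. Y (k n) x) \<longlonglongrightarrow> F g x"
      by (rule L2_tendsto_AE_subseq[OF YF Y2])
    have "L2_eq M (F g) (\<lambda>\<xi>. - of_real (m \<xi>) * F f \<xi>)"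
      unfolding L2_eq_def using k(2)
    proof eventually_elim
      case (elim x)
      have "filterlim r (at 0) sequentially"
        using r_lim by (rule filterlim_mono) (auto intro: at_le)
      then have "(\<lambda>n. (exp (- r n * m x) - exp (- 0 * m x)) / (r n - 0)) \<longlonglongrightarrow> - m x * exp (- 0 * m x)"
        by (rule filterlim_compose[OF exp_minus_diff_quotient_tendsto])
      then have "(\<lambda>n. Y n x) \<longlonglongrightarrow> of_real (- m x * exp (- 0 * m x)) * F f x"
        unfolding Y_def by (intro tendsto_intros)
      then have "(\<lambda>n. Y (k n) x) \<longlonglongrightarrow> of_real (- m x * exp (- 0 * m x)) * F f x"
        by (rule LIMSEQ_subseq_LIMSEQ[OF _ k(1), unfolded comp_def])
      from LIMSEQ_unique[OF elim this] show ?case by simp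
    qed
    then show "f \<in> Dom \<and> L2_eq M g (\<lambda>x. - D f x)"
      using minus_D_iff[OF f g] by blast
  qed
qed

text \<open>The semigroup is determined on the domain by uniqueness of solutions, and the domain is dense.\<close>

lemma generated_semigroup_eq:
  assumes S: "C0_semigroup M S" and gen: "generated_by M S Dom (\<lambda>f x. - D f x)"
    and t: "t \<ge> 0" and f: "f \<in> L2 M"
  shows "L2_eq M (S t f) (T t f)"
proof -
  note S' = C0_semigroupD[OF S]
  have on_Dom: "L2_eq M (S t g) (T t g)" if g: "g \<in> Dom" for g
  proof (rule flow_unique[OF semigroup_flow[OF S gen g] T_flow[OF g] _ t])
    show "L2_eq M (S 0 g) (T 0 g)" using S'(2)[OF D_properties(1)[OF g]] by (simp add: T_0)
  qed
  have "L2_tendsto M (\<lambda>h. S t (T h f)) (S t f) (at_right 0)"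
    by (rule L2_tendsto_bounded_operator[OF S'(1)[OF t] T_continuous_at_0[OF f]])
  moreover have "L2_tendsto M (\<lambda>h. S t (T h f)) (T t f) (at_right 0)"
  proof (rule L2_tendsto_cong)
    show "L2_tendsto M (\<lambda>h. T t (T h f)) (T t f) (at_right 0)"
      by (rule L2_tendsto_bounded_operator[OF T_bounded[OF t] T_continuous_at_0[OF f]])
    show "\<forall>\<^sub>F h in at_right 0. S t (T h f) \<in> L2 M \<and> L2_eq M (T t (T h f)) (S t (T h f))"
      unfolding eventually_at_filter
      by (intro always_eventually allI impI conjI S'(5) t T_L2 f L2_eq_sym[OF on_Dom] T_smoothing) auto
  qed (use T_L2[OF t f] in auto)
  ultimately show ?thesis
    by (rule L2_tendsto_unique) simp
qed

end

section \<open>The filtration of the rationals by fractional ideals\<close>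

locale adelic_base =
  fixes E :: "nat \<Rightarrow> nat"
  assumes adelic: "adelic_sequence E"
begin

abbreviation e :: "int \<Rightarrow> rat" where "e \<equiv> exp_psi E"

definition q :: "int \<Rightarrow> real" where "q n = of_rat (e n)"

definition L :: "int \<Rightarrow> rat set" where "L n = {x. \<exists>k::int. x = of_int k * e n}"

lemma E_simps: "strict_mono E" "E 0 = 1" "E n dvd E (Suc n)" "m > 0 \<Longrightarrow> \<exists>n. m dvd E n"
  using adelic by (auto simp: adelic_sequence_def)

lemma E_pos: "E n > 0"
  using strict_mono_less_eq[OF E_simps(1), of 0 n] E_simps(2) by simp

lemma e_pos: "e n > 0"
  using E_pos by (simp add: exp_psi_def)

lemma e_0 [simp]: "e 0 = 1"
  by (simp add: exp_psi_def E_simps)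

lemma e_minus: "e (- n) = 1 / e n"
  by (cases "n = 0") (auto simp: exp_psi_def E_simps)

lemma e_step: "\<exists>d\<ge>2. e (n + 1) = of_nat d * e n"
proof -
  have E_step: "\<exists>d\<ge>2. E (Suc k) = d * E k" for k
  proof -
    obtain d where d: "E (Suc k) = d * E k"
      using E_simps(3)[of k] unfolding dvd_def by (auto simp: mult.commute)
    have "E k < E (Suc k)" using strict_mono_less[OF E_simps(1), of k "Suc k"] by simp
    then have "d \<noteq> 0" "d \<noteq> 1" using d by auto
    then show ?thesis using d by (intro exI[of _ d]) auto
  qed
  show ?thesis
  proof (cases "n \<ge> 0")
    case True
    obtain d where "d \<ge> 2" "E (Suc (nat n)) = d * E (nat n)" using E_step by blast
    then show ?thesis using True by (intro exI[of _ d]) (simp add: exp_psi_def nat_add_distrib)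
  next
    case False
    obtain d where d: "d \<ge> 2" "E (Suc (nat (- n - 1))) = d * E (nat (- n - 1))" using E_step by blast
    have "Suc (nat (- n - 1)) = nat (- n)" using False by simp
    then have "e n = 1 / (of_nat d * of_nat (E (nat (- n - 1))))"
      using False d by (simp add: exp_psi_def)
    moreover have "e (n + 1) = 1 / of_nat (E (nat (- n - 1)))"
      using False e_minus[of "- n - 1"] by (simp add: exp_psi_def algebra_simps)
    ultimately show ?thesis using d E_pos by (intro exI[of _ d]) auto
  qed
qed

text \<open>The number $e^{\Lambda(n+1)}$ of possible digits at place \<open>n\<close>.\<close>

definition digit_bound :: "int \<Rightarrow> nat" where
  "digit_bound n = (SOME d. d \<ge> 2 \<and> e (n + 1) = of_nat d * e n)"

lemma digit_bound: "digit_bound n \<ge> 2" "e (n + 1) = of_nat (digit_bound n) * e n"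
  using someI_ex[OF e_step[of n, unfolded Bex_def]] by (auto simp: digit_bound_def)

lemma exp_Lambda_Suc: "exp_Lambda E (n + 1) = of_nat (digit_bound n)"
  using e_pos[of n] digit_bound(2)[of n] by (simp add: exp_Lambda_def)

lemma e_multiple:
  assumes "m \<le> n"
  shows "\<exists>k::nat. k > 0 \<and> e n = of_nat k * e m"
  using assms
proof (induction n rule: int_ge_induct)
  case base
  show ?case by (intro exI[of _ 1]) auto
next
  case (step n)
  then obtain k :: nat where "k > 0" "e n = of_nat k * e m" by blast
  then show ?case using digit_bound[of n] by (intro exI[of _ "digit_bound n * k"]) auto
qed

lemma q_pos [simp]: "q n > 0"
  using e_pos by (simp add: q_def)

lemma q_nonneg [simp]: "q n \<ge> 0"
  using q_pos[of n] by linarith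

lemma q_nonzero [simp]: "q n \<noteq> 0"
  using q_pos[of n] by linarith

lemma q_0 [simp]: "q 0 = 1"
  by (simp add: q_def)

lemma q_minus: "q (- n) = 1 / q n"
  by (simp add: q_def e_minus of_rat_divide)

lemma q_Suc: "q (n + 1) = of_nat (digit_bound n) * q n"
  by (simp add: q_def digit_bound(2) of_rat_mult)

lemma q_Suc_ge: "q (n + 1) \<ge> 2 * q n"
  unfolding q_Suc using digit_bound(1)[of n] by (intro mult_right_mono) auto

lemma q_strict_mono: "strict_mono q"
proof -
  have "m < n \<Longrightarrow> q m < q n" for m n
  proof (induction n rule: int_gr_induct)
    case base
    show ?case using q_Suc_ge[of m] q_pos[of m] by linarith
  next
    case (step i)
    then show ?case using q_Suc_ge[of i] q_pos[of i] by linarith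
  qed
  then show ?thesis by (rule strict_monoI)
qed

lemma q_less_iff [simp]: "q m < q n \<longleftrightarrow> m < n"
  using strict_mono_less[OF q_strict_mono] .

lemma q_le_iff [simp]: "q m \<le> q n \<longleftrightarrow> m \<le> n"
  using strict_mono_less_eq[OF q_strict_mono] .

lemma q_eq_iff [simp]: "q m = q n \<longleftrightarrow> m = n"
  using strict_mono_eq[OF q_strict_mono] .

lemma q_ge_power: "q (int n) \<ge> 2 ^ n"
proof (induction n)
  case (Suc n)
  then show ?case using q_Suc_ge[of "int n"] by (simp add: add.commute)
qed simp

lemma q_unbounded: "\<exists>n. q (int n) > x"
proof -
  obtain n where "x < 2 ^ n" using real_arch_pow[of 2 x] by auto
  then show ?thesis using q_ge_power[of n] by (intro exI[of _ n]) linarith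
qed

lemma q_small: "x > 0 \<Longrightarrow> \<exists>n. 1 / q (int n) < x"
  using q_unbounded[of "1 / x"] by (auto simp: field_simps)

lemma L_mono: "m \<le> n \<Longrightarrow> L n \<subseteq> L m"
proof -
  assume "m \<le> n"
  then obtain k :: nat where k: "e n = of_nat k * e m" using e_multiple by blast
  show "L n \<subseteq> L m"
  proof
    fix x assume "x \<in> L n"
    then obtain i :: int where "x = of_int i * e n" by (auto simp: L_def)
    then have "x = of_int (i * int k) * e m" by (simp add: k)
    then show "x \<in> L m" unfolding L_def by blast
  qed
qed

lemma L_zero [simp]: "0 \<in> L n"
  by (auto simp: L_def intro: exI[of _ 0])

lemma L_add: "x \<in> L n \<Longrightarrow> y \<in> L n \<Longrightarrow> x + y \<in> L n"
  unfolding L_def by (auto simp flip: distrib_right of_int_add)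

lemma L_uminus: "x \<in> L n \<Longrightarrow> - x \<in> L n"
  unfolding L_def by (auto intro: exI[of _ "- k" for k])

lemma L_multiple: "of_int k * e n \<in> L n"
  by (auto simp: L_def)

lemma L_0_iff: "x \<in> L 0 \<longleftrightarrow> x \<in> \<int>"
  by (auto simp: L_def Ints_def)

lemma L_0_mult: "x \<in> L 0 \<Longrightarrow> y \<in> L n \<Longrightarrow> x * y \<in> L n"
  unfolding L_def by (auto simp: mult.assoc[symmetric] simp flip: of_int_mult)

lemma L_mult_dual: "x \<in> L (- n) \<Longrightarrow> y \<in> L n \<Longrightarrow> x * y \<in> L 0"
proof -
  assume "x \<in> L (- n)" "y \<in> L n"
  then obtain k l :: int where "x = of_int k * e (- n)" "y = of_int l * e n" by (auto simp: L_def)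
  then have "x * y = of_int (k * l) * e 0" using e_pos[of n] by (simp add: e_minus)
  then show "x * y \<in> L 0" unfolding L_def by blast
qed

text \<open>The greatest exponent exists: the denominator of \<open>x\<close> divides some \<open>E n\<close>, which gives one exponent, and
  nonzero elements of \<open>L n\<close> have absolute value at least \<open>q n\<close>, which bounds all of them.\<close>

lemma rat_ord_iff:
  assumes "x \<noteq> 0"
  shows "x \<in> L n \<longleftrightarrow> n \<le> rat_ord E x"
proof -
  have "\<exists>a. x \<in> L a"
  proof -
    obtain i j where x: "x = of_int i / of_int j" "j > 0"
      by (cases x) (auto simp: Fract_of_int_quotient)
    obtain n where "nat j dvd E n" using E_simps(4)[of "nat j"] x by auto
    then obtain k where k: "E n = nat j * k" by (auto elim: dvdE)
    then have "k > 0" using E_pos[of n] by (cases k) auto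
    have "e (- int n) = 1 / (of_int j * of_nat k)"
      unfolding e_minus using k x by (simp add: exp_psi_def)
    then have "x = of_int (i * int k) * e (- int n)"
      using x \<open>k > 0\<close> by simp
    then show ?thesis unfolding L_def by blast
  qed
  then obtain a where a: "x \<in> L a" by blast
  obtain N where N: "q (int N) > \<bar>of_rat x\<bar>" using q_unbounded by blast
  have bound: "n \<le> int N" if "x \<in> L n" for n
  proof (rule ccontr)
    assume "\<not> n \<le> int N"
    obtain k :: int where k: "x = of_int k * e n" using \<open>x \<in> L n\<close> unfolding L_def by blast
    then have "k \<noteq> 0" using assms by auto
    then have "1 * q n \<le> \<bar>of_int k\<bar> * q n" by (intro mult_right_mono) (linarith, simp)
    also have "\<dots> = \<bar>of_rat x\<bar>" using q_nonneg[of n] by (simp add: k of_rat_mult abs_mult q_def)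
    finally have "q n < q (int N)" using N by linarith
    with \<open>\<not> n \<le> int N\<close> show False by simp
  qed
  define k where "k = (LEAST k. x \<in> L (int N - int k))"
  have "x \<in> L (int N - int (nat (int N - a)))" using a bound[OF a] by simp
  then have k: "x \<in> L (int N - int k)" unfolding k_def by (rule LeastI)
  have max: "n \<le> int N - int k" if "x \<in> L n" for n
  proof -
    have "x \<in> L (int N - int (nat (int N - n)))" using that bound[OF that] by simp
    then have "k \<le> nat (int N - n)" unfolding k_def by (rule Least_le)
    then show ?thesis using bound[OF that] by linarith
  qed
  have "rat_ord E x = int N - int k"
    unfolding rat_ord_def
    by (rule Greatest_equality) (use k max in \<open>auto simp: L_def\<close>)
  then show ?thesis
    using k max L_mono[of n "int N - int k"] by auto
qed

lemma rat_dist_le_iff: "rat_dist E x y \<le> 1 / q n \<longleftrightarrow> x - y \<in> L n"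
proof (cases "x = y")
  case False
  have "1 / q k \<le> 1 / q n \<longleftrightarrow> n \<le> k" for k
    by (simp add: divide_le_eq le_divide_eq)
  moreover have "rat_dist E x y = 1 / q (rat_ord E (x - y))"
    using False by (simp add: rat_dist_def q_def)
  ultimately show ?thesis using False rat_ord_iff[of "x - y" n] by simp
qed (simp add: rat_dist_def)

lemma rat_dist_values: "x \<noteq> y \<Longrightarrow> rat_dist E x y = 1 / q (rat_ord E (x - y))"
  by (simp add: rat_dist_def q_def)

end

section \<open>The ultrametric ring of finite adeles\<close>

locale adele_ring = adelic_base E for E +
  fixes \<iota> :: "rat \<Rightarrow> 'a::{comm_ring_1, topological_ab_group_add,
      topological_semigroup_mult, complete_space}"
  assumes adeles: "finite_adeles E \<iota>"
begin

lemma \<iota>_1: "\<iota> 1 = 1" and \<iota>_add: "\<iota> (x + y) = \<iota> x + \<iota> y" and \<iota>_mult: "\<iota> (x * y) = \<iota> x * \<iota> y"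
  and \<iota>_dist: "dist (\<iota> x) (\<iota> y) = rat_dist E x y" and \<iota>_dense: "closure (range \<iota>) = UNIV"
  using adeles by (auto simp: finite_adeles_def)

lemma \<iota>_0: "\<iota> 0 = 0"
  using \<iota>_add[of 0 0] by simp

lemma \<iota>_minus: "\<iota> (- x) = - \<iota> x"
  using \<iota>_add[of x "- x"] by (simp add: \<iota>_0 eq_neg_iff_add_eq_0 add.commute)

lemma \<iota>_diff: "\<iota> (x - y) = \<iota> x - \<iota> y"
  using \<iota>_add[of x "- y"] by (simp add: \<iota>_minus)

lemma \<iota>_sum: "\<iota> (\<Sum>i\<in>I. f i) = (\<Sum>i\<in>I. \<iota> (f i))"
  by (induction I rule: infinite_finite_induct) (auto simp: \<iota>_0 \<iota>_add)

lemma approximating_sequence: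
  obtains r where "(\<lambda>k. \<iota> (r k)) \<longlonglongrightarrow> x"
proof -
  have "x \<in> closure (range \<iota>)" by (simp add: \<iota>_dense)
  then obtain y where y: "\<And>k. y k \<in> range \<iota>" "y \<longlonglongrightarrow> x" unfolding closure_sequential by blast
  then have "\<forall>k. \<exists>r. y k = \<iota> r" by auto
  then obtain r where "\<And>k. y k = \<iota> (r k)" by metis
  then have "y = (\<lambda>k. \<iota> (r k))" by auto
  then show ?thesis using that y by blast
qed

text \<open>True on the dense image of the rationals, hence everywhere by continuity of the addition.\<close>

lemma dist_translate [simp]: "dist (x + z) (y + z) = dist x (y :: 'a)"
proof -
  obtain r s t where r: "(\<lambda>k. \<iota> (r k)) \<longlonglongrightarrow> x" and s: "(\<lambda>k. \<iota> (s k)) \<longlonglongrightarrow> y" and t: "(\<lambda>k. \<iota> (t k)) \<longlonglongrightarrow> z"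
    by (metis approximating_sequence)
  have "(\<lambda>k. dist (\<iota> (r k) + \<iota> (t k)) (\<iota> (s k) + \<iota> (t k))) \<longlonglongrightarrow> dist (x + z) (y + z)"
    by (intro tendsto_intros r s t)
  moreover have "dist (\<iota> (r k) + \<iota> (t k)) (\<iota> (s k) + \<iota> (t k)) = dist (\<iota> (r k)) (\<iota> (s k))" for k
    by (simp add: \<iota>_add[symmetric] \<iota>_dist rat_dist_def)
  moreover have "(\<lambda>k. dist (\<iota> (r k)) (\<iota> (s k))) \<longlonglongrightarrow> dist x y"
    by (intro tendsto_intros r s)
  ultimately show ?thesis using LIMSEQ_unique by fastforce
qed

abbreviation nrm :: "'a \<Rightarrow> real" where "nrm x \<equiv> dist x 0"

lemma dist_eq_nrm: "dist x y = nrm (x - y)"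
  using dist_translate[of x "- y" y] by simp

lemma nrm_minus [simp]: "nrm (- x) = nrm x"
  using dist_translate[of "- x" x 0] by (simp add: dist_commute)

lemma rat_ultrametric: "rat_dist E x z \<le> max (rat_dist E x y) (rat_dist E y z)"
proof (cases "x = y \<or> y = z")
  case False
  then have "\<exists>n. max (rat_dist E x y) (rat_dist E y z) = 1 / q n"
    by (auto simp: rat_dist_values max_def)
  then obtain n where n: "max (rat_dist E x y) (rat_dist E y z) = 1 / q n" by blast
  then have "x - y \<in> L n" "y - z \<in> L n"
    by (metis max.cobounded1 max.cobounded2 rat_dist_le_iff)+
  then have "x - z \<in> L n" using L_add by fastforce
  then show ?thesis using n rat_dist_le_iff by metis
qed (auto simp: rat_dist_def)

lemma dist_ultrametric: "dist x z \<le> max (dist x y) (dist y (z::'a))"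
proof -
  obtain r s t where r: "(\<lambda>k. \<iota> (r k)) \<longlonglongrightarrow> x" and s: "(\<lambda>k. \<iota> (s k)) \<longlonglongrightarrow> y" and t: "(\<lambda>k. \<iota> (t k)) \<longlonglongrightarrow> z"
    by (metis approximating_sequence)
  show ?thesis
  proof (rule LIMSEQ_le)
    show "(\<lambda>k. dist (\<iota> (r k)) (\<iota> (t k))) \<longlonglongrightarrow> dist x z" by (intro tendsto_intros r t)
    show "(\<lambda>k. max (dist (\<iota> (r k)) (\<iota> (s k))) (dist (\<iota> (s k)) (\<iota> (t k)))) \<longlonglongrightarrow> max (dist x y) (dist y z)"
      by (intro tendsto_intros r s t)
  qed (auto simp: \<iota>_dist rat_ultrametric)
qed

lemma nrm_add_le: "nrm (x + y) \<le> max (nrm x) (nrm y)"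
  using dist_ultrametric[of "x + y" 0 y] dist_translate[of x y 0] by simp

lemma isosceles: "dist x y < nrm y \<Longrightarrow> nrm x = nrm y"
  using dist_ultrametric[of x 0 y] dist_ultrametric[of y 0 x] by (auto simp: dist_commute max_def split: if_splits)

lemma nrm_\<iota>: "nrm (\<iota> r) = (if r = 0 then 0 else 1 / q (rat_ord E r))"
  using \<iota>_dist[of r 0] by (simp add: \<iota>_0 rat_dist_def q_def)

lemma approximation:
  assumes "d > 0"
  obtains r where "dist (\<iota> r) x < d"
  using closure_approachable[of x "range \<iota>"] assms \<iota>_dense by auto

text \<open>Points close to \<open>x \<noteq> 0\<close> have the same norm as \<open>x\<close>, and rational points are among them.\<close>

lemma nrm_values:
  assumes "x \<noteq> 0"
  obtains n where "nrm x = 1 / q n"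
proof -
  obtain r where "dist (\<iota> r) x < nrm x" using approximation[of "nrm x" x] assms by auto
  then have *: "nrm (\<iota> r) = nrm x" by (rule isosceles)
  then have "r \<noteq> 0" using assms \<iota>_0 by auto
  with * show ?thesis using that[of "rat_ord E r"] by (simp add: nrm_\<iota>)
qed

definition G :: "int \<Rightarrow> 'a set" where "G n = {x. nrm x \<le> 1 / q n}"

lemma G_iff: "x \<in> G n \<longleftrightarrow> nrm x \<le> 1 / q n"
  by (simp add: G_def)

lemma G_\<iota>_iff [simp]: "\<iota> r \<in> G n \<longleftrightarrow> r \<in> L n"
  using \<iota>_dist[of r 0] rat_dist_le_iff[of r 0 n] by (simp add: G_iff \<iota>_0)

lemma G_zero [simp]: "0 \<in> G n"
  by (simp add: G_iff)

lemma G_minus_iff [simp]: "- x \<in> G n \<longleftrightarrow> x \<in> G n"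
  by (simp add: G_iff)

lemma G_add: "x \<in> G n \<Longrightarrow> y \<in> G n \<Longrightarrow> x + y \<in> G n"
  using nrm_add_le[of x y] by (simp add: G_iff)

lemma G_diff: "x \<in> G n \<Longrightarrow> y \<in> G n \<Longrightarrow> x - y \<in> G n"
  using G_add[of x n "- y"] by simp

lemma G_minus_commute: "x - y \<in> G n \<longleftrightarrow> y - x \<in> G n"
  using G_minus_iff[of "x - y" n] by simp

lemma G_trans: "x - y \<in> G n \<Longrightarrow> y - z \<in> G n \<Longrightarrow> x - z \<in> G n"
  using G_add[of "x - y" n "y - z"] by simp

lemma G_antimono: "m \<le> n \<Longrightarrow> G n \<subseteq> G m"
  unfolding G_def by (auto elim!: order_trans intro!: divide_left_mono mult_pos_pos)

lemma G_antimonoD: "x \<in> G n \<Longrightarrow> m \<le> n \<Longrightarrow> x \<in> G m"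
  using G_antimono by blast

lemma G_exhaust: "\<exists>n. x \<in> G (- int n)"
  using q_unbounded[of "nrm x"] by (auto simp: G_iff q_minus intro: less_imp_le)

lemma cball_eq: "cball a (1 / q n) = {x. x - a \<in> G n}"
  by (auto simp: G_iff dist_commute dist_eq_nrm[of _ a])

text \<open>The norm takes no values strictly between \<open>1 / q n\<close> and \<open>1 / q (n - 1)\<close>, so balls are open and closed.\<close>

lemma G_eq_strict: "x \<in> G n \<longleftrightarrow> nrm x < 1 / q (n - 1)"
proof
  assume "x \<in> G n"
  then have "nrm x \<le> 1 / q n" by (simp add: G_iff)
  also have "\<dots> < 1 / q (n - 1)" by (intro divide_strict_left_mono mult_pos_pos) auto
  finally show "nrm x < 1 / q (n - 1)" .
next
  assume *: "nrm x < 1 / q (n - 1)"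
  show "x \<in> G n"
  proof (cases "x = 0")
    case False
    then obtain k where k: "nrm x = 1 / q k" by (rule nrm_values)
    with * have "q (n - 1) < q k" by (simp add: field_simps)
    then have "n \<le> k" by simp
    then show ?thesis by (simp add: G_iff k frac_le)
  qed simp
qed

lemma ball_eq: "ball a (1 / q (n - 1)) = {x. x - a \<in> G n}"
  by (auto simp: G_eq_strict dist_commute dist_eq_nrm[of _ a])

lemma open_coset: "open {x. x - a \<in> G n}"
  using open_ball[of a "1 / q (n - 1)"] by (simp add: ball_eq)

lemma closed_coset: "closed {x. x - a \<in> G n}"
  using closed_cball[of a "1 / q n"] by (simp add: cball_eq)

lemma open_G: "open (G n)" and closed_G: "closed (G n)"
  using open_coset[of 0 n] closed_coset[of 0 n] by auto

lemma approximation_mod_G: obtains r where "x - \<iota> r \<in> G n"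
proof -
  obtain r where "dist (\<iota> r) x < 1 / q n" by (rule approximation[of "1 / q n" x]) auto
  then have "\<iota> r - x \<in> G n" by (simp add: G_iff dist_eq_nrm[of _ x])
  then show ?thesis using that by (simp add: G_minus_commute)
qed

lemma G_approximating_sequence:
  assumes "x \<in> G n"
  obtains r where "\<And>k. r k \<in> L n" "(\<lambda>k. \<iota> (r k)) \<longlonglongrightarrow> x"
proof -
  obtain r where r: "(\<lambda>k. \<iota> (r k)) \<longlonglongrightarrow> x" by (rule approximating_sequence)
  have "\<forall>\<^sub>F k in sequentially. \<iota> (r k) \<in> G n"
    using topological_tendstoD[OF r open_G assms] .
  then obtain N where N: "\<And>k. k \<ge> N \<Longrightarrow> \<iota> (r k) \<in> G n" by (auto simp: eventually_sequentially)
  show ?thesis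
  proof (rule that[of "\<lambda>k. r (k + N)"])
    show "r (k + N) \<in> L n" for k using N[of "k + N"] by simp
    show "(\<lambda>k. \<iota> (r (k + N))) \<longlonglongrightarrow> x" using LIMSEQ_ignore_initial_segment[OF r] .
  qed
qed

text \<open>Inclusions between products of fractional ideals pass to their closures.\<close>

lemma G_mult:
  assumes L: "\<And>r s. r \<in> L a \<Longrightarrow> s \<in> L b \<Longrightarrow> r * s \<in> L c" and "x \<in> G a" "y \<in> G b"
  shows "x * y \<in> G c"
proof -
  obtain r where r: "\<And>k. r k \<in> L a" "(\<lambda>k. \<iota> (r k)) \<longlonglongrightarrow> x"
    using G_approximating_sequence[OF assms(2)] by blast
  obtain s where s: "\<And>k. s k \<in> L b" "(\<lambda>k. \<iota> (s k)) \<longlonglongrightarrow> y"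
    using G_approximating_sequence[OF assms(3)] by blast
  have "(\<lambda>k. \<iota> (r k) * \<iota> (s k)) \<longlonglongrightarrow> x * y" by (intro tendsto_mult r s)
  moreover have "\<iota> (r k) * \<iota> (s k) \<in> G c" for k
    using L r s by (simp flip: \<iota>_mult)
  ultimately show ?thesis by (rule closed_sequentially[OF closed_G, rotated])
qed

lemma G_mult_dual: "x \<in> G (- n) \<Longrightarrow> y \<in> G n \<Longrightarrow> x * y \<in> G 0"
  by (rule G_mult[OF L_mult_dual])

lemma G_0_mult: "x \<in> G 0 \<Longrightarrow> y \<in> G n \<Longrightarrow> x * y \<in> G n"
  by (rule G_mult[OF L_0_mult])

text \<open>A rational point that is closer to \<open>x\<close> than \<open>0\<close> is has the norm of \<open>x\<close>, and the norm determines the order.\<close>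

lemma adele_ord_eq:
  assumes "nrm x = 1 / q n"
  shows "adele_ord E \<iota> x = n"
  unfolding adele_ord_def
proof (rule the_equality)
  show conv: "\<forall>r. (\<lambda>k. \<iota> (r k)) \<longlonglongrightarrow> x \<longrightarrow> (\<forall>\<^sub>F k in sequentially. rat_ord E (r k) = n)"
  proof (intro allI impI)
    fix r assume "(\<lambda>k. \<iota> (r k)) \<longlonglongrightarrow> x"
    then have "\<forall>\<^sub>F k in sequentially. dist (\<iota> (r k)) x < nrm x"
      by (rule tendstoD) (simp add: assms)
    then show "\<forall>\<^sub>F k in sequentially. rat_ord E (r k) = n"
    proof eventually_elim
      case (elim k)
      from isosceles[OF this] show ?case by (auto simp: nrm_\<iota> assms split: if_splits)
    qed
  qed
  fix n' assume n': "\<forall>r. (\<lambda>k. \<iota> (r k)) \<longlonglongrightarrow> x \<longrightarrow> (\<forall>\<^sub>F k in sequentially. rat_ord E (r k) = n')"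
  obtain r where r: "(\<lambda>k. \<iota> (r k)) \<longlonglongrightarrow> x" by (rule approximating_sequence)
  have "\<forall>\<^sub>F k in sequentially. rat_ord E (r k) = n" "\<forall>\<^sub>F k in sequentially. rat_ord E (r k) = n'"
    using conv n' r by auto
  then have "\<forall>\<^sub>F k::nat in sequentially. n' = n" by eventually_elim simp
  then show "n' = n" by simp
qed

lemma nrm_eq_ord: "x \<noteq> 0 \<Longrightarrow> nrm x = 1 / q (adele_ord E \<iota> x)"
  by (metis nrm_values adele_ord_eq)

lemma adele_norm_eq: "adele_norm E \<iota> x = nrm x"
  using nrm_eq_ord[of x] by (simp add: adele_norm_def q_def)

end

section \<open>Digits, fractional part and the canonical character\<close>

context adele_ring
begin

text \<open>Modulo \<open>G (l + 1)\<close>, \<open>y\<close> is represented by a rational \<open>k * e l\<close>, and only the residue of \<open>k\<close> modulo the number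
  of digits matters.\<close>

lemma digit_ex1:
  assumes y: "y \<in> G l"
  shows "\<exists>!c::nat. c < digit_bound l \<and> y - \<iota> (of_nat c * e l) \<in> G (l + 1)"
proof (rule ex_ex1I)
  let ?d = "digit_bound l"
  have d: "?d > 0" using digit_bound(1)[of l] by simp
  obtain r where r: "y - \<iota> r \<in> G (l + 1)" by (rule approximation_mod_G)
  then have "\<iota> r \<in> G l"
    using G_diff[OF y G_antimonoD[OF r, of l]] by simp
  then obtain k :: int where k: "r = of_int k * e l" by (auto simp: L_def)
  define c where "c = nat (k mod int ?d)"
  have c: "int c = k mod int ?d" using d by (simp add: c_def)
  have "k = (k div int ?d) * int ?d + int c" unfolding c by simp
  then have "r = of_int ((k div int ?d) * int ?d + int c) * e l" using k by simp
  then have "r - of_nat c * e l = of_int (k div int ?d) * e (l + 1)"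
    unfolding digit_bound(2) by (simp add: algebra_simps)
  then have "\<iota> r - \<iota> (of_nat c * e l) \<in> G (l + 1)"
    by (simp add: L_multiple flip: \<iota>_diff)
  with r have "y - \<iota> (of_nat c * e l) \<in> G (l + 1)" by (rule G_trans)
  moreover have "c < ?d" using c d by (metis of_nat_less_iff pos_mod_bound of_nat_0_less_iff)
  ultimately show "\<exists>c. c < ?d \<and> y - \<iota> (of_nat c * e l) \<in> G (l + 1)" by blast
next
  let ?d = "digit_bound l"
  fix c c' assume c: "c < ?d \<and> y - \<iota> (of_nat c * e l) \<in> G (l + 1)"
    and c': "c' < ?d \<and> y - \<iota> (of_nat c' * e l) \<in> G (l + 1)"
  then have "\<iota> (of_nat c * e l) - \<iota> (of_nat c' * e l) \<in> G (l + 1)"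
    using G_trans[of "\<iota> (of_nat c * e l)" y] G_minus_commute by blast
  then have "of_nat c * e l - of_nat c' * e l \<in> L (l + 1)"
    by (simp flip: \<iota>_diff)
  then obtain k :: int where "of_nat c * e l - of_nat c' * e l = of_int k * (of_nat ?d * e l)"
    by (auto simp: L_def digit_bound(2))
  then have "(of_int (int c - int c') :: rat) * e l = of_int (k * int ?d) * e l"
    by (simp add: algebra_simps)
  then have "(of_int (int c - int c') :: rat) = of_int (k * int ?d)"
    using e_pos[of l] by (metis less_irrefl mult_right_cancel)
  then have eq: "int c - int c' = k * int ?d" by (rule of_int_eq_iff[THEN iffD1])
  then have "\<bar>k * int ?d\<bar> < int ?d" using c c' by auto
  then have "\<bar>k\<bar> * int ?d < 1 * int ?d" by (simp add: abs_mult)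
  then have "k = 0" by (simp only: mult_less_cancel_right) linarith
  then show "c = c'" using eq by simp
qed

text \<open>The property that the definite description in \<open>adele_digits\<close> selects.\<close>

definition expansion :: "'a \<Rightarrow> (int \<Rightarrow> nat) \<Rightarrow> bool" where
  "expansion x c \<longleftrightarrow> (\<forall>l < adele_ord E \<iota> x. c l = 0) \<and> c (adele_ord E \<iota> x) \<noteq> 0 \<and>
        (\<forall>l. of_nat (c l) < exp_Lambda E (l + 1)) \<and>
        (\<lambda>k. \<iota> (of_nat (c (adele_ord E \<iota> x + int k)) * exp_psi E (adele_ord E \<iota> x + int k))) sums x"

abbreviation partial_expansion :: "'a \<Rightarrow> (int \<Rightarrow> nat) \<Rightarrow> nat \<Rightarrow> 'a" where
  "partial_expansion x c K \<equiv>
     \<Sum>k<K. \<iota> (of_nat (c (adele_ord E \<iota> x + int k)) * e (adele_ord E \<iota> x + int k))"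

lemma G_sum: "(\<And>i. i \<in> I \<Longrightarrow> f i \<in> G n) \<Longrightarrow> sum f I \<in> G n"
  by (induction I rule: infinite_finite_induct) (auto intro: G_add)

text \<open>The remainder is a convergent sum of terms in the closed group of the first omitted place.\<close>

lemma expansion_remainder:
  assumes "expansion x c"
  shows "x - partial_expansion x c K \<in> G (adele_ord E \<iota> x + int K)"
proof -
  let ?g = "adele_ord E \<iota> x"
  let ?t = "\<lambda>k. \<iota> (of_nat (c (?g + int k)) * e (?g + int k))"
  have "?t sums x" using assms by (simp add: expansion_def)
  then have "(\<lambda>n. sum ?t {..<n + K} - sum ?t {..<K}) \<longlonglongrightarrow> x - sum ?t {..<K}"
    unfolding sums_def by (intro tendsto_diff tendsto_const LIMSEQ_ignore_initial_segment)
  moreover have "sum ?t {..<n + K} - sum ?t {..<K} \<in> G (?g + int K)" for n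
  proof -
    have "sum ?t {..<n + K} - sum ?t {..<K} = sum ?t ({..<n + K} - {..<K})"
      by (rule sum_diff[symmetric]) auto
    also have "\<dots> \<in> G (?g + int K)"
    proof (rule G_sum)
      fix k assume "k \<in> {..<n + K} - {..<K}"
      then have "?g + int K \<le> ?g + int k" by auto
      moreover have "?t k \<in> G (?g + int k)"
        using L_multiple[of "int (c (?g + int k))" "?g + int k"] by simp
      ultimately show "?t k \<in> G (?g + int K)" using G_antimonoD by blast
    qed
    finally show ?thesis .
  qed
  ultimately show ?thesis by (rule closed_sequentially[OF closed_G, rotated])
qed

text \<open>The digits are peeled off one at a time; the remainders \<open>R k\<close> tend to \<open>0\<close>.\<close>

lemma expansion_exists:
  assumes "x \<noteq> 0"
  shows "\<exists>c. expansion x c"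
proof -
  let ?g = "adele_ord E \<iota> x"
  define dig where "dig y l = (THE c::nat. c < digit_bound l \<and> y - \<iota> (of_nat c * e l) \<in> G (l + 1))" for y l
  have dig: "dig y l < digit_bound l" "y - \<iota> (of_nat (dig y l) * e l) \<in> G (l + 1)" if "y \<in> G l" for y l
    using theI'[OF digit_ex1[OF that]] by (auto simp: dig_def)
  define R where "R = rec_nat x (\<lambda>k y. y - \<iota> (of_nat (dig y (?g + int k)) * e (?g + int k)))"
  have R_0: "R 0 = x" and R_Suc: "R (Suc k) = R k - \<iota> (of_nat (dig (R k) (?g + int k)) * e (?g + int k))" for k
    by (simp_all add: R_def)
  have R: "R k \<in> G (?g + int k)" for k
  proof (induction k)
    case 0
    then show ?case using nrm_eq_ord[OF assms] by (simp add: R_0 G_iff)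
  next
    case (Suc k)
    then show ?case using dig(2)[OF Suc] by (simp add: R_Suc algebra_simps)
  qed
  define c where "c l = (if l < ?g then 0 else dig (R (nat (l - ?g))) l)" for l
  have c: "c (?g + int k) = dig (R k) (?g + int k)" for k by (simp add: c_def)
  have "expansion x c"
    unfolding expansion_def
  proof (intro conjI allI impI)
    show "c l = 0" if "l < ?g" for l using that by (simp add: c_def)
    show "of_nat (c l) < exp_Lambda E (l + 1)" for l
    proof (cases "l < ?g")
      case True
      then show ?thesis using digit_bound(1)[of l] by (simp add: c_def exp_Lambda_Suc)
    next
      case False
      then show ?thesis using dig(1)[OF R[of "nat (l - ?g)"]] by (simp add: c_def exp_Lambda_Suc)
    qed
    show "c ?g \<noteq> 0"
    proof
      assume "c ?g = 0"
      then have "R (Suc 0) = x" using c[of 0] R_Suc[of 0] by (simp add: R_0 \<iota>_0)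
      then have "x \<in> G (?g + 1)" using R[of "Suc 0"] by simp
      then have "nrm x < 1 / q (?g + 1 - 1)" by (simp only: G_eq_strict)
      then show False using nrm_eq_ord[OF assms] by simp
    qed
    have partial: "partial_expansion x c K = x - R K" for K
    proof (induction K)
      case (Suc K)
      then show ?case unfolding R_Suc c[symmetric] by simp
    qed (simp add: R_0)
    show "(\<lambda>k. \<iota> (of_nat (c (?g + int k)) * e (?g + int k))) sums x"
      unfolding sums_def partial
    proof (rule tendstoI)
      fix d :: real assume "d > 0"
      obtain N where N: "1 / q (int N) < d" using q_small \<open>d > 0\<close> by blast
      show "\<forall>\<^sub>F K in sequentially. dist (x - R K) x < d"
        unfolding eventually_sequentially
      proof (intro exI[of _ "N + nat \<bar>?g\<bar>"] allI impI)
        fix K assume K: "N + nat \<bar>?g\<bar> \<le> K"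
        have "R K \<in> G (int N)" by (rule G_antimonoD[OF R[of K]]) (use K in linarith)
        then show "dist (x - R K) x < d"
          using N by (simp add: dist_eq_nrm[of _ x] G_iff)
      qed
    qed
  qed
  then show ?thesis by blast
qed

text \<open>At the first place where two expansions might differ they have the same remainder, which determines the digit.\<close>

lemma expansion_unique:
  assumes c: "expansion x c" and c': "expansion x c'"
  shows "c = c'"
proof
  let ?g = "adele_ord E \<iota> x"
  have digit: "a (?g + int k) < digit_bound (?g + int k) \<and>
      (x - partial_expansion x a k) - \<iota> (of_nat (a (?g + int k)) * e (?g + int k)) \<in> G (?g + int k + 1)"
    if "expansion x a" for a k
    using expansion_remainder[OF that, of "Suc k"] that
    by (simp add: expansion_def exp_Lambda_Suc algebra_simps)
  have eq: "c (?g + int k) = c' (?g + int k)" for k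
  proof (induction k rule: less_induct)
    case (less k)
    then have "partial_expansion x c k = partial_expansion x c' k"
      by (intro sum.cong) auto
    then show ?case
      using digit[OF c, of k] digit[OF c', of k] digit_ex1[OF expansion_remainder[OF c, of k]]
      by (metis (no_types, lifting))
  qed
  fix l show "c l = c' l"
  proof (cases "l < ?g")
    case True
    then show ?thesis using c c' by (simp add: expansion_def)
  next
    case False
    then show ?thesis using eq[of "nat (l - ?g)"] by simp
  qed
qed

lemma expansion_adele_digits:
  assumes "x \<noteq> 0"
  shows "expansion x (adele_digits E \<iota> x)"
proof -
  have "\<exists>!c. expansion x c" using expansion_exists[OF assms] expansion_unique by blast
  from theI'[OF this] show ?thesis unfolding adele_digits_def expansion_def .
qed

text \<open>All that is used of the digits later on: the fractional part represents \<open>x\<close> modulo \<open>G 0\<close>.\<close>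

lemma fractional_part_congruence: "x - \<iota> (fractional_part E \<iota> x) \<in> G 0"
proof (cases "x \<noteq> 0 \<and> adele_ord E \<iota> x < 0")
  case True
  let ?g = "adele_ord E \<iota> x" and ?c = "adele_digits E \<iota> x"
  have "fractional_part E \<iota> x = (\<Sum>l = ?g..-1. of_nat (?c l) * e l)"
    using True by (simp add: fractional_part_def)
  also have "\<dots> = (\<Sum>k<nat (- ?g). of_nat (?c (?g + int k)) * e (?g + int k))"
    by (rule sum.reindex_bij_witness[of _ "\<lambda>k. ?g + int k" "\<lambda>l. nat (l - ?g)"]) auto
  finally have "\<iota> (fractional_part E \<iota> x) = partial_expansion x ?c (nat (- ?g))"
    by (simp add: \<iota>_sum)
  then show ?thesis
    using expansion_remainder[OF expansion_adele_digits, of x "nat (- ?g)"] True by simp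
next
  case False
  then have "fractional_part E \<iota> x = 0" unfolding fractional_part_def by (rule if_not_P)
  moreover have "x \<in> G 0"
  proof (cases "x = 0")
    case False
    then have "adele_ord E \<iota> x \<ge> 0" using \<open>\<not> (x \<noteq> 0 \<and> adele_ord E \<iota> x < 0)\<close> by simp
    then have "1 \<le> q (adele_ord E \<iota> x)" using q_le_iff[of 0 "adele_ord E \<iota> x"] by simp
    then show ?thesis using nrm_eq_ord[OF False] by (simp add: G_iff)
  qed simp
  ultimately show ?thesis by (simp add: \<iota>_0)
qed

abbreviation ch :: "'a \<Rightarrow> complex" where "ch \<equiv> adele_char E \<iota>"

lemma exp_of_rat_cong:
  assumes "r - s \<in> \<int>"
  shows "exp (2 * of_real pi * \<i> * of_rat r) = exp (2 * of_real pi * \<i> * of_rat s)"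
proof -
  obtain k :: int where k: "r - s = of_int k" using assms by (auto elim: Ints_cases)
  then have "r = s + of_int k" by simp
  then have "2 * of_real pi * \<i> * of_rat r = 2 * of_real pi * \<i> * of_rat s + (2 * of_int k * of_real pi) * \<i>"
    by (simp add: of_rat_add algebra_simps)
  then have "exp (2 * of_real pi * \<i> * of_rat r) = exp (2 * of_real pi * \<i> * of_rat s) * exp ((2 * of_int k * of_real pi) * \<i>)"
    by (simp only: exp_add)
  also have "exp ((2 * of_int k * of_real pi) * \<i>) = 1"
    using exp_integer_2pi[of "of_int k"] by simp
  finally show ?thesis by simp
qed

text \<open>Two rational representatives modulo \<open>G 0\<close> differ by an integer.\<close>

lemma char_eq:
  assumes "x - \<iota> r \<in> G 0"
  shows "ch x = exp (2 * of_real pi * \<i> * of_rat r)"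
proof -
  have "\<iota> (fractional_part E \<iota> x) - \<iota> r \<in> G 0"
    using G_trans[OF _ assms] fractional_part_congruence[of x] G_minus_commute by blast
  then have "fractional_part E \<iota> x - r \<in> \<int>"
    by (simp add: L_0_iff flip: \<iota>_diff)
  then show ?thesis unfolding adele_char_def by (rule exp_of_rat_cong)
qed

lemma char_add: "ch (x + y) = ch x * ch y"
proof -
  obtain r s where r: "x - \<iota> r \<in> G 0" and s: "y - \<iota> s \<in> G 0"
    by (metis approximation_mod_G)
  have "x + y - \<iota> (r + s) \<in> G 0"
    using G_add[OF r s] by (simp add: \<iota>_add algebra_simps)
  from char_eq[OF this] show ?thesis
    by (simp add: char_eq[OF r] char_eq[OF s] of_rat_add algebra_simps flip: exp_add)
qed

lemma char_eq_1: "x \<in> G 0 \<Longrightarrow> ch x = 1"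
  using char_eq[of x 0] by (simp add: \<iota>_0)

lemma char_0 [simp]: "ch 0 = 1"
  by (rule char_eq_1) simp

lemma char_eq_1_iff: "ch x = 1 \<longleftrightarrow> x \<in> G 0"
proof
  assume 1: "ch x = 1"
  obtain r where r: "x - \<iota> r \<in> G 0" by (rule approximation_mod_G)
  have "exp (2 * of_real pi * \<i> * of_rat r) = 1" using char_eq[OF r] 1 by simp
  then obtain n :: int where n: "Im (2 * of_real pi * \<i> * of_rat r) = of_int (2 * n) * pi"
    using exp_eq_1 by blast
  obtain a b where ab: "r = of_int a / of_int b" "b > 0"
    by (cases r) (auto simp: Fract_of_int_quotient)
  have "of_rat r = complex_of_real (of_int a / of_int b)"
    by (simp add: ab of_rat_divide)
  then have "2 * pi * (of_int a / of_int b) = of_int (2 * n) * pi" using n by simp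
  then have "of_int a = (of_int (n * b) :: real)" using ab by (simp add: field_simps)
  then have "a = n * b" by (rule of_int_eq_iff[THEN iffD1])
  then have "r = of_int n" using ab by simp
  then have "\<iota> r \<in> G 0" by (simp add: L_0_iff)
  from G_add[OF r this] show "x \<in> G 0" by simp
qed (rule char_eq_1)

lemma char_minus: "ch (- x) * ch x = 1"
  using char_add[of "- x" x] by simp

lemma char_nonzero [simp]: "ch x \<noteq> 0"
  using char_minus[of x] by auto

lemma norm_char [simp]: "cmod (ch x) = 1"
proof -
  obtain a b where ab: "fractional_part E \<iota> x = of_int a / of_int b" "b > 0"
    by (cases "fractional_part E \<iota> x") (auto simp: Fract_of_int_quotient)
  have "of_rat (fractional_part E \<iota> x) = complex_of_real (of_int a / of_int b)"
    by (simp add: ab of_rat_divide)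
  then have "2 * of_real pi * \<i> * of_rat (fractional_part E \<iota> x) = \<i> * complex_of_real (2 * pi * (of_int a / of_int b))"
    by simp
  then show ?thesis unfolding adele_char_def by (simp only: norm_exp_i_times)
qed

lemma cnj_char: "cnj (ch x) = ch (- x)"
proof -
  have "cnj (ch x) * ch x = 1" using complex_norm_square[of "ch x"] by (simp add: mult.commute)
  then show ?thesis using char_minus[of x] by (metis char_nonzero mult_right_cancel)
qed

lemma char_cong: "x - y \<in> G 0 \<Longrightarrow> ch x = ch y"
  using char_add[of "x - y" y] char_eq_1[of "x - y"] by simp

lemma continuous_char: "continuous_on UNIV ch"
  unfolding continuous_on_topological
proof (intro ballI allI impI)
  fix x B assume B: "open B" "ch x \<in> B"
  show "\<exists>A. open A \<and> x \<in> A \<and> (\<forall>y\<in>UNIV. y \<in> A \<longrightarrow> ch y \<in> B)"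
    using B char_cong by (intro exI[of _ "{y. y - x \<in> G 0}"]) (auto simp: open_coset)
qed

lemma continuous_char_mult: "continuous_on UNIV (\<lambda>x. ch (\<xi> * x))"
proof -
  have "continuous_on UNIV (\<lambda>x. \<xi> * x)"
    unfolding continuous_on_def by (intro ballI tendsto_mult tendsto_const tendsto_ident_at)
  from continuous_on_compose2[OF continuous_char this] show ?thesis by simp
qed

lemma char_mult_eq_1: "\<xi> \<in> G (- n) \<Longrightarrow> x \<in> G n \<Longrightarrow> ch (\<xi> * x) = 1"
  by (intro char_eq_1 G_mult_dual)

text \<open>The annihilator of \<open>G n\<close> is \<open>G (- n)\<close>: the single test point \<open>\<iota> (e n)\<close> detects every \<open>\<xi>\<close> outside.\<close>

lemma annihilator_G:
  assumes "\<xi> \<notin> G (- n)"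
  obtains x where "x \<in> G n" "ch (\<xi> * x) \<noteq> 1"
proof (rule that[of "\<iota> (e n)"])
  show "\<iota> (e n) \<in> G n" using L_multiple[of 1 n] by simp
  show "ch (\<xi> * \<iota> (e n)) \<noteq> 1"
  proof
    assume "ch (\<xi> * \<iota> (e n)) = 1"
    then have "\<xi> * \<iota> (e n) \<in> G 0" by (simp add: char_eq_1_iff)
    moreover have "\<iota> (e (- n)) \<in> G (- n)" using L_multiple[of 1 "- n"] by simp
    ultimately have "(\<xi> * \<iota> (e n)) * \<iota> (e (- n)) \<in> G (- n)" by (rule G_0_mult)
    also have "(\<xi> * \<iota> (e n)) * \<iota> (e (- n)) = \<xi> * \<iota> (e n * e (- n))"
      by (simp add: \<iota>_mult mult.assoc)
    also have "e n * e (- n) = 1" using e_pos[of n] by (simp add: e_minus)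
    finally show False using assms by (simp add: \<iota>_1)
  qed
qed

end

section \<open>Haar measure and characters\<close>

locale adele_haar = adele_ring E \<iota>
  for E and \<iota> :: "rat \<Rightarrow> 'a::{comm_ring_1, topological_ab_group_add,
      topological_semigroup_mult, complete_space}" +
  fixes M :: "'a measure"
  assumes haar: "normalized_haar E \<iota> M"
begin

lemma sets_M [measurable_cong, simp]: "sets M = sets borel"
  using haar by (simp add: normalized_haar_def)

lemma space_M [simp]: "space M = UNIV"
  using sets_eq_imp_space_eq[OF sets_M] by simp

lemma emeasure_translate: "B \<in> sets borel \<Longrightarrow> emeasure M ((\<lambda>x. a + x) ` B) = emeasure M B"
  using haar unfolding normalized_haar_def sets_M by blast

lemma emeasure_G_0: "emeasure M (G 0) = 1"
  using haar by (simp add: normalized_haar_def adele_norm_eq G_def)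

lemma measurable_continuous:
  "continuous_on UNIV (f :: 'a \<Rightarrow> 'b::topological_space) \<Longrightarrow> f \<in> borel_measurable M"
  using borel_measurable_continuous_onI[of f] by (simp cong: measurable_cong_sets)

lemma char_measurable [measurable]: "(\<lambda>x. ch (\<xi> * x)) \<in> borel_measurable M"
  by (rule measurable_continuous[OF continuous_char_mult])

abbreviation coset :: "'a \<Rightarrow> int \<Rightarrow> 'a set" where "coset a n \<equiv> {x. x - a \<in> G n}"

lemma coset_sets [measurable, simp]: "coset a n \<in> sets borel"
  using open_coset by simp

lemma coset_eq_image: "coset a n = (\<lambda>x. a + x) ` G n"
proof (intro set_eqI iffI)
  fix x assume "x \<in> coset a n"
  then show "x \<in> (\<lambda>x. a + x) ` G n" by (intro image_eqI[of _ _ "x - a"]) auto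
qed auto

lemma emeasure_coset_eq: "emeasure M (coset a n) = emeasure M (G n)"
  unfolding coset_eq_image using coset_sets[of 0 n] by (intro emeasure_translate) simp

text \<open>The digits at place \<open>n\<close> enumerate the cosets of \<open>G (n + 1)\<close> in \<open>G n\<close>.\<close>

lemma emeasure_G_Suc: "emeasure M (G n) = of_nat (digit_bound n) * emeasure M (G (n + 1))"
proof -
  let ?B = "\<lambda>k. coset (\<iota> (of_nat k * e n)) (n + 1)"
  have "G n = (\<Union>k<digit_bound n. ?B k)"
  proof (intro set_eqI iffI)
    fix x assume "x \<in> G n"
    from ex1_implies_ex[OF digit_ex1[OF this]] show "x \<in> (\<Union>k<digit_bound n. ?B k)" by auto
  next
    fix x assume "x \<in> (\<Union>k<digit_bound n. ?B k)"
    then obtain k where k: "x - \<iota> (of_nat k * e n) \<in> G n"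
      using G_antimonoD[of _ "n + 1" n] by auto
    have "\<iota> (of_nat k * e n) \<in> G n" using L_multiple[of "int k" n] by simp
    from G_add[OF k this] show "x \<in> G n" by simp
  qed
  moreover have "disjoint_family_on ?B {..<digit_bound n}"
    unfolding disjoint_family_on_def
  proof (intro ballI impI)
    fix k l assume kl: "k \<in> {..<digit_bound n}" "l \<in> {..<digit_bound n}" "k \<noteq> l"
    show "?B k \<inter> ?B l = {}"
    proof (rule ccontr)
      assume "?B k \<inter> ?B l \<noteq> {}"
      then obtain x where x: "x \<in> ?B k" "x \<in> ?B l" by blast
      then have "x - \<iota> (of_nat k * e n) \<in> G n"
        using G_antimonoD[of _ "n + 1" n] by auto
      moreover have "\<iota> (of_nat k * e n) \<in> G n" using L_multiple[of "int k" n] by simp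
      ultimately have "x \<in> G n" using G_add by fastforce
      from digit_ex1[OF this] show False using x kl by blast
    qed
  qed
  ultimately have "emeasure M (G n) = (\<Sum>k<digit_bound n. emeasure M (?B k))"
    by (subst sum_emeasure) auto
  then show ?thesis by (simp add: emeasure_coset_eq)
qed

text \<open>The normalization at \<open>0\<close> propagates in both directions through the indices of the groups.\<close>

lemma emeasure_G: "emeasure M (G n) = ennreal (1 / q n)"
proof (induction n rule: int_induct[of _ 0])
  case base
  show ?case by (simp add: emeasure_G_0)
next
  case (step1 n)
  let ?d = "digit_bound n"
  have d: "?d > 0" using digit_bound(1)[of n] by simp
  have *: "of_nat ?d * emeasure M (G (n + 1)) = ennreal (1 / q n)"
    using emeasure_G_Suc[of n] step1 by simp
  have "emeasure M (G (n + 1)) \<noteq> top"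
  proof
    assume "emeasure M (G (n + 1)) = top"
    with * d show False by (simp add: ennreal_mult_eq_top_iff ennreal_mult_top)
  qed
  then obtain r where r: "emeasure M (G (n + 1)) = ennreal r" "r \<ge> 0" by (cases "emeasure M (G (n + 1))") auto
  have "ennreal (of_nat ?d * r) = ennreal (1 / q n)"
    using * r by (simp add: ennreal_mult ennreal_of_nat_eq_real_of_nat)
  then have "of_nat ?d * r = 1 / q n" using r by (simp add: ennreal_inj)
  then have "r = 1 / q (n + 1)" using d unfolding q_Suc by (simp add: field_simps)
  then show ?case using r by simp
next
  case (step2 n)
  have "emeasure M (G (n - 1)) = of_nat (digit_bound (n - 1)) * ennreal (1 / q n)"
    using emeasure_G_Suc[of "n - 1"] step2 by simp
  also have "\<dots> = ennreal (of_nat (digit_bound (n - 1)) * (1 / q n))"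
    unfolding ennreal_of_nat_eq_real_of_nat by (rule ennreal_mult[symmetric]) auto
  also have "of_nat (digit_bound (n - 1)) * (1 / q n) = 1 / q (n - 1)"
    using q_Suc[of "n - 1"] digit_bound(1)[of "n - 1"] by simp
  finally show ?case .
qed

lemma emeasure_coset: "emeasure M (coset a n) = ennreal (1 / q n)"
  by (simp add: emeasure_coset_eq emeasure_G)

lemma measure_coset: "measure M (coset a n) = 1 / q n"
  by (simp add: measure_def emeasure_coset)

definition ind :: "'a \<Rightarrow> int \<Rightarrow> 'a \<Rightarrow> complex" where
  "ind a n x = (if x - a \<in> G n then 1 else 0)"

lemma ind_eq_indicator: "ind a n = (\<lambda>x. indicator (coset a n) x)"
  by (auto simp: ind_def indicator_def)

lemma ind_measurable [measurable]: "ind a n \<in> borel_measurable M"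
  unfolding ind_eq_indicator by (intro borel_measurable_indicator) simp

lemma ind_integrable: "integrable M (ind a n)"
proof -
  have "integrable M (\<lambda>x. complex_of_real (indicator (coset a n) x))"
    by (intro integrable_of_real integrable_real_indicator) (auto simp: emeasure_coset)
  moreover have "(\<lambda>x. complex_of_real (indicator (coset a n) x)) = ind a n"
    by (auto simp: ind_def indicator_def)
  ultimately show ?thesis by simp
qed

lemma norm_ind: "cmod (ind a n x) \<le> 1"
  by (simp add: ind_def)

lemma ind_integral: "(\<integral>x. ind a n x \<partial>M) = of_real (1 / q n)"
proof -
  have "(\<integral>x. ind a n x \<partial>M) = (\<integral>x. complex_of_real (indicator (coset a n) x) \<partial>M)"
    by (intro Bochner_Integration.integral_cong) (auto simp: ind_def indicator_def)
  also have "\<dots> = of_real (\<integral>x. indicator (coset a n) x \<partial>M)"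
    by (rule integral_complex_of_real)
  also have "\<dots> = of_real (1 / q n)" by (simp add: measure_coset)
  finally show ?thesis .
qed

lemma integrable_bounded_mult:
  fixes f g :: "'a \<Rightarrow> complex"
  assumes f: "integrable M f" and [measurable]: "g \<in> borel_measurable M" and g: "\<And>x. cmod (g x) \<le> C"
  shows "integrable M (\<lambda>x. f x * g x)"
proof (rule Bochner_Integration.integrable_bound)
  show "integrable M (\<lambda>x. of_real C * f x)" using f by simp
  show "(\<lambda>x. f x * g x) \<in> borel_measurable M" using f by measurable
  have "cmod (f x) * cmod (g x) \<le> cmod (f x) * \<bar>C\<bar>" for x
    using g[of x] by (intro mult_left_mono) auto
  then show "AE x in M. cmod (f x * g x) \<le> cmod (of_real C * f x)"
    by (simp add: norm_mult mult.commute)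
qed

lemma integral_translate:
  fixes f :: "'a \<Rightarrow> complex"
  assumes f: "f \<in> borel_measurable M"
  shows "(\<integral>x. f (a + x) \<partial>M) = (\<integral>x. f x \<partial>M)"
proof -
  have "continuous_on UNIV (\<lambda>x. a + x)" by (intro continuous_intros)
  from borel_measurable_continuous_onI[OF this]
  have T: "(\<lambda>x. a + x) \<in> measurable M M" by (simp cong: measurable_cong_sets)
  have "distr M M (\<lambda>x. a + x) = M"
  proof (rule measure_eqI)
    fix B assume "B \<in> sets (distr M M (\<lambda>x. a + x))"
    then have B: "B \<in> sets M" by simp
    have "(\<lambda>x. a + x) -` B = (\<lambda>x. - a + x) ` B"
    proof (intro set_eqI iffI)
      fix x assume "x \<in> (\<lambda>x. a + x) -` B"
      then show "x \<in> (\<lambda>x. - a + x) ` B" by (intro image_eqI[of _ _ "a + x"]) auto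
    qed auto
    then show "emeasure (distr M M (\<lambda>x. a + x)) B = emeasure M B"
      using B emeasure_translate[of B "- a"] by (simp add: emeasure_distr[OF T])
  qed simp
  then show ?thesis using integral_distr[OF T f] by simp
qed

text \<open>Orthogonality of characters: outside the annihilator, translating by a point of \<open>G n\<close> on which
  the character is not \<open>1\<close> multiplies the integral by a factor different from \<open>1\<close>.\<close>

lemma char_integral: "(\<integral>x. ind a n x * ch (\<xi> * x) \<partial>M) = ch (\<xi> * a) * (if \<xi> \<in> G (- n) then of_real (1 / q n) else 0)"
proof (cases "\<xi> \<in> G (- n)")
  case True
  have eq: "ind a n x * ch (\<xi> * x) = ch (\<xi> * a) * ind a n x" for x
  proof (cases "x - a \<in> G n")
    case in_coset: True
    have "ch (\<xi> * x) = ch (\<xi> * (x - a)) * ch (\<xi> * a)"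
      by (simp add: char_add[symmetric] algebra_simps)
    then show ?thesis using char_mult_eq_1[OF True in_coset] by simp
  qed (simp add: ind_def)
  show ?thesis using True by (simp only: eq) (simp add: ind_integral)
next
  case False
  then obtain x0 where x0: "x0 \<in> G n" "ch (\<xi> * x0) \<noteq> 1" by (rule annihilator_G)
  let ?I = "\<integral>x. ind a n x * ch (\<xi> * x) \<partial>M"
  have "?I = (\<integral>x. ind a n (x0 + x) * ch (\<xi> * (x0 + x)) \<partial>M)"
    by (rule integral_translate[symmetric]) measurable
  also have "\<dots> = (\<integral>x. ch (\<xi> * x0) * (ind a n x * ch (\<xi> * x)) \<partial>M)"
  proof (intro Bochner_Integration.integral_cong refl)
    fix x
    have "x0 + x - a \<in> G n \<longleftrightarrow> x - a \<in> G n"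
      using G_add[OF x0(1), of "x - a"] G_diff[of "x0 + x - a" n x0] x0(1) by (auto simp: algebra_simps)
    then show "ind a n (x0 + x) * ch (\<xi> * (x0 + x)) = ch (\<xi> * x0) * (ind a n x * ch (\<xi> * x))"
      by (simp add: ind_def char_add distrib_left)
  qed
  also have "\<dots> = ch (\<xi> * x0) * ?I" by simp
  finally have "(1 - ch (\<xi> * x0)) * ?I = 0" by (simp add: algebra_simps)
  then show ?thesis using x0 False by simp
qed

section \<open>Test functions and Plancherel\<close>

abbreviation FT :: "('a \<Rightarrow> complex) \<Rightarrow> 'a \<Rightarrow> complex" where "FT \<equiv> fourier E \<iota> M"

lemma FT_integrable: "integrable M f \<Longrightarrow> integrable M (\<lambda>x. f x * ch (\<xi> * x))"
  by (rule integrable_bounded_mult[where C = 1]) auto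

lemma FT_add: "integrable M f \<Longrightarrow> integrable M g \<Longrightarrow> FT (\<lambda>x. f x + g x) \<xi> = FT f \<xi> + FT g \<xi>"
  by (simp add: fourier_def distrib_right FT_integrable)

lemma FT_diff: "integrable M f \<Longrightarrow> integrable M g \<Longrightarrow> FT (\<lambda>x. f x - g x) \<xi> = FT f \<xi> - FT g \<xi>"
  by (simp add: fourier_def left_diff_distrib FT_integrable)

lemma FT_cmult: "FT (\<lambda>x. c * f x) \<xi> = c * FT f \<xi>"
  by (simp add: fourier_def mult.assoc)

lemma norm_FT_le: "cmod (FT f \<xi>) \<le> (\<integral>x. cmod (f x) \<partial>M)"
  unfolding fourier_def using integral_norm_bound[of M "\<lambda>x. f x * ch (\<xi> * x)"] by (simp add: norm_mult)

lemma FT_ind: "FT (ind a n) \<xi> = ch (\<xi> * a) * (of_real (1 / q n) * ind 0 (- n) \<xi>)"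
  unfolding fourier_def char_integral by (simp add: ind_def)

lemma bounded_integrable_L2:
  assumes f: "integrable M f" and bound: "\<And>x. cmod (f x) \<le> C"
  shows "f \<in> L2 M"
proof (rule L2_dominated_sq)
  show "integrable M (\<lambda>x. C * cmod (f x))" using f by simp
  show "AE x in M. (cmod (f x))\<^sup>2 \<le> C * cmod (f x)"
    using bound by (auto simp: power2_eq_square intro!: mult_right_mono)
qed (use f in simp)

lemma ind_L2: "ind a n \<in> L2 M"
  by (rule bounded_integrable_L2[OF ind_integrable norm_ind])

text \<open>In this form, a character on the dual ball, the transform can be transformed again by the orthogonality
  relation with the two balls exchanged.\<close>

lemma FT_ind_eq: "FT (ind a n) = (\<lambda>\<xi>. (of_real (1 / q n) * ind 0 (- n) \<xi>) * ch (a * \<xi>))"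
  by (rule ext) (simp only: FT_ind mult.commute)

lemma FT_ind_integrable: "integrable M (FT (ind a n))"
  unfolding FT_ind_eq
  by (rule integrable_bounded_mult[where C = 1]) (auto intro!: integrable_mult_right ind_integrable)

lemma FT_ind_L2: "FT (ind a n) \<in> L2 M"
proof (rule bounded_integrable_L2[OF FT_ind_integrable])
  show "cmod (FT (ind a n) x) \<le> 1 / q n" for x
    unfolding FT_ind_eq by (simp add: norm_mult norm_divide ind_def)
qed

lemma FT_FT_ind: "FT (FT (ind a n)) y = ind (- a) n y"
proof -
  have "FT (FT (ind a n)) y = (\<integral>\<xi>. of_real (1 / q n) * (ind 0 (- n) \<xi> * ch ((a + y) * \<xi>)) \<partial>M)"
    unfolding FT_ind_eq fourier_def[of _ _ _ _ y]
    by (intro Bochner_Integration.integral_cong) (auto simp: char_add distrib_right)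
  also have "\<dots> = of_real (1 / q n) * (ch ((a + y) * 0) * (if a + y \<in> G (- (- n)) then of_real (1 / q (- n)) else 0))"
    unfolding char_integral[symmetric] by simp
  also have "\<dots> = ind (- a) n y"
    by (simp add: ind_def q_minus add.commute)
  finally show ?thesis .
qed

text \<open>The Schwartz--Bruhat functions, as the span of the ball indicators.\<close>

inductive_set Test :: "('a \<Rightarrow> complex) set" where
  Test_ind: "ind a n \<in> Test"
| Test_add: "f \<in> Test \<Longrightarrow> g \<in> Test \<Longrightarrow> (\<lambda>x. f x + g x) \<in> Test"
| Test_cmult: "f \<in> Test \<Longrightarrow> (\<lambda>x. c * f x) \<in> Test"

lemma Test_diff: "f \<in> Test \<Longrightarrow> g \<in> Test \<Longrightarrow> (\<lambda>x. f x - g x) \<in> Test"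
  using Test_add[OF _ Test_cmult, of f g "-1"] by simp

lemma Test_zero: "(\<lambda>x. 0) \<in> Test"
  using Test_cmult[OF Test_ind, of 0] by simp

lemma Test_integrable: "f \<in> Test \<Longrightarrow> integrable M f"
  by (induction rule: Test.induct) (auto intro: ind_integrable)

lemma Test_L2: "f \<in> Test \<Longrightarrow> f \<in> L2 M"
  by (induction rule: Test.induct) (auto intro: ind_L2 L2_add L2_cmult)

lemma FT_Test_L2: "f \<in> Test \<Longrightarrow> FT f \<in> L2 M"
proof (induction rule: Test.induct)
  case (Test_add f g)
  then have "FT (\<lambda>x. f x + g x) = (\<lambda>\<xi>. FT f \<xi> + FT g \<xi>)" using Test_integrable by (simp add: fun_eq_iff FT_add)
  then show ?case using Test_add by (simp add: L2_add)
next
  case (Test_cmult f c)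
  then show ?case by (simp add: FT_cmult[abs_def] L2_cmult)
qed (rule FT_ind_L2)

definition ip :: "('a \<Rightarrow> complex) \<Rightarrow> ('a \<Rightarrow> complex) \<Rightarrow> complex" where
  "ip f g = (\<integral>x. f x * cnj (g x) \<partial>M)"

lemma L2_cnj:
  assumes "f \<in> L2 M"
  shows "(\<lambda>x. cnj (f x)) \<in> L2 M"
proof (rule L2_dominated[OF _ assms])
  have "cnj \<in> borel_measurable borel"
    by (intro borel_measurable_continuous_onI continuous_intros)
  from measurable_compose[OF L2_measurable[OF assms] this]
  show "(\<lambda>x. cnj (f x)) \<in> borel_measurable M" .
qed simp

lemma ip_integrable: "f \<in> L2 M \<Longrightarrow> g \<in> L2 M \<Longrightarrow> integrable M (\<lambda>x. f x * cnj (g x))"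
  by (intro L2_mult_integrable L2_cnj)

lemma ip_add_left: "f \<in> L2 M \<Longrightarrow> f' \<in> L2 M \<Longrightarrow> g \<in> L2 M \<Longrightarrow> ip (\<lambda>x. f x + f' x) g = ip f g + ip f' g"
  by (simp add: ip_def distrib_right ip_integrable)

lemma ip_cmult_left: "ip (\<lambda>x. c * f x) g = c * ip f g"
  by (simp add: ip_def mult.assoc)

lemma ip_add_right: "f \<in> L2 M \<Longrightarrow> g \<in> L2 M \<Longrightarrow> g' \<in> L2 M \<Longrightarrow> ip f (\<lambda>x. g x + g' x) = ip f g + ip f g'"
  by (simp add: ip_def distrib_left ip_integrable)

lemma ip_cmult_right: "ip f (\<lambda>x. c * g x) = cnj c * ip f g"
  by (simp add: ip_def mult.left_commute)

lemma ip_self: "ip f f = of_real ((L2_norm M f)\<^sup>2)"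
  unfolding ip_def L2_norm_sq complex_norm_square[symmetric] of_real_power[symmetric]
  by (rule integral_complex_of_real)

text \<open>Two balls are disjoint or nested, on both sides of the Fourier transform.\<close>

lemma ip_ind: "ip (ind a m) (ind b n) = (if a - b \<in> G (min m n) then of_real (1 / q (max m n)) else 0)"
proof -
  define c where "c = (if m \<ge> n then a else b)"
  have "ind a m x * cnj (ind b n x) = (if a - b \<in> G (min m n) then 1 else 0) * ind c (max m n) x" for x
  proof -
    have iff: "x - a \<in> G k \<longleftrightarrow> x - b \<in> G k" if "a - b \<in> G k" for k
      using that G_trans[of x a k b] G_trans[of x b k a] G_minus_commute by blast
    have ab: "a - b \<in> G (min m n)" if "x - a \<in> G m" "x - b \<in> G n"
      using G_trans[of a x "min m n" b] that G_antimonoD[of "x - a" m "min m n"]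
        G_antimonoD[of "x - b" n "min m n"] G_minus_commute by auto
    show ?thesis
    proof (cases "a - b \<in> G (min m n)")
      case True
      show ?thesis
      proof (cases "m \<ge> n")
        case mn: True
        then have "x - b \<in> G n" if "x - a \<in> G m"
          using iff[of n] True G_antimonoD[OF that mn] by (simp add: min_absorb2)
        then show ?thesis using True mn by (auto simp: ind_def c_def max_absorb1)
      next
        case False
        then have mn: "m \<le> n" by simp
        then have "x - a \<in> G m" if "x - b \<in> G n"
          using iff[of m] True G_antimonoD[OF that mn] by (simp add: min_absorb1)
        then show ?thesis using True False by (auto simp: ind_def c_def max_def)
      qed
    next
      case False
      then show ?thesis using ab by (auto simp: ind_def)
    qed
  qed
  then have "ip (ind a m) (ind b n) = (if a - b \<in> G (min m n) then 1 else 0) * (\<integral>x. ind c (max m n) x \<partial>M)"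
    by (simp add: ip_def)
  then show ?thesis by (simp add: ind_integral)
qed

lemma ip_FT_ind: "ip (FT (ind a m)) (FT (ind b n)) = ip (ind a m) (ind b n)"
proof -
  have "FT (ind a m) \<xi> * cnj (FT (ind b n) \<xi>) = of_real (1 / (q m * q n)) * (ind 0 (- min m n) \<xi> * ch ((a - b) * \<xi>))" for \<xi>
  proof -
    have inds: "ind 0 (- m) \<xi> * cnj (ind 0 (- n) \<xi>) = ind 0 (- min m n) \<xi>"
      using G_antimonoD[of \<xi> "- m" "- n"] G_antimonoD[of \<xi> "- n" "- m"]
      by (auto simp: ind_def min_def)
    have chs: "ch (a * \<xi>) * cnj (ch (b * \<xi>)) = ch ((a - b) * \<xi>)"
      by (simp add: cnj_char char_add[symmetric] algebra_simps)
    have "(of_real r * i * c) * cnj (of_real s * j * d) = of_real (r * s) * ((i * cnj j) * (c * cnj d))"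
      for r s :: real and i j c d :: complex by (simp add: mult_ac)
    then show ?thesis unfolding FT_ind_eq inds[symmetric] chs[symmetric] by simp
  qed
  then have "ip (FT (ind a m)) (FT (ind b n))
      = of_real (1 / (q m * q n)) * (if a - b \<in> G (min m n) then of_real (1 / q (- min m n)) else 0)"
    by (simp add: ip_def char_integral)
  also have "\<dots> = (if a - b \<in> G (min m n) then of_real (1 / q (max m n)) else 0)"
    by (auto simp: q_minus min_def max_def)
  finally show ?thesis unfolding ip_ind .
qed

lemma FT_ip_Test:
  assumes "f \<in> Test" "g \<in> Test"
  shows "ip (FT f) (FT g) = ip f g"
proof -
  have FT_add': "FT (\<lambda>x. f x + g x) = (\<lambda>\<xi>. FT f \<xi> + FT g \<xi>)" if "f \<in> Test" "g \<in> Test" for f g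
    using that by (simp add: fun_eq_iff FT_add Test_integrable)
  have 1: "ip (FT (ind a n)) (FT g) = ip (ind a n) g" for a n
    using assms(2)
  proof (induction rule: Test.induct)
    case (Test_add f g)
    then show ?case
      by (simp add: FT_add' ip_add_right FT_Test_L2 Test_L2 Test.Test_ind ind_L2 FT_ind_L2)
  next
    case (Test_cmult f c)
    then show ?case by (simp add: FT_cmult[abs_def] ip_cmult_right)
  qed (rule ip_FT_ind)
  show ?thesis
    using assms(1)
  proof (induction rule: Test.induct)
    case (Test_add f f')
    then show ?case using assms(2)
      by (simp add: FT_add' ip_add_left FT_Test_L2 Test_L2)
  next
    case (Test_cmult f c)
    then show ?case by (simp add: FT_cmult[abs_def] ip_cmult_left)
  qed (rule 1)
qed

lemma FT_norm_Test:
  assumes "f \<in> Test"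
  shows "L2_norm M (FT f) = L2_norm M f"
proof -
  have "of_real ((L2_norm M (FT f))\<^sup>2) = (of_real ((L2_norm M f)\<^sup>2) :: complex)"
    using FT_ip_Test[OF assms assms] by (simp only: ip_self)
  then have "(L2_norm M (FT f))\<^sup>2 = (L2_norm M f)\<^sup>2" by (rule of_real_eq_iff[THEN iffD1])
  then show ?thesis using power2_eq_imp_eq[OF _ L2_norm_nonneg L2_norm_nonneg] by blast
qed

end

context adele_haar
begin

subsection \<open>Density of the test functions\<close>

text \<open>Approximation is required in mean and in mean square at once: the first controls Fourier
  transforms pointwise, the second controls them in norm.\<close>

definition approximable :: "('a \<Rightarrow> complex) \<Rightarrow> bool" where
  "approximable f \<longleftrightarrow> integrable M f \<and> f \<in> L2 M \<and>
     (\<forall>d>0. \<exists>g\<in>Test. (\<integral>x. cmod (f x - g x) \<partial>M) < d \<and> L2_norm M (\<lambda>x. f x - g x) < d)"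

lemma integral_norm_triangle:
  fixes f g h :: "'a \<Rightarrow> complex"
  assumes "integrable M f" "integrable M g" "integrable M h"
  shows "(\<integral>x. cmod (f x - h x) \<partial>M) \<le> (\<integral>x. cmod (f x - g x) \<partial>M) + (\<integral>x. cmod (g x - h x) \<partial>M)"
proof -
  have "(\<integral>x. cmod (f x - h x) \<partial>M) \<le> (\<integral>x. cmod (f x - g x) + cmod (g x - h x) \<partial>M)"
  proof (rule integral_mono)
    show "cmod (f x - h x) \<le> cmod (f x - g x) + cmod (g x - h x)" for x
      using norm_triangle_ineq[of "f x - g x" "g x - h x"] by simp
  qed (use assms in auto)
  also have "\<dots> = (\<integral>x. cmod (f x - g x) \<partial>M) + (\<integral>x. cmod (g x - h x) \<partial>M)"
    using assms by (intro Bochner_Integration.integral_add) auto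
  finally show ?thesis .
qed

lemma approximable_Test:
  assumes "f \<in> Test"
  shows "approximable f"
  unfolding approximable_def using assms Test_integrable Test_L2 by (auto intro!: bexI[of _ f])

lemma approximable_limit:
  assumes X: "\<And>n. approximable (X n)" and f: "integrable M f" "f \<in> L2 M"
    and lim: "(\<lambda>n. \<integral>x. cmod (f x - X n x) \<partial>M) \<longlonglongrightarrow> 0" "(\<lambda>n. L2_norm M (\<lambda>x. f x - X n x)) \<longlonglongrightarrow> 0"
  shows "approximable f"
  unfolding approximable_def
proof (intro conjI allI impI f)
  fix d :: real assume "d > 0"
  then have "\<forall>\<^sub>F n in sequentially. (\<integral>x. cmod (f x - X n x) \<partial>M) < d / 2"
    "\<forall>\<^sub>F n in sequentially. L2_norm M (\<lambda>x. f x - X n x) < d / 2"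
    using order_tendstoD(2)[OF lim(1), of "d / 2"] order_tendstoD(2)[OF lim(2), of "d / 2"] \<open>d > 0\<close>
    by simp_all
  then have "\<forall>\<^sub>F n in sequentially. (\<integral>x. cmod (f x - X n x) \<partial>M) < d / 2 \<and> L2_norm M (\<lambda>x. f x - X n x) < d / 2"
    by eventually_elim simp
  then obtain n where n: "(\<integral>x. cmod (f x - X n x) \<partial>M) < d / 2" "L2_norm M (\<lambda>x. f x - X n x) < d / 2"
    by (auto simp: eventually_sequentially)
  have Xn: "integrable M (X n)" "X n \<in> L2 M" using X[of n] by (auto simp: approximable_def)
  obtain g where g: "g \<in> Test" "(\<integral>x. cmod (X n x - g x) \<partial>M) < d / 2" "L2_norm M (\<lambda>x. X n x - g x) < d / 2"
    using X[of n] \<open>d > 0\<close> unfolding approximable_def by (meson half_gt_zero)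
  show "\<exists>g\<in>Test. (\<integral>x. cmod (f x - g x) \<partial>M) < d \<and> L2_norm M (\<lambda>x. f x - g x) < d"
    using integral_norm_triangle[OF f(1) Xn(1) Test_integrable[OF g(1)]]
      L2_norm_triangle_mid[OF f(2) Xn(2) Test_L2[OF g(1)]] g n by (intro bexI[of _ g]) auto
qed

lemma approximable_sequence:
  assumes "approximable f"
  obtains g where "\<And>n. g n \<in> Test" "(\<lambda>n. \<integral>x. cmod (f x - g n x) \<partial>M) \<longlonglongrightarrow> 0"
    "(\<lambda>n. L2_norm M (\<lambda>x. f x - g n x)) \<longlonglongrightarrow> 0"
proof -
  have "\<exists>g. g \<in> Test \<and> (\<integral>x. cmod (f x - g x) \<partial>M) < inverse (real (Suc n)) \<and>
      L2_norm M (\<lambda>x. f x - g x) < inverse (real (Suc n))" for n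
    using assms unfolding approximable_def by (metis inverse_positive_iff_positive of_nat_0_less_iff zero_less_Suc)
  then obtain g where g: "\<And>n. g n \<in> Test" "\<And>n. (\<integral>x. cmod (f x - g n x) \<partial>M) < inverse (real (Suc n))"
    "\<And>n. L2_norm M (\<lambda>x. f x - g n x) < inverse (real (Suc n))" by metis
  show ?thesis
  proof (rule that[of g])
    show "(\<lambda>n. \<integral>x. cmod (f x - g n x) \<partial>M) \<longlonglongrightarrow> 0"
    proof (rule tendsto_sandwich[OF _ _ tendsto_const LIMSEQ_inverse_real_of_nat])
      show "\<forall>\<^sub>F n in sequentially. (\<integral>x. cmod (f x - g n x) \<partial>M) \<le> inverse (real (Suc n))"
        by (intro always_eventually allI less_imp_le g(2))
    qed simp
    show "(\<lambda>n. L2_norm M (\<lambda>x. f x - g n x)) \<longlonglongrightarrow> 0"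
    proof (rule tendsto_sandwich[OF _ _ tendsto_const LIMSEQ_inverse_real_of_nat])
      show "\<forall>\<^sub>F n in sequentially. (L2_norm M (\<lambda>x. f x - g n x)) \<le> inverse (real (Suc n))"
        by (intro always_eventually allI less_imp_le g(3))
    qed simp
  qed (rule g)
qed

lemma approximable_add:
  assumes f: "approximable f" and g: "approximable g"
  shows "approximable (\<lambda>x. f x + g x)"
proof -
  obtain f' where f': "\<And>n. f' n \<in> Test" "(\<lambda>n. \<integral>x. cmod (f x - f' n x) \<partial>M) \<longlonglongrightarrow> 0"
    "(\<lambda>n. L2_norm M (\<lambda>x. f x - f' n x)) \<longlonglongrightarrow> 0" using approximable_sequence[OF f] by blast
  obtain g' where g': "\<And>n. g' n \<in> Test" "(\<lambda>n. \<integral>x. cmod (g x - g' n x) \<partial>M) \<longlonglongrightarrow> 0"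
    "(\<lambda>n. L2_norm M (\<lambda>x. g x - g' n x)) \<longlonglongrightarrow> 0" using approximable_sequence[OF g] by blast
  have fg: "integrable M f" "f \<in> L2 M" "integrable M g" "g \<in> L2 M"
    using f g by (auto simp: approximable_def)
  note T = Test_integrable[OF f'(1)] Test_L2[OF f'(1)] Test_integrable[OF g'(1)] Test_L2[OF g'(1)]
  show ?thesis
  proof (rule approximable_limit)
    show "approximable (\<lambda>x. f' n x + g' n x)" for n
      by (intro approximable_Test Test_add f' g')
    have "(\<integral>x. cmod (f x + g x - (f' n x + g' n x)) \<partial>M)
        \<le> (\<integral>x. cmod (f x - f' n x) \<partial>M) + (\<integral>x. cmod (g x - g' n x) \<partial>M)" for n
    proof -
      have "(\<integral>x. cmod (f x + g x - (f' n x + g' n x)) \<partial>M) \<le> (\<integral>x. cmod (f x - f' n x) + cmod (g x - g' n x) \<partial>M)"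
      proof (rule integral_mono)
        show "cmod (f x + g x - (f' n x + g' n x)) \<le> cmod (f x - f' n x) + cmod (g x - g' n x)" for x
          using norm_triangle_ineq[of "f x - f' n x" "g x - g' n x"] by (simp add: algebra_simps)
      qed (use fg T in auto)
      also have "\<dots> = (\<integral>x. cmod (f x - f' n x) \<partial>M) + (\<integral>x. cmod (g x - g' n x) \<partial>M)"
        using fg T by (intro Bochner_Integration.integral_add) auto
      finally show ?thesis .
    qed
    then show "(\<lambda>n. \<integral>x. cmod (f x + g x - (f' n x + g' n x)) \<partial>M) \<longlonglongrightarrow> 0"
      by (intro tendsto_sandwich[OF _ _ tendsto_const tendsto_add_zero[OF f'(2) g'(2)]]) auto
    have "L2_norm M (\<lambda>x. f x + g x - (f' n x + g' n x))
        \<le> L2_norm M (\<lambda>x. f x - f' n x) + L2_norm M (\<lambda>x. g x - g' n x)" for n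
      using L2_norm_triangle[OF L2_diff[OF fg(2) T(2)] L2_diff[OF fg(4) T(4)], of n n]
      by (simp add: algebra_simps)
    then show "(\<lambda>n. L2_norm M (\<lambda>x. f x + g x - (f' n x + g' n x))) \<longlonglongrightarrow> 0"
      by (intro tendsto_sandwich[OF _ _ tendsto_const tendsto_add_zero[OF f'(3) g'(3)]]) auto
  qed (use fg in \<open>auto intro: L2_add\<close>)
qed

lemma approximable_cmult:
  assumes f: "approximable f"
  shows "approximable (\<lambda>x. c * f x)"
proof -
  obtain f' where f': "\<And>n. f' n \<in> Test" "(\<lambda>n. \<integral>x. cmod (f x - f' n x) \<partial>M) \<longlonglongrightarrow> 0"
    "(\<lambda>n. L2_norm M (\<lambda>x. f x - f' n x)) \<longlonglongrightarrow> 0" using approximable_sequence[OF f] by blast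
  show ?thesis
  proof (rule approximable_limit)
    show "approximable (\<lambda>x. c * f' n x)" for n by (intro approximable_Test Test_cmult f')
    show "(\<lambda>n. \<integral>x. cmod (c * f x - c * f' n x) \<partial>M) \<longlonglongrightarrow> 0"
      using tendsto_mult_right_zero[OF f'(2), of "cmod c"] by (simp add: norm_mult flip: right_diff_distrib)
    show "(\<lambda>n. L2_norm M (\<lambda>x. c * f x - c * f' n x)) \<longlonglongrightarrow> 0"
      using tendsto_mult_right_zero[OF f'(3), of "cmod c"] by (simp add: L2_norm_cmult flip: right_diff_distrib)
  qed (use f in \<open>auto simp: approximable_def intro: L2_cmult\<close>)
qed

lemma approximable_diff: "approximable f \<Longrightarrow> approximable g \<Longrightarrow> approximable (\<lambda>x. f x - g x)"
  using approximable_add[OF _ approximable_cmult, of f g "-1"] by simp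

lemma approximable_zero: "approximable (\<lambda>x. 0)"
  by (rule approximable_Test[OF Test_zero])

lemma approximable_sum: "(\<And>i. i \<in> I \<Longrightarrow> approximable (f i)) \<Longrightarrow> approximable (\<lambda>x. \<Sum>i\<in>I. f i x)"
  by (induction I rule: infinite_finite_induct) (auto intro: approximable_zero approximable_add)

lemma approximable_dominated:
  fixes g :: "'a \<Rightarrow> real"
  assumes X: "\<And>n. approximable (X n)" and f: "f \<in> borel_measurable M"
    and g: "integrable M g" "integrable M (\<lambda>x. (g x)\<^sup>2)"
    and lim: "\<And>x. (\<lambda>n. X n x) \<longlonglongrightarrow> f x" and bound: "\<And>n x. cmod (X n x) \<le> g x"
  shows "approximable f"
proof -
  have Xm: "integrable M (X n)" "X n \<in> L2 M" for n using X[of n] by (auto simp: approximable_def)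
  have fg: "cmod (f x) \<le> g x" for x
    by (rule LIMSEQ_le_const2[OF tendsto_norm[OF lim]]) (use bound in auto)
  have fi: "integrable M f"
    by (rule Bochner_Integration.integrable_bound[OF g(1) f]) (auto intro: order_trans[OF fg abs_ge_self])
  have L: "L2_tendsto M X f sequentially"
    by (rule L2_tendsto_dominated[OF f _ g(2)]) (use Xm lim bound in \<open>auto dest: L2_measurable\<close>)
  show ?thesis
  proof (rule approximable_limit[OF X fi])
    have "(\<lambda>n. \<integral>x. cmod (f x - X n x) \<partial>M) \<longlonglongrightarrow> (\<integral>x. 0 \<partial>M)"
    proof (rule integral_dominated_convergence)
      show "integrable M (\<lambda>x. 2 * g x)" using g by simp
      show "AE x in M. (\<lambda>n. cmod (f x - X n x)) \<longlonglongrightarrow> 0"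
      proof (intro always_eventually allI)
        fix x
        have "(\<lambda>n. f x - X n x) \<longlonglongrightarrow> f x - f x" by (intro tendsto_intros lim)
        then show "(\<lambda>n. cmod (f x - X n x)) \<longlonglongrightarrow> 0" using tendsto_norm by fastforce
      qed
      show "AE x in M. norm (cmod (f x - X n x)) \<le> 2 * g x" for n
      proof (intro always_eventually allI)
        fix x
        show "norm (cmod (f x - X n x)) \<le> 2 * g x"
          using norm_triangle_ineq4[of "f x" "X n x"] fg[of x] bound[of n x] by simp
      qed
    qed (use f Xm in \<open>auto dest: L2_measurable\<close>)
    then show "(\<lambda>n. \<integral>x. cmod (f x - X n x) \<partial>M) \<longlonglongrightarrow> 0" by simp
    show "(\<lambda>n. L2_norm M (\<lambda>x. f x - X n x)) \<longlonglongrightarrow> 0"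
      using L2_tendstoD(3)[OF L] by (subst L2_norm_minus_commute)
  qed (rule L2_tendstoD(1)[OF L])
qed

text \<open>The rational points make the balls a countable base of the topology.\<close>

lemma borel_subset_sigma_cosets: "sets borel \<subseteq> sigma_sets (UNIV :: 'a set) (insert {} {coset a n | a n. True})"
  (is "_ \<subseteq> sigma_sets UNIV ?C")
  unfolding sets_borel
proof (rule sigma_sets_mono)
  show "{S :: 'a set. open S} \<subseteq> sigma_sets UNIV ?C"
  proof
    fix S :: "'a set" assume "S \<in> {S. open S}"
    then have S: "open S" by simp
    define I where "I = {(r, n). coset (\<iota> r) n \<subseteq> S}"
    have "S = (\<Union>(r, n)\<in>I. coset (\<iota> r) n)"
    proof (intro set_eqI iffI)
      fix x assume "x \<in> S"
      then obtain d where d: "d > 0" "ball x d \<subseteq> S" using S openE by blast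
      obtain N where N: "1 / q (int N) < d" using q_small d by blast
      obtain r where r: "x - \<iota> r \<in> G (int N)" by (rule approximation_mod_G)
      have "coset (\<iota> r) (int N) \<subseteq> S"
      proof
        fix y assume "y \<in> coset (\<iota> r) (int N)"
        then have "y - x \<in> G (int N)" using G_trans[of y "\<iota> r" "int N" x] r G_minus_commute by blast
        then have "dist x y < d" using N by (simp add: G_iff dist_commute[of x] dist_eq_nrm[of _ x])
        then show "y \<in> S" using d by auto
      qed
      then show "x \<in> (\<Union>(r, n)\<in>I. coset (\<iota> r) n)" using r by (auto simp: I_def)
    qed (auto simp: I_def)
    also have "\<dots> \<in> sigma_sets UNIV ?C"
    proof (rule sigma_sets_UNION)
      show "countable ((\<lambda>(r, n). coset (\<iota> r) n) ` I)" by simp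
      show "b \<in> sigma_sets UNIV ?C" if "b \<in> (\<lambda>(r, n). coset (\<iota> r) n) ` I" for b
        using that by (auto intro!: sigma_sets.Basic)
    qed
    finally show "S \<in> sigma_sets UNIV ?C" .
  qed
qed

lemma coset_Int:
  assumes "m \<le> n"
  shows "coset a m \<inter> coset b n = (if a - b \<in> G m then coset b n else {})"
proof -
  have "x - a \<in> G m \<longleftrightarrow> a - b \<in> G m" if "x - b \<in> G n" for x
    using G_antimonoD[OF that assms] G_trans[of x a m b] G_trans[of x b m a]
      G_trans[of a x m b] G_minus_commute by blast
  then show ?thesis by auto
qed

text \<open>Dynkin's argument: the balls and the empty set are closed under intersection and generate the Borel sets.
  Intersecting with \<open>G N\<close>, which has finite measure, provides a dominating function for countable unions.\<close>

lemma approximable_indicator: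
  assumes "B \<in> sets borel"
  shows "approximable (indicator (B \<inter> G N))"
proof -
  let ?C = "insert {} {coset a n | a n. True}"
  have "B \<in> sigma_sets UNIV ?C" using assms borel_subset_sigma_cosets by blast
  have "Int_stable ?C"
  proof (rule Int_stableI)
    fix A B assume AB: "A \<in> ?C" "B \<in> ?C"
    show "A \<inter> B \<in> ?C"
    proof (cases "A = {} \<or> B = {}")
      case False
      then obtain a m b n where *: "A = coset a m" "B = coset b n" using AB by auto
      show ?thesis
      proof (cases "m \<le> n")
        case True
        then show ?thesis unfolding * using coset_Int[OF True, of a b] by auto
      next
        case False
        then show ?thesis unfolding * using coset_Int[of n m b a] by (auto simp: Int_commute)
      qed
    qed auto
  qed
  moreover have "?C \<subseteq> Pow UNIV" by simp
  ultimately show ?thesis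
    using \<open>B \<in> sigma_sets UNIV ?C\<close>
  proof (induction rule: sigma_sets_induct_disjoint)
    case (basic A)
    have "A \<inter> G N = {} \<or> (\<exists>a n. A \<inter> G N = coset a n)"
    proof (cases "A = {}")
      case False
      then obtain a n where A: "A = coset a n" using basic by auto
      have "coset a n \<inter> coset 0 N = {} \<or> coset a n \<inter> coset 0 N = coset 0 N \<or> coset a n \<inter> coset 0 N = coset a n"
      proof (cases "n \<le> N")
        case True
        from coset_Int[OF this, of a 0] show ?thesis by presburger
      next
        case False
        then have "N \<le> n" by simp
        from coset_Int[OF this, of 0 a] show ?thesis unfolding Int_commute[of "coset a n"] by presburger
      qed
      moreover have "A \<inter> G N = coset a n \<inter> coset 0 N" by (simp add: A)
      ultimately show ?thesis by metis
    qed auto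
    then show ?case
    proof
      assume "A \<inter> G N = {}"
      then show ?thesis using approximable_zero by simp
    next
      assume "\<exists>a n. A \<inter> G N = coset a n"
      then obtain a n where "A \<inter> G N = coset a n" by blast
      then show ?thesis using approximable_Test[OF Test_ind, of a n] by (simp add: ind_eq_indicator)
    qed
  next
    case empty
    then show ?case using approximable_zero by simp
  next
    case (compl A)
    have "approximable (\<lambda>x. indicator (G N) x - indicator (A \<inter> G N) x)"
      using approximable_Test[OF Test_ind, of 0 N] compl by (intro approximable_diff) (auto simp: ind_eq_indicator)
    also have "(\<lambda>x. indicator (G N) x - indicator (A \<inter> G N) x) = (indicator ((UNIV - A) \<inter> G N) :: 'a \<Rightarrow> complex)"
      by (auto simp: indicator_def)
    finally show ?case .
  next
    case (union A)
    have disj: "disjoint_family A" using union by simp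
    have Am: "A i \<in> sets borel" for i
    proof -
      have "sigma_sets UNIV ?C \<subseteq> sets borel"
        by (rule sets.sigma_sets_subset'[of _ borel UNIV, simplified]) auto
      then show ?thesis using union.hyps by blast
    qed
    show ?case
    proof (rule approximable_dominated[where X = "\<lambda>n x. \<Sum>i<n. indicator (A i \<inter> G N) x" and g = "indicator (G N)"])
      show "approximable (\<lambda>x. \<Sum>i<n. indicator (A i \<inter> G N) x)" for n
        by (intro approximable_sum union)
      show "indicator ((\<Union>i. A i) \<inter> G N) \<in> borel_measurable M"
        using Am coset_sets[of 0 N] by (intro borel_measurable_indicator) auto
      show gi: "integrable M (indicator (G N) :: 'a \<Rightarrow> real)"
        using coset_sets[of 0 N] by (intro integrable_real_indicator) (auto simp: emeasure_G)
      have "(\<lambda>x. (indicator (G N) x)\<^sup>2) = (indicator (G N) :: 'a \<Rightarrow> real)" by (auto simp: indicator_def)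
      then show "integrable M (\<lambda>x. (indicator (G N) x :: real)\<^sup>2)" using gi by simp
      have *: "(\<Sum>i<n. indicator (A i \<inter> G N) x) = (indicator ((\<Union>i<n. A i) \<inter> G N) x :: complex)" for n x
      proof -
        have "disjoint_family_on (\<lambda>i. A i \<inter> G N) {..<n}"
          using disj unfolding disjoint_family_on_def by blast
        moreover have "(\<Union>i<n. A i) \<inter> G N = (\<Union>i<n. A i \<inter> G N)" by blast
        ultimately show ?thesis by (simp only: indicator_UN_disjoint finite_lessThan)
      qed
      show "cmod (\<Sum>i<n. indicator (A i \<inter> G N) x) \<le> indicator (G N) x" for n x
        unfolding * by (auto simp: indicator_def)
      fix x
      show "(\<lambda>n. \<Sum>i<n. indicator (A i \<inter> G N) x) \<longlonglongrightarrow> (indicator ((\<Union>i. A i) \<inter> G N) x :: complex)"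
        unfolding *
      proof (rule tendsto_eventually, cases "x \<in> (\<Union>i. A i)")
        case True
        then obtain i where "x \<in> A i" by blast
        then show "\<forall>\<^sub>F n in sequentially. indicator ((\<Union>i<n. A i) \<inter> G N) x = (indicator ((\<Union>i. A i) \<inter> G N) x :: complex)"
          unfolding eventually_sequentially by (intro exI[of _ "Suc i"]) (auto simp: indicator_def)
      qed (auto simp: indicator_def)
    qed
  qed
qed

lemma indicator_exhaust_tendsto: "(\<lambda>k. indicator (G (- int k)) x * z k) \<longlonglongrightarrow> (z' :: complex)" if "z \<longlonglongrightarrow> z'"
proof -
  obtain n where n: "x \<in> G (- int n)" using G_exhaust by blast
  have "\<forall>\<^sub>F k in sequentially. z k = indicator (G (- int k)) x * z k"
    unfolding eventually_sequentially
    using G_antimonoD[OF n] by (intro exI[of _ n]) (auto simp: indicator_def)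
  then show ?thesis using that by (rule Lim_transform_eventually[rotated])
qed

text \<open>Simple functions bounded by twice the modulus of \<open>f\<close>, cut off to the exhausting groups
  \<open>G (- k)\<close>, converge under domination in both senses.\<close>

lemma integrable_L2_approximable:
  assumes f: "integrable M f" "f \<in> L2 M"
  shows "approximable f"
proof -
  have fm: "f \<in> borel_measurable M" using f by simp
  from borel_measurable_implies_sequence_metric[OF fm, of 0]
  obtain s where s: "\<And>i. simple_function M (s i)" "\<And>x. (\<lambda>i. s i x) \<longlonglongrightarrow> f x" "\<And>i x. cmod (s i x) \<le> 2 * cmod (f x)"
    by auto
  show ?thesis
  proof (rule approximable_dominated[where X = "\<lambda>k x. indicator (G (- int k)) x * s k x" and g = "\<lambda>x. 2 * cmod (f x)"])
    show "approximable (\<lambda>x. indicator (G (- int k)) x * s k x)" for k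
    proof -
      have fin: "finite (range (s k))" using s(1)[of k] by (simp add: simple_function_def)
      have vim: "s k -` {y} \<in> sets borel" for y
        using simple_functionD(2)[OF s(1)[of k], of "{y}"] by simp
      have "approximable (\<lambda>x. \<Sum>y\<in>range (s k). y * indicator (s k -` {y} \<inter> G (- int k)) x)"
        by (intro approximable_sum approximable_cmult approximable_indicator vim)
      also have "(\<lambda>x. \<Sum>y\<in>range (s k). y * indicator (s k -` {y} \<inter> G (- int k)) x)
          = (\<lambda>x. indicator (G (- int k)) x * s k x)"
      proof
        fix x
        have "(\<Sum>y\<in>range (s k). y * indicator (s k -` {y} \<inter> G (- int k)) x)
            = (\<Sum>y\<in>range (s k). if y = s k x then indicator (G (- int k)) x * s k x else 0)"
          by (intro sum.cong) (auto simp: indicator_def)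
        then show "(\<Sum>y\<in>range (s k). y * indicator (s k -` {y} \<inter> G (- int k)) x) = indicator (G (- int k)) x * s k x"
          using fin by (simp add: sum.delta)
      qed
      finally show ?thesis .
    qed
    show "integrable M (\<lambda>x. 2 * cmod (f x))" using f by simp
    show "integrable M (\<lambda>x. (2 * cmod (f x))\<^sup>2)" using L2_integrable[OF f(2)] by (simp add: power_mult_distrib)
    show "(\<lambda>k. indicator (G (- int k)) x * s k x) \<longlonglongrightarrow> f x" for x
      by (rule indicator_exhaust_tendsto[OF s(2)])
    show "cmod (indicator (G (- int k)) x * s k x) \<le> 2 * cmod (f x)" for k x
      using s(3)[of k x] by (auto simp: indicator_def)
  qed (rule fm)
qed

lemma Test_dense_L2:
  assumes f: "f \<in> L2 M"
  obtains g where "\<And>n. g n \<in> Test" "L2_tendsto M g f sequentially"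
proof -
  define h where "h k x = indicator (G (- int k)) x * f x" for k x
  have fm [measurable]: "f \<in> borel_measurable M" using f by (rule L2_measurable)
  have G_sets: "G n \<in> sets M" for n using coset_sets[of 0 n] by simp
  have hm: "h k \<in> borel_measurable M" for k
    unfolding h_def using G_sets by measurable
  have hb: "cmod (h k x) \<le> cmod (f x)" for k x by (auto simp: h_def indicator_def)
  have h2: "h k \<in> L2 M" for k
    by (rule L2_dominated[OF hm f]) (use hb in auto)
  have hi: "integrable M (h k)" for k
  proof -
    have "ind 0 (- int k) x * f x = h k x" for x by (simp add: h_def ind_def indicator_def)
    then show ?thesis using L2_mult_integrable[OF ind_L2 f, of 0 "- int k"] by simp
  qed
  have hf: "L2_tendsto M h f sequentially"
  proof (rule L2_tendsto_dominated[OF fm hm L2_integrable[OF f]])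
    show "AE x in M. (\<lambda>n. h n x) \<longlonglongrightarrow> f x"
      unfolding h_def by (intro always_eventually allI indicator_exhaust_tendsto tendsto_const)
  qed (use hb in auto)
  have "\<exists>g. g \<in> Test \<and> L2_norm M (\<lambda>x. h n x - g x) < inverse (real (Suc n))" for n
    using integrable_L2_approximable[OF hi h2, of n] unfolding approximable_def
    by (metis inverse_positive_iff_positive of_nat_0_less_iff zero_less_Suc)
  then obtain g where g: "\<And>n. g n \<in> Test" "\<And>n. L2_norm M (\<lambda>x. h n x - g n x) < inverse (real (Suc n))"
    by metis
  have "L2_tendsto M g f sequentially"
  proof (rule L2_tendsto_le[OF f])
    show "\<forall>\<^sub>F n in sequentially. g n \<in> L2 M" using g Test_L2 by simp
    show "\<forall>\<^sub>F n in sequentially. L2_norm M (\<lambda>x. g n x - f x) \<le> inverse (real (Suc n)) + L2_norm M (\<lambda>x. h n x - f x)"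
    proof (intro always_eventually allI)
      fix n
      show "L2_norm M (\<lambda>x. g n x - f x) \<le> inverse (real (Suc n)) + L2_norm M (\<lambda>x. h n x - f x)"
        using L2_norm_triangle_mid[OF Test_L2[OF g(1)] h2 f, of n n] less_imp_le[OF g(2)[of n]]
        by (subst (asm) (2) L2_norm_minus_commute) linarith
    qed
    show "(\<lambda>n. inverse (real (Suc n)) + L2_norm M (\<lambda>x. h n x - f x)) \<longlonglongrightarrow> 0"
      by (intro tendsto_add_zero LIMSEQ_inverse_real_of_nat L2_tendstoD(3)[OF hf])
  qed
  then show ?thesis using that g(1) by blast
qed

subsection \<open>The unitary Fourier transform\<close>

lemma FT_Test_Cauchy:
  assumes g: "\<And>n. g n \<in> Test" "L2_tendsto M g f sequentially"
  shows "L2_Cauchy M (\<lambda>n. FT (g n))"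
proof -
  have C: "L2_Cauchy M g" by (rule L2_tendsto_imp_Cauchy[OF g(2) Test_L2[OF g(1)]])
  have "L2_norm M (\<lambda>x. FT (g m) x - FT (g n) x) = L2_norm M (\<lambda>x. g m x - g n x)" for m n
  proof -
    have "FT (\<lambda>x. g m x - g n x) = (\<lambda>x. FT (g m) x - FT (g n) x)"
      using Test_integrable[OF g(1)] by (simp add: fun_eq_iff FT_diff)
    then show ?thesis using FT_norm_Test[OF Test_diff[OF g(1)[of m] g(1)[of n]]] by simp
  qed
  then show ?thesis using C FT_Test_L2[OF g(1)] by (simp add: L2_Cauchy_def)
qed

text \<open>Test functions that converge in mean have pointwise convergent transforms; if they also converge in mean
  square, then these transforms form a Cauchy sequence in \<open>L2\<close>, so its limit there is the pointwise one.\<close>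

lemma Plancherel:
  assumes f: "integrable M f" "f \<in> L2 M"
  shows "FT f \<in> L2 M" "L2_norm M (FT f) = L2_norm M f"
proof -
  obtain g where g: "\<And>n. g n \<in> Test" "(\<lambda>n. \<integral>x. cmod (f x - g n x) \<partial>M) \<longlonglongrightarrow> 0"
    "(\<lambda>n. L2_norm M (\<lambda>x. f x - g n x)) \<longlonglongrightarrow> 0"
    using approximable_sequence[OF integrable_L2_approximable[OF f]] by blast
  have gf: "L2_tendsto M g f sequentially"
    unfolding L2_tendsto_def using f g(3) Test_L2[OF g(1)]
    by (auto simp: L2_norm_minus_commute[of M _ f])
  have lim: "(\<lambda>n. FT (g n) \<xi>) \<longlonglongrightarrow> FT f \<xi>" for \<xi>
  proof -
    have "\<forall>\<^sub>F n in sequentially. cmod (FT f \<xi> - FT (g n) \<xi>) \<le> (\<integral>x. cmod (f x - g n x) \<partial>M)"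
      using norm_FT_le[of "\<lambda>x. f x - g _ x" \<xi>] f Test_integrable[OF g(1)] by (simp add: FT_diff)
    from Lim_null_comparison[OF this g(2)] have "(\<lambda>n. FT f \<xi> - FT (g n) \<xi>) \<longlonglongrightarrow> 0" .
    from tendsto_diff[OF tendsto_const this, of "FT f \<xi>"] show ?thesis by simp
  qed
  have "FT f \<in> borel_measurable M"
    by (rule borel_measurable_LIMSEQ_metric[OF L2_measurable[OF FT_Test_L2[OF g(1)]] lim])
  then have L: "L2_tendsto M (\<lambda>n. FT (g n)) (FT f) sequentially"
    using lim by (intro L2_Cauchy_pointwise[OF FT_Test_Cauchy[OF g(1) gf]]) auto
  then show "FT f \<in> L2 M" by (rule L2_tendstoD)
  have "(\<lambda>n. L2_norm M (FT (g n))) \<longlonglongrightarrow> L2_norm M f"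
    using L2_tendsto_norm[OF gf] FT_norm_Test[OF g(1)] by simp
  then show "L2_norm M (FT f) = L2_norm M f"
    using LIMSEQ_unique[OF L2_tendsto_norm[OF L]] by simp
qed

abbreviation F2 :: "('a \<Rightarrow> complex) \<Rightarrow> 'a \<Rightarrow> complex" where "F2 \<equiv> fourier_L2 E \<iota> M"

lemma fourier_L2_exists:
  assumes "f \<in> L2 M"
  shows "\<exists>g. \<exists>\<phi>::nat \<Rightarrow> 'a \<Rightarrow> complex. (\<forall>n. integrable M (\<phi> n) \<and> \<phi> n \<in> L2 M) \<and> L2_tendsto M \<phi> f sequentially \<and>
        L2_tendsto M (\<lambda>n. FT (\<phi> n)) g sequentially"
proof -
  obtain \<phi> where \<phi>: "\<And>n. \<phi> n \<in> Test" "L2_tendsto M \<phi> f sequentially"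
    using Test_dense_L2[OF assms] by blast
  obtain g r where "L2_tendsto M (\<lambda>n. FT (\<phi> n)) g sequentially"
    by (rule L2_complete[OF FT_Test_Cauchy[OF \<phi>]])
  then show ?thesis using \<phi> Test_integrable Test_L2 by blast
qed

text \<open>Any approximating sequence computes the extended transform, by Plancherel.\<close>

lemma FT_tendsto_F2:
  assumes f: "f \<in> L2 M" and \<psi>: "\<And>n. integrable M (\<psi> n)" "\<And>n. \<psi> n \<in> L2 M" "L2_tendsto M \<psi> f sequentially"
  shows "L2_tendsto M (\<lambda>n. FT (\<psi> n)) (F2 f) sequentially"
proof -
  obtain \<phi> :: "nat \<Rightarrow> 'a \<Rightarrow> complex" where \<phi>: "\<And>n. integrable M (\<phi> n)" "\<And>n. \<phi> n \<in> L2 M"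
    "L2_tendsto M \<phi> f sequentially" "L2_tendsto M (\<lambda>n. FT (\<phi> n)) (F2 f) sequentially"
    using someI_ex[OF fourier_L2_exists[OF f]] unfolding fourier_L2_def by blast
  have eq: "L2_norm M (\<lambda>x. FT (\<psi> n) x - FT (\<phi> n) x) = L2_norm M (\<lambda>x. \<psi> n x - \<phi> n x)" for n
  proof -
    have "(\<lambda>x. FT (\<psi> n) x - FT (\<phi> n) x) = FT (\<lambda>x. \<psi> n x - \<phi> n x)"
      using \<phi> \<psi> by (simp add: fun_eq_iff FT_diff)
    then show ?thesis using \<phi> \<psi> by (simp add: Plancherel L2_diff)
  qed
  have "L2_tendsto M (\<lambda>n x. \<psi> n x - \<phi> n x) (\<lambda>x. f x - f x) sequentially"
    by (intro L2_tendsto_diff \<phi> \<psi>)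
  then have "L2_tendsto M (\<lambda>n x. FT (\<psi> n) x - FT (\<phi> n) x) (\<lambda>x. 0) sequentially"
    using L2_diff[OF Plancherel(1)[OF \<psi>(1,2)] Plancherel(1)[OF \<phi>(1,2)]]
    by (simp add: L2_tendsto_def eq)
  from L2_tendsto_add[OF this \<phi>(4)] show ?thesis by simp
qed

lemma F2_L2:
  assumes "f \<in> L2 M"
  shows "F2 f \<in> L2 M"
proof -
  obtain \<phi> where "\<And>n. \<phi> n \<in> Test" "L2_tendsto M \<phi> f sequentially"
    using Test_dense_L2[OF assms] by blast
  then show ?thesis
    using L2_tendstoD(1)[OF FT_tendsto_F2[OF assms]] Test_integrable Test_L2 by blast
qed

lemma F2_eq_FT:
  assumes "integrable M f" "f \<in> L2 M"
  shows "L2_eq M (F2 f) (FT f)"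
proof -
  have "L2_tendsto M (\<lambda>n::nat. FT f) (F2 f) sequentially"
    using assms by (intro FT_tendsto_F2 L2_tendsto_const) auto
  moreover have "L2_tendsto M (\<lambda>n::nat. FT f) (FT f) sequentially"
    using assms by (intro L2_tendsto_const Plancherel)
  ultimately show ?thesis by (rule L2_tendsto_unique) simp
qed

lemma F2_norm:
  assumes "f \<in> L2 M"
  shows "L2_norm M (F2 f) = L2_norm M f"
proof -
  obtain \<phi> where \<phi>: "\<And>n. \<phi> n \<in> Test" "L2_tendsto M \<phi> f sequentially"
    using Test_dense_L2[OF assms] by blast
  have "(\<lambda>n. L2_norm M (FT (\<phi> n))) \<longlonglongrightarrow> L2_norm M (F2 f)"
    using \<phi> Test_integrable Test_L2 by (intro L2_tendsto_norm FT_tendsto_F2 assms) auto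
  moreover have "(\<lambda>n. L2_norm M (FT (\<phi> n))) \<longlonglongrightarrow> L2_norm M f"
    using L2_tendsto_norm[OF \<phi>(2)] FT_norm_Test[OF \<phi>(1)] by simp
  ultimately show ?thesis by (rule LIMSEQ_unique)
qed

lemma F2_add:
  assumes f: "f \<in> L2 M" and g: "g \<in> L2 M"
  shows "L2_eq M (F2 (\<lambda>x. f x + g x)) (\<lambda>x. F2 f x + F2 g x)"
proof -
  obtain \<phi> where \<phi>: "\<And>n. \<phi> n \<in> Test" "L2_tendsto M \<phi> f sequentially"
    using Test_dense_L2[OF f] by blast
  obtain \<psi> where \<psi>: "\<And>n. \<psi> n \<in> Test" "L2_tendsto M \<psi> g sequentially"
    using Test_dense_L2[OF g] by blast
  note T = Test_integrable[OF \<phi>(1)] Test_L2[OF \<phi>(1)] Test_integrable[OF \<psi>(1)] Test_L2[OF \<psi>(1)]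
  have eq: "(\<lambda>n. FT (\<lambda>x. \<phi> n x + \<psi> n x)) = (\<lambda>n x. FT (\<phi> n) x + FT (\<psi> n) x)"
    using T by (simp add: fun_eq_iff FT_add)
  have "L2_tendsto M (\<lambda>n x. FT (\<phi> n) x + FT (\<psi> n) x) (F2 (\<lambda>x. f x + g x)) sequentially"
    unfolding eq[symmetric] using T by (intro FT_tendsto_F2 L2_tendsto_add \<phi> \<psi> L2_add f g) auto
  moreover have "L2_tendsto M (\<lambda>n x. FT (\<phi> n) x + FT (\<psi> n) x) (\<lambda>x. F2 f x + F2 g x) sequentially"
    using T by (intro L2_tendsto_add FT_tendsto_F2 \<phi> \<psi> f g)
  ultimately show ?thesis by (rule L2_tendsto_unique) simp
qed

lemma F2_cmult:
  assumes f: "f \<in> L2 M"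
  shows "L2_eq M (F2 (\<lambda>x. c * f x)) (\<lambda>x. c * F2 f x)"
proof -
  obtain \<phi> where \<phi>: "\<And>n. \<phi> n \<in> Test" "L2_tendsto M \<phi> f sequentially"
    using Test_dense_L2[OF f] by blast
  note T = Test_integrable[OF \<phi>(1)] Test_L2[OF \<phi>(1)]
  have eq: "(\<lambda>n. FT (\<lambda>x. c * \<phi> n x)) = (\<lambda>n x. c * FT (\<phi> n) x)"
    by (simp add: fun_eq_iff FT_cmult)
  have "L2_tendsto M (\<lambda>n x. c * FT (\<phi> n) x) (F2 (\<lambda>x. c * f x)) sequentially"
    unfolding eq[symmetric] using T by (intro FT_tendsto_F2 L2_tendsto_cmult \<phi> L2_cmult f) auto
  moreover have "L2_tendsto M (\<lambda>n x. c * FT (\<phi> n) x) (\<lambda>x. c * F2 f x) sequentially"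
    using T by (intro L2_tendsto_cmult FT_tendsto_F2 \<phi> f)
  ultimately show ?thesis by (rule L2_tendsto_unique) simp
qed

text \<open>The range contains the ball indicators and is closed, because the transform is isometric.\<close>

lemma F2_surj:
  assumes g: "g \<in> L2 M"
  shows "\<exists>f\<in>L2 M. L2_eq M (F2 f) g"
proof -
  have T: "\<exists>f\<in>L2 M. L2_eq M (F2 f) h" if "h \<in> Test" for h
    using that
  proof (induction rule: Test.induct)
    case (Test_ind a n)
    have "FT (FT (ind (- a) n)) = ind a n" by (simp add: fun_eq_iff FT_FT_ind)
    then show ?case using F2_eq_FT[OF FT_ind_integrable FT_ind_L2, of "- a" n] FT_ind_L2 by metis
  next
    case (Test_add f g)
    then obtain f' g' where *: "f' \<in> L2 M" "L2_eq M (F2 f') f" "g' \<in> L2 M" "L2_eq M (F2 g') g" by blast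
    have "L2_eq M (F2 (\<lambda>x. f' x + g' x)) (\<lambda>x. f x + g x)"
      using F2_add[OF *(1,3)] *(2,4) unfolding L2_eq_def by eventually_elim simp
    then show ?case using L2_add[OF *(1,3)] by blast
  next
    case (Test_cmult f c)
    then obtain f' where *: "f' \<in> L2 M" "L2_eq M (F2 f') f" by blast
    have "L2_eq M (F2 (\<lambda>x. c * f' x)) (\<lambda>x. c * f x)"
      using F2_cmult[OF *(1), of c] *(2) unfolding L2_eq_def by eventually_elim simp
    then show ?case using L2_cmult[OF *(1)] by blast
  qed
  obtain \<psi> where \<psi>: "\<And>n. \<psi> n \<in> Test" "L2_tendsto M \<psi> g sequentially"
    using Test_dense_L2[OF g] by blast
  obtain h where h: "\<And>n. h n \<in> L2 M" "\<And>n. L2_eq M (F2 (h n)) (\<psi> n)"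
    using T[OF \<psi>(1)] by metis
  have diff: "L2_eq M (F2 (\<lambda>x. u x - v x)) (\<lambda>x. F2 u x - F2 v x)" if "u \<in> L2 M" "v \<in> L2 M" for u v
    using F2_add[OF that(1) L2_cmult[OF that(2)], of "-1"] F2_cmult[OF that(2), of "-1"]
    unfolding L2_eq_def by auto
  have iso: "L2_norm M (\<lambda>x. u x - v x) = L2_norm M (\<lambda>x. F2 u x - F2 v x)" if "u \<in> L2 M" "v \<in> L2 M" for u v
    using F2_norm[OF L2_diff[OF that]]
      L2_norm_eq[OF F2_L2[OF L2_diff[OF that]] L2_diff[OF F2_L2 F2_L2, OF that] diff[OF that]] by simp
  have "L2_norm M (\<lambda>x. h m x - h n x) = L2_norm M (\<lambda>x. \<psi> m x - \<psi> n x)" for m n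
    unfolding iso[OF h(1) h(1)] using h(2)[of m] h(2)[of n]
    by (intro L2_norm_eq L2_diff F2_L2 h Test_L2 \<psi>) (auto simp: L2_eq_def)
  then have "L2_Cauchy M h"
    using L2_tendsto_imp_Cauchy[OF \<psi>(2) Test_L2[OF \<psi>(1)]] h(1) by (simp add: L2_Cauchy_def)
  then obtain f r where f: "L2_tendsto M h f sequentially" by (rule L2_complete)
  note f2 = L2_tendstoD(1)[OF f]
  have "L2_tendsto M (\<lambda>n. F2 (h n)) (F2 f) sequentially"
    using f F2_L2 h(1) iso[OF h(1) f2] by (simp add: L2_tendsto_def)
  moreover have "L2_tendsto M (\<lambda>n. F2 (h n)) g sequentially"
  proof (rule L2_tendsto_cong[OF \<psi>(2)])
    show "\<forall>\<^sub>F n in sequentially. F2 (h n) \<in> L2 M \<and> L2_eq M (\<psi> n) (F2 (h n))"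
      by (intro always_eventually allI conjI F2_L2 L2_eq_sym[OF h(2)] h(1))
  qed (use g in auto)
  ultimately have "L2_eq M (F2 f) g" by (rule L2_tendsto_unique) simp
  then show ?thesis using f2 by blast
qed

end

section \<open>The heat kernel\<close>

lemma integrable_Fatou:
  fixes X :: "nat \<Rightarrow> 'b \<Rightarrow> complex"
  assumes f: "f \<in> borel_measurable N" and X: "\<And>n. integrable N (X n)"
    and lim: "\<And>x. (\<lambda>n. X n x) \<longlonglongrightarrow> f x" and bound: "\<And>n. (\<integral>x. cmod (X n x) \<partial>N) \<le> B"
  shows "integrable N f"
proof (rule integrableI_bounded[OF f])
  have "(\<integral>\<^sup>+x. ennreal (cmod (f x)) \<partial>N) = (\<integral>\<^sup>+x. liminf (\<lambda>n. ennreal (cmod (X n x))) \<partial>N)"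
  proof (rule nn_integral_cong)
    fix x
    have "(\<lambda>n. ennreal (cmod (X n x))) \<longlonglongrightarrow> ennreal (cmod (f x))"
      by (intro tendsto_ennrealI tendsto_norm lim)
    then show "ennreal (cmod (f x)) = liminf (\<lambda>n. ennreal (cmod (X n x)))"
      using lim_imp_Liminf[OF sequentially_bot] by metis
  qed
  also have "\<dots> \<le> liminf (\<lambda>n. \<integral>\<^sup>+x. ennreal (cmod (X n x)) \<partial>N)"
    using X by (intro nn_integral_liminf) auto
  also have "\<dots> \<le> liminf (\<lambda>n. ennreal B)"
  proof (intro Liminf_mono always_eventually allI)
    fix n
    have "(\<integral>\<^sup>+x. ennreal (cmod (X n x)) \<partial>N) = ennreal (\<integral>x. cmod (X n x) \<partial>N)"
      using X by (intro nn_integral_eq_integral) auto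
    then show "(\<integral>\<^sup>+x. ennreal (cmod (X n x)) \<partial>N) \<le> ennreal B"
      using bound by (simp add: ennreal_leI)
  qed
  also have "\<dots> = ennreal B"
    by (rule Liminf_const) simp
  finally show "(\<integral>\<^sup>+x. ennreal (cmod (f x)) \<partial>N) < \<infinity>"
    using le_less_trans[OF _ ennreal_less_top] by (simp add: infinity_ennreal_def)
qed

locale adele_heat = adele_haar E \<iota> M
  for E and \<iota> :: "rat \<Rightarrow> 'a::{comm_ring_1, topological_ab_group_add,
      topological_semigroup_mult, complete_space}" and M +
  fixes \<alpha> t :: real
  assumes \<alpha>: "\<alpha> > 0" and t: "t > 0"
begin

text \<open>The value of $e^{-t\|\xi\|^\alpha}$ on the sphere \<open>nrm \<xi> = q n\<close>.\<close>

definition w :: "int \<Rightarrow> real" where "w n = exp (- t * q n powr \<alpha>)"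

text \<open>The height of the layer whose base is the ball \<open>G (- n)\<close>.\<close>

definition c :: "int \<Rightarrow> real" where "c n = w n - w (n + 1)"

definition K :: "'a \<Rightarrow> real" where "K \<xi> = exp (- t * nrm \<xi> powr \<alpha>)"

abbreviation window :: "nat \<Rightarrow> int set" where "window N \<equiv> {- int N..int N}"

lemma w_antimono: "m \<le> n \<Longrightarrow> w n \<le> w m"
  unfolding w_def using t \<alpha> by (auto intro!: mult_left_mono powr_mono2)

lemma w_pos: "w n > 0" and w_le_1: "w n \<le> 1"
  using t by (auto simp: w_def)

lemma c_nonneg: "c n \<ge> 0"
  unfolding c_def using w_antimono[of n "n + 1"] by simp

lemma c_le_w: "c n \<le> w n"
  unfolding c_def using w_pos[of "n + 1"] by simp

lemma sum_c:
  assumes "j \<le> n + 1"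
  shows "(\<Sum>i\<in>{j..n}. c i) = w j - w (n + 1)"
proof -
  have "j - 1 \<le> n" using assms by simp
  then show ?thesis
  proof (induction n rule: int_ge_induct)
    case (step i)
    have "{j..i + 1} = insert (i + 1) {j..i}" using step by auto
    then show ?case using step by (simp add: c_def)
  qed simp
qed

lemma sum_c_window_le: "(\<Sum>n\<in>window N. c n) \<le> 1"
  using sum_c[of "- int N" "int N"] w_le_1[of "- int N"] w_pos[of "int N + 1"] by simp

lemma q_at_top: "filterlim (\<lambda>N. q (int N + 1)) at_top sequentially"
proof (rule filterlim_at_top_mono)
  show "filterlim (\<lambda>N::nat. (2::real) ^ N) at_top sequentially"
    by real_asymp
  show "\<forall>\<^sub>F N in sequentially. 2 ^ N \<le> q (int N + 1)"
    by (intro always_eventually allI order_trans[OF q_ge_power]) simp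
qed

lemma w_tendsto_0: "(\<lambda>N. w (int N + 1)) \<longlonglongrightarrow> 0"
proof -
  have "((\<lambda>y::real. exp (- t * y powr \<alpha>)) \<longlongrightarrow> 0) at_top"
    using t \<alpha> by real_asymp
  from filterlim_compose[OF this q_at_top] show ?thesis unfolding w_def .
qed

lemma w_tendsto_1: "(\<lambda>N. w (- int N)) \<longlonglongrightarrow> 1"
proof -
  have "(\<lambda>N. q (- int N)) \<longlonglongrightarrow> 0"
  proof (rule tendsto_sandwich[OF _ _ tendsto_const])
    show "(\<lambda>N::nat. (1/2::real) ^ N) \<longlonglongrightarrow> 0" by real_asymp
    show "\<forall>\<^sub>F N in sequentially. q (- int N) \<le> (1/2) ^ N"
      using q_ge_power by (intro always_eventually allI) (simp add: q_minus power_one_over frac_le)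
  qed simp
  then have "(\<lambda>N. q (- int N) powr \<alpha>) \<longlonglongrightarrow> 0 powr \<alpha>"
    using \<alpha> by (intro tendsto_powr') auto
  then have "(\<lambda>N. exp (- t * q (- int N) powr \<alpha>)) \<longlonglongrightarrow> exp (- t * 0)"
    using \<alpha> by (intro tendsto_intros) auto
  then show ?thesis by (simp add: w_def)
qed

text \<open>These are the integrals of the layers.  For large \<open>n\<close> the bound $y^2 e^{-ty^\alpha} < 1$ at \<open>y = q n\<close>
  gives a term of at most \<open>1 / q n\<close>, hence of at most \<open>2 ^ - n\<close>; for the other \<open>n\<close> the factor \<open>q n\<close> is bounded and
  the heights add up to at most \<open>1\<close>.\<close>

lemma sum_cq_bounded: "\<exists>B. \<forall>N. (\<Sum>n\<in>window N. c n * q n) \<le> B"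
proof -
  have "((\<lambda>y::real. y\<^sup>2 * exp (- t * y powr \<alpha>)) \<longlongrightarrow> 0) at_top"
    using t \<alpha> by real_asymp
  then have "\<forall>\<^sub>F y::real in at_top. y\<^sup>2 * exp (- t * y powr \<alpha>) < 1"
    by (rule order_tendstoD) simp
  then obtain Y where Y: "\<And>y. y \<ge> Y \<Longrightarrow> y\<^sup>2 * exp (- t * y powr \<alpha>) < 1"
    by (auto simp: eventually_at_top_linorder)
  obtain n0 :: nat where n0: "q (int n0) > Y" using q_unbounded by blast
  define h :: "int \<Rightarrow> real" where "h n = (if n \<ge> 0 then (1/2) ^ nat n else 0)" for n
  have term_le: "c n * q n \<le> c n * q (int n0) + h n" for n
  proof (cases "n \<le> int n0")
    case True
    have "c n * q n \<le> c n * q (int n0)" using True c_nonneg by (intro mult_left_mono) auto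
    moreover have "h n \<ge> 0" by (simp add: h_def)
    ultimately show ?thesis by linarith
  next
    case False
    then have "Y \<le> q n" using n0 q_le_iff[of "int n0" n] by linarith
    from Y[OF this] have "w n * q n \<le> 1 / q n" by (simp add: w_def field_simps power2_eq_square)
    also have "\<dots> \<le> (1/2) ^ nat n"
      using False q_ge_power[of "nat n"] by (simp add: power_one_over frac_le)
    finally have "w n * q n \<le> h n" using False by (simp add: h_def)
    moreover have "c n * q n \<le> w n * q n" by (intro mult_right_mono c_le_w) simp
    moreover have "0 \<le> c n * q (int n0)" using c_nonneg by simp
    ultimately show ?thesis by linarith
  qed
  have h_sum: "(\<Sum>n\<in>window N. h n) = 2 - (1/2) ^ N" for N
  proof (induction N)
    case (Suc N)
    have "window (Suc N) = insert (- int (Suc N)) (insert (int (Suc N)) (window N))" by auto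
    then have "(\<Sum>n\<in>window (Suc N). h n) = h (- int (Suc N)) + (h (int (Suc N)) + (\<Sum>n\<in>window N. h n))"
      by simp
    also have "h (- int (Suc N)) = 0" by (simp add: h_def)
    also have "h (int (Suc N)) = (1/2) ^ Suc N" unfolding h_def nat_int by simp
    finally show ?case using Suc by simp
  qed (simp add: h_def)
  have "(\<Sum>n\<in>window N. c n * q n) \<le> q (int n0) + 2" for N
  proof -
    have "(\<Sum>n\<in>window N. c n * q n) \<le> (\<Sum>n\<in>window N. c n * q (int n0) + h n)"
      by (intro sum_mono term_le)
    also have "\<dots> = (\<Sum>n\<in>window N. c n) * q (int n0) + (2 - (1/2) ^ N)"
      by (simp add: sum.distrib h_sum sum_distrib_right)
    also have "\<dots> \<le> 1 * q (int n0) + 2"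
      by (intro add_mono mult_right_mono sum_c_window_le) auto
    finally show ?thesis by simp
  qed
  then show ?thesis by blast
qed

definition K_N :: "nat \<Rightarrow> 'a \<Rightarrow> real" where
  "K_N N \<xi> = (\<Sum>n\<in>window N. if \<xi> \<in> G (- n) then c n else 0)"

lemma K_N_nonneg: "K_N N \<xi> \<ge> 0"
  unfolding K_N_def by (intro sum_nonneg) (simp add: c_nonneg)

lemma K_N_nonzero:
  assumes "nrm \<xi> = q j" "- int N \<le> j" "j \<le> int N"
  shows "K_N N \<xi> = w j - w (int N + 1)"
proof -
  have "\<xi> \<in> G (- n) \<longleftrightarrow> j \<le> n" for n by (simp add: G_iff assms(1) q_minus)
  then have "K_N N \<xi> = (\<Sum>n\<in>window N. if j \<le> n then c n else 0)" by (simp add: K_N_def)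
  also have "\<dots> = (\<Sum>n\<in>{n \<in> window N. j \<le> n}. c n)" by (rule sum.inter_filter[symmetric]) simp
  also have "{n \<in> window N. j \<le> n} = {j..int N}" using assms by auto
  finally show ?thesis using assms by (simp add: sum_c)
qed

lemma K_N_zero: "K_N N 0 = w (- int N) - w (int N + 1)"
  by (simp add: K_N_def sum_c)

lemma nrm_nonzero_values:
  assumes "\<xi> \<noteq> 0"
  obtains j where "nrm \<xi> = q j"
  using nrm_values[OF assms] q_minus by metis

text \<open>The heights of the layers above a point telescope.\<close>

lemma K_N_tendsto: "(\<lambda>N. K_N N \<xi>) \<longlonglongrightarrow> K \<xi>"
proof (cases "\<xi> = 0")
  case True
  then show ?thesis
    using tendsto_diff[OF w_tendsto_1 w_tendsto_0] by (simp add: K_N_zero K_def)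
next
  case False
  then obtain j where j: "nrm \<xi> = q j" by (rule nrm_nonzero_values)
  have ev: "\<forall>\<^sub>F N in sequentially. w j - w (int N + 1) = K_N N \<xi>"
    unfolding eventually_sequentially
    by (intro exI[of _ "nat \<bar>j\<bar>"] allI impI K_N_nonzero[OF j, symmetric]) linarith+
  have "(\<lambda>N. w j - w (int N + 1)) \<longlonglongrightarrow> w j - 0"
    by (intro tendsto_diff tendsto_const w_tendsto_0)
  from Lim_transform_eventually[OF this ev] show ?thesis
    by (simp add: K_def j w_def)
qed

lemma K_N_mono: "N \<le> N' \<Longrightarrow> K_N N \<xi> \<le> K_N N' \<xi>"
  unfolding K_N_def by (intro sum_mono2) (auto simp: c_nonneg)

lemma K_N_le_K: "K_N N \<xi> \<le> K \<xi>"
  by (rule LIMSEQ_le_const[OF K_N_tendsto]) (auto intro!: exI[of _ N] K_N_mono)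

lemma K_le_1: "K \<xi> \<le> 1" and K_nonneg: "K \<xi> \<ge> 0"
  using t by (auto simp: K_def)

lemma K_measurable [measurable]: "K \<in> borel_measurable M"
proof -
  have [measurable]: "nrm \<in> borel_measurable M" by (rule measurable_continuous) (intro continuous_intros)
  show ?thesis unfolding K_def by measurable
qed

lemma K_N_eq_ind: "complex_of_real (K_N N \<xi>) = (\<Sum>n\<in>window N. of_real (c n) * ind 0 (- n) \<xi>)"
  by (simp add: K_N_def ind_def if_distrib cong: if_cong)

lemma K_integrable: "integrable M (\<lambda>\<xi>. complex_of_real (K \<xi>))"
proof -
  obtain B where B: "\<And>N. (\<Sum>n\<in>window N. c n * q n) \<le> B" using sum_cq_bounded by blast
  have int: "integrable M (\<lambda>\<xi>. complex_of_real (K_N N \<xi>))" for N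
    unfolding K_N_eq_ind by (intro Bochner_Integration.integrable_sum integrable_mult_right ind_integrable)
  show ?thesis
  proof (rule integrable_Fatou)
    show "integrable M (\<lambda>\<xi>. complex_of_real (K_N N \<xi>))" for N by (rule int)
    show "(\<lambda>N. complex_of_real (K_N N \<xi>)) \<longlonglongrightarrow> complex_of_real (K \<xi>)" for \<xi>
      by (intro tendsto_of_real K_N_tendsto)
    show "(\<integral>\<xi>. cmod (complex_of_real (K_N N \<xi>)) \<partial>M) \<le> B" for N
    proof -
      have "complex_of_real (\<integral>\<xi>. cmod (complex_of_real (K_N N \<xi>)) \<partial>M) = (\<integral>\<xi>. complex_of_real (K_N N \<xi>) \<partial>M)"
        by (simp add: K_N_nonneg flip: integral_complex_of_real)
      also have "\<dots> = (\<Sum>n\<in>window N. of_real (c n) * of_real (1 / q (- n)))"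
        unfolding K_N_eq_ind
        by (subst Bochner_Integration.integral_sum)
           (auto intro!: integrable_mult_right ind_integrable simp: ind_integral)
      also have "\<dots> = complex_of_real (\<Sum>n\<in>window N. c n * q n)"
        by (simp add: q_minus)
      finally show ?thesis using B[of N] by (simp only: of_real_eq_iff)
    qed
  qed measurable
qed

abbreviation Z :: "'a \<Rightarrow> complex" where "Z x \<equiv> heat_kernel E \<iota> M \<alpha> x t"

definition Z_N :: "nat \<Rightarrow> 'a \<Rightarrow> real" where
  "Z_N N x = (\<Sum>n\<in>window N. if x \<in> G n then c n * q n else 0)"

lemma Z_N_nonneg: "Z_N N x \<ge> 0"
  unfolding Z_N_def by (intro sum_nonneg) (simp add: c_nonneg)

lemma Z_N_bounded: obtains B where "B \<ge> 0" "\<And>N x. Z_N N x \<le> B"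
proof -
  obtain B where B: "\<And>N. (\<Sum>n\<in>window N. c n * q n) \<le> B" using sum_cq_bounded by blast
  have "Z_N N x \<le> (\<Sum>n\<in>window N. c n * q n)" for N x
    unfolding Z_N_def by (intro sum_mono) (simp add: c_nonneg)
  then have le: "Z_N N x \<le> B" for N x using B order_trans by blast
  then have "B \<ge> 0" using Z_N_nonneg order_trans by blast
  then show ?thesis using that le by blast
qed

lemma Z_N_eq_ind: "complex_of_real (Z_N N (x - y)) = (\<Sum>n\<in>window N. of_real (c n * q n) * ind x n y)"
  by (simp add: Z_N_def ind_def if_distrib G_minus_commute[of x y] cong: if_cong)

text \<open>The kernel is the increasing limit of positive combinations of normalized indicators of the
  groups \<open>G n\<close>, the transforms of the layers of \<open>exp (- t * \<parallel>\<xi>\<parallel> powr \<alpha>)\<close>.\<close>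

lemma Z_N_tendsto: "(\<lambda>N. complex_of_real (Z_N N x)) \<longlonglongrightarrow> Z x"
proof -
  have "(\<lambda>N. \<integral>\<xi>. ch (- x * \<xi>) * complex_of_real (K_N N \<xi>) \<partial>M) \<longlonglongrightarrow> (\<integral>\<xi>. ch (- x * \<xi>) * complex_of_real (K \<xi>) \<partial>M)"
  proof (rule integral_dominated_convergence)
    show "integrable M (\<lambda>\<xi>. K \<xi>)" using K_integrable by (simp add: complex_of_real_integrable_eq)
    show "AE \<xi> in M. (\<lambda>N. ch (- x * \<xi>) * complex_of_real (K_N N \<xi>)) \<longlonglongrightarrow> ch (- x * \<xi>) * complex_of_real (K \<xi>)"
      by (intro always_eventually allI tendsto_mult tendsto_const tendsto_of_real K_N_tendsto)
    show "AE \<xi> in M. cmod (ch (- x * \<xi>) * complex_of_real (K_N N \<xi>)) \<le> K \<xi>" for N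
      by (intro always_eventually allI) (simp add: norm_mult K_N_nonneg K_N_le_K)
    show "(\<lambda>\<xi>. ch (- x * \<xi>) * complex_of_real (K_N N \<xi>)) \<in> borel_measurable M" for N
      unfolding K_N_eq_ind by measurable
  qed measurable
  moreover have "(\<integral>\<xi>. ch (- x * \<xi>) * complex_of_real (K_N N \<xi>) \<partial>M) = complex_of_real (Z_N N x)" for N
  proof -
    have "(\<integral>\<xi>. ch (- x * \<xi>) * complex_of_real (K_N N \<xi>) \<partial>M)
        = (\<integral>\<xi>. (\<Sum>n\<in>window N. of_real (c n) * (ind 0 (- n) \<xi> * ch (- x * \<xi>))) \<partial>M)"
      unfolding K_N_eq_ind by (simp add: sum_distrib_left mult_ac)
    also have "\<dots> = (\<Sum>n\<in>window N. of_real (c n) * (\<integral>\<xi>. ind 0 (- n) \<xi> * ch (- x * \<xi>) \<partial>M))"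
      by (subst Bochner_Integration.integral_sum)
         (intro integrable_mult_right FT_integrable ind_integrable, simp only: integral_mult_right_zero)
    also have "\<dots> = complex_of_real (Z_N N x)"
      unfolding char_integral by (simp add: Z_N_def q_minus if_distrib cong: if_cong)
    finally show ?thesis .
  qed
  ultimately show ?thesis
    by (simp add: heat_kernel_def adele_norm_eq K_def)
qed

lemma Z_translate_measurable: "(\<lambda>y. Z (x - y)) \<in> borel_measurable M"
proof (rule borel_measurable_LIMSEQ_metric[OF _ Z_N_tendsto])
  show "(\<lambda>y. complex_of_real (Z_N N (x - y))) \<in> borel_measurable M" for N
    unfolding Z_N_eq_ind by measurable
qed

lemma Z_translate_integrable: "integrable M (\<lambda>y. Z (x - y))"
proof (rule integrable_Fatou[OF Z_translate_measurable])
  show int: "integrable M (\<lambda>y. complex_of_real (Z_N N (x - y)))" for N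
    unfolding Z_N_eq_ind by (intro Bochner_Integration.integrable_sum integrable_mult_right ind_integrable)
  show "(\<lambda>N. complex_of_real (Z_N N (x - y))) \<longlonglongrightarrow> Z (x - y)" for y by (rule Z_N_tendsto)
  show "(\<integral>y. cmod (complex_of_real (Z_N N (x - y))) \<partial>M) \<le> 1" for N
  proof -
    have "complex_of_real (\<integral>y. cmod (complex_of_real (Z_N N (x - y))) \<partial>M) = (\<integral>y. complex_of_real (Z_N N (x - y)) \<partial>M)"
      by (simp add: Z_N_nonneg flip: integral_complex_of_real)
    also have "\<dots> = (\<Sum>n\<in>window N. of_real (c n * q n) * of_real (1 / q n))"
      unfolding Z_N_eq_ind
      by (subst Bochner_Integration.integral_sum)
         (auto intro!: integrable_mult_right ind_integrable simp: ind_integral)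
    also have "\<dots> = complex_of_real (\<Sum>n\<in>window N. c n)"
      by simp
    finally show ?thesis using sum_c_window_le[of N] by (simp only: of_real_eq_iff)
  qed
qed

lemma Z_translate_L2: "(\<lambda>y. Z (x - y)) \<in> L2 M"
proof -
  obtain B where B: "B \<ge> 0" "\<And>N x. Z_N N x \<le> B" by (rule Z_N_bounded) blast
  have "cmod (Z (x - y)) \<le> B" for y
    by (rule LIMSEQ_le_const2[OF tendsto_norm[OF Z_N_tendsto]]) (auto simp: Z_N_nonneg B)
  then show ?thesis by (rule bounded_integrable_L2[OF Z_translate_integrable])
qed

definition T :: "('a \<Rightarrow> complex) \<Rightarrow> 'a \<Rightarrow> complex" where
  "T f x = (\<integral>y. Z (x - y) * f y \<partial>M)"

lemma T_add: "f \<in> L2 M \<Longrightarrow> g \<in> L2 M \<Longrightarrow> T (\<lambda>x. f x + g x) x = T f x + T g x"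
  by (simp add: T_def distrib_left L2_mult_integrable Z_translate_L2)

lemma T_diff: "f \<in> L2 M \<Longrightarrow> g \<in> L2 M \<Longrightarrow> T (\<lambda>x. f x - g x) x = T f x - T g x"
  by (simp add: T_def right_diff_distrib L2_mult_integrable Z_translate_L2)

lemma T_cmult: "T (\<lambda>x. b * f x) x = b * T f x"
  by (simp add: T_def mult.left_commute)

lemma T_pointwise_bound: "f \<in> L2 M \<Longrightarrow> cmod (T f x) \<le> L2_norm M (\<lambda>y. Z (x - y)) * L2_norm M f"
  unfolding T_def by (intro norm_integral_mult_le_L2 Z_translate_L2)

text \<open>The convolution of \<open>Z_N N\<close> with the indicator of the ball of index \<open>m\<close> around \<open>a\<close>: averaging that indicator
  over the translates of \<open>G n\<close> spreads it over the larger of the two balls.\<close>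

definition conv_Z_N_ind :: "'a \<Rightarrow> int \<Rightarrow> nat \<Rightarrow> 'a \<Rightarrow> real" where
  "conv_Z_N_ind a m N x = (\<Sum>n\<in>window N. if x - a \<in> G (min n m) then c n * (q (min n m) / q m) else 0)"

lemma conv_Z_N_ind_eq: "complex_of_real (conv_Z_N_ind a m N x) = (\<Sum>n\<in>window N. of_real (c n * (q (min n m) / q m)) * ind a (min n m) x)"
  by (simp add: conv_Z_N_ind_def ind_def if_distrib cong: if_cong)

lemma conv_Z_N_ind_nonneg: "conv_Z_N_ind a m N x \<ge> 0"
  unfolding conv_Z_N_ind_def by (intro sum_nonneg) (simp add: c_nonneg)

lemma conv_Z_N_ind_mono: "N \<le> N' \<Longrightarrow> conv_Z_N_ind a m N x \<le> conv_Z_N_ind a m N' x"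
  unfolding conv_Z_N_ind_def by (intro sum_mono2) (auto simp: c_nonneg)

lemma conv_Z_N_ind_le_1: "conv_Z_N_ind a m N x \<le> 1"
proof -
  have "conv_Z_N_ind a m N x \<le> (\<Sum>n\<in>window N. c n)"
    unfolding conv_Z_N_ind_def
  proof (rule sum_mono)
    fix n
    have "q (min n m) / q m \<le> 1" by simp
    then show "(if x - a \<in> G (min n m) then c n * (q (min n m) / q m) else 0) \<le> c n"
      using c_nonneg[of n] mult_left_le[of "q (min n m) / q m" "c n"] by simp
  qed
  then show ?thesis using sum_c_window_le[of N] by linarith
qed

lemma conv_Z_N_ind_tendsto: "(\<lambda>N. complex_of_real (conv_Z_N_ind a m N x)) \<longlonglongrightarrow> T (ind a m) x"
proof -
  obtain B where B: "B \<ge> 0" "\<And>N x. Z_N N x \<le> B" by (rule Z_N_bounded) blast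
  have "(\<lambda>N. \<integral>y. complex_of_real (Z_N N (x - y)) * ind a m y \<partial>M) \<longlonglongrightarrow> T (ind a m) x"
    unfolding T_def
  proof (rule integral_dominated_convergence)
    show "(\<lambda>y. Z (x - y) * ind a m y) \<in> borel_measurable M"
      using Z_translate_measurable[of x] by measurable
    show "(\<lambda>y. complex_of_real (Z_N N (x - y)) * ind a m y) \<in> borel_measurable M" for N
      unfolding Z_N_eq_ind by measurable
    show "integrable M (\<lambda>y. B * cmod (ind a m y))" using ind_integrable by simp
    show "AE y in M. (\<lambda>N. complex_of_real (Z_N N (x - y)) * ind a m y) \<longlonglongrightarrow> Z (x - y) * ind a m y"
      by (intro always_eventually allI tendsto_mult tendsto_const Z_N_tendsto)
    show "AE y in M. cmod (complex_of_real (Z_N N (x - y)) * ind a m y) \<le> B * cmod (ind a m y)" for N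
      by (intro always_eventually allI) (auto simp: norm_mult Z_N_nonneg intro!: mult_right_mono B)
  qed
  moreover have "(\<integral>y. complex_of_real (Z_N N (x - y)) * ind a m y \<partial>M) = complex_of_real (conv_Z_N_ind a m N x)" for N
  proof -
    have prod: "(\<integral>y. ind x n y * ind a m y \<partial>M) = (if x - a \<in> G (min n m) then of_real (1 / q (max n m)) else 0)" for n
    proof -
      have "(\<integral>y. ind x n y * ind a m y \<partial>M) = ip (ind x n) (ind a m)"
        unfolding ip_def by (intro Bochner_Integration.integral_cong) (auto simp: ind_def)
      then show ?thesis unfolding ip_ind .
    qed
    have "(\<integral>y. complex_of_real (Z_N N (x - y)) * ind a m y \<partial>M)
        = (\<integral>y. (\<Sum>n\<in>window N. of_real (c n * q n) * (ind x n y * ind a m y)) \<partial>M)"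
      by (simp only: Z_N_eq_ind sum_distrib_right mult.assoc)
    also have "\<dots> = (\<Sum>n\<in>window N. of_real (c n * q n) * (\<integral>y. ind x n y * ind a m y \<partial>M))"
      by (subst Bochner_Integration.integral_sum)
         (auto intro!: integrable_mult_right L2_mult_integrable ind_L2)
    also have "\<dots> = (\<Sum>n\<in>window N. complex_of_real (if x - a \<in> G (min n m) then c n * (q (min n m) / q m) else 0))"
    proof (rule sum.cong[OF refl])
      fix n
      have "q n * (1 / q (max n m)) = q (min n m) / q m" by (simp add: min_def max_def)
      then have "c n * q n * (1 / q (max n m)) = c n * (q (min n m) / q m)" by (simp only: mult.assoc)
      then show "of_real (c n * q n) * (\<integral>y. ind x n y * ind a m y \<partial>M)
          = complex_of_real (if x - a \<in> G (min n m) then c n * (q (min n m) / q m) else 0)"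
        unfolding prod by (simp flip: of_real_mult of_real_divide)
    qed
    also have "\<dots> = complex_of_real (conv_Z_N_ind a m N x)"
      unfolding conv_Z_N_ind_def by simp
    finally show ?thesis .
  qed
  ultimately show ?thesis by simp
qed

text \<open>For each layer, averaging over \<open>G n\<close> on one side is restriction to \<open>G (- n)\<close> on the other; the layers are
  summed by dominated convergence, with the limit itself as dominating function.\<close>

lemma T_ind:
  shows "integrable M (T (ind a m))" "T (ind a m) \<in> L2 M"
    "FT (T (ind a m)) \<xi> = of_real (K \<xi>) * FT (ind a m) \<xi>"
proof -
  have conv_int: "integrable M (\<lambda>x. complex_of_real (conv_Z_N_ind a m N x))" for N
    unfolding conv_Z_N_ind_eq by (intro Bochner_Integration.integrable_sum integrable_mult_right ind_integrable)
  have meas: "T (ind a m) \<in> borel_measurable M"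
    by (rule borel_measurable_LIMSEQ_metric[OF borel_measurable_integrable[OF conv_int] conv_Z_N_ind_tendsto])
  show int: "integrable M (T (ind a m))"
  proof (rule integrable_Fatou[OF meas conv_int conv_Z_N_ind_tendsto])
    fix N
    have "complex_of_real (\<integral>x. cmod (complex_of_real (conv_Z_N_ind a m N x)) \<partial>M) = (\<integral>x. complex_of_real (conv_Z_N_ind a m N x) \<partial>M)"
      by (simp add: conv_Z_N_ind_nonneg flip: integral_complex_of_real)
    also have "\<dots> = (\<Sum>n\<in>window N. of_real (c n * (q (min n m) / q m)) * of_real (1 / q (min n m)))"
      unfolding conv_Z_N_ind_eq
      by (subst Bochner_Integration.integral_sum)
         (auto intro!: integrable_mult_right ind_integrable simp: ind_integral)
    also have "\<dots> = complex_of_real ((\<Sum>n\<in>window N. c n) * (1 / q m))"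
      by (simp add: sum_distrib_right sum_divide_distrib)
    finally have "(\<integral>x. cmod (complex_of_real (conv_Z_N_ind a m N x)) \<partial>M) = (\<Sum>n\<in>window N. c n) * (1 / q m)"
      by (simp only: of_real_eq_iff)
    also have "\<dots> \<le> 1 * (1 / q m)" by (intro mult_right_mono sum_c_window_le) simp
    finally show "(\<integral>x. cmod (complex_of_real (conv_Z_N_ind a m N x)) \<partial>M) \<le> 1 / q m" by simp
  qed
  have "cmod (T (ind a m) x) \<le> 1" for x
    by (rule LIMSEQ_le_const2[OF tendsto_norm[OF conv_Z_N_ind_tendsto]]) (auto simp: conv_Z_N_ind_nonneg conv_Z_N_ind_le_1)
  then show "T (ind a m) \<in> L2 M" by (rule bounded_integrable_L2[OF int])
  have conv_le: "conv_Z_N_ind a m N x \<le> cmod (T (ind a m) x)" for N x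
    by (rule LIMSEQ_le_const[OF tendsto_norm[OF conv_Z_N_ind_tendsto]])
       (auto simp: conv_Z_N_ind_nonneg intro!: exI[of _ N] conv_Z_N_ind_mono)
  have "(\<lambda>N. FT (\<lambda>x. complex_of_real (conv_Z_N_ind a m N x)) \<xi>) \<longlonglongrightarrow> FT (T (ind a m)) \<xi>"
    unfolding fourier_def
  proof (rule integral_dominated_convergence)
    show "integrable M (\<lambda>x. cmod (T (ind a m) x))" using int by simp
    show "(\<lambda>x. T (ind a m) x * ch (\<xi> * x)) \<in> borel_measurable M" using meas by measurable
    show "(\<lambda>x. complex_of_real (conv_Z_N_ind a m N x) * ch (\<xi> * x)) \<in> borel_measurable M" for N
      using borel_measurable_integrable[OF conv_int[of N]] by measurable
    show "AE x in M. (\<lambda>N. complex_of_real (conv_Z_N_ind a m N x) * ch (\<xi> * x)) \<longlonglongrightarrow> T (ind a m) x * ch (\<xi> * x)"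
      by (intro always_eventually allI tendsto_mult tendsto_const conv_Z_N_ind_tendsto)
    show "AE x in M. cmod (complex_of_real (conv_Z_N_ind a m N x) * ch (\<xi> * x)) \<le> cmod (T (ind a m) x)" for N
      by (intro always_eventually allI) (simp add: norm_mult conv_Z_N_ind_nonneg conv_le)
  qed
  moreover have "FT (\<lambda>x. complex_of_real (conv_Z_N_ind a m N x)) \<xi> = of_real (K_N N \<xi>) * FT (ind a m) \<xi>" for N
  proof -
    have "FT (\<lambda>x. complex_of_real (conv_Z_N_ind a m N x)) \<xi>
        = (\<integral>x. (\<Sum>n\<in>window N. of_real (c n * (q (min n m) / q m)) * (ind a (min n m) x * ch (\<xi> * x))) \<partial>M)"
      by (simp only: conv_Z_N_ind_eq fourier_def sum_distrib_right mult.assoc)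
    also have "\<dots> = (\<Sum>n\<in>window N. of_real (c n * (q (min n m) / q m)) * FT (ind a (min n m)) \<xi>)"
      unfolding fourier_def
      by (subst Bochner_Integration.integral_sum)
         (auto intro!: integrable_mult_right FT_integrable ind_integrable)
    also have "\<dots> = (\<Sum>n\<in>window N. of_real (c n) * ind 0 (- n) \<xi> * FT (ind a m) \<xi>)"
    proof (rule sum.cong[OF refl])
      fix n
      have "ind 0 (- min n m) \<xi> = ind 0 (- n) \<xi> * ind 0 (- m) \<xi>"
        using G_antimonoD[of \<xi> "- m" "- n"] G_antimonoD[of \<xi> "- n" "- m"]
        by (auto simp: ind_def min_def)
      moreover have "complex_of_real (c n * (q (min n m) / q m)) * of_real (1 / q (min n m)) = of_real (c n) * of_real (1 / q m)"
        by simp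
      ultimately show "of_real (c n * (q (min n m) / q m)) * FT (ind a (min n m)) \<xi>
          = of_real (c n) * ind 0 (- n) \<xi> * FT (ind a m) \<xi>"
        unfolding FT_ind by (simp add: field_simps)
    qed
    also have "\<dots> = of_real (K_N N \<xi>) * FT (ind a m) \<xi>"
      unfolding K_N_eq_ind by (simp add: sum_distrib_right)
    finally show ?thesis .
  qed
  moreover have "(\<lambda>N. complex_of_real (K_N N \<xi>) * FT (ind a m) \<xi>) \<longlonglongrightarrow> of_real (K \<xi>) * FT (ind a m) \<xi>"
    by (intro tendsto_mult tendsto_const tendsto_of_real K_N_tendsto)
  ultimately show "FT (T (ind a m)) \<xi> = of_real (K \<xi>) * FT (ind a m) \<xi>"
    using LIMSEQ_unique by fastforce
qed

lemma T_Test: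
  assumes "f \<in> Test"
  shows "integrable M (T f) \<and> T f \<in> L2 M \<and> (\<forall>\<xi>. FT (T f) \<xi> = of_real (K \<xi>) * FT f \<xi>)"
  using assms
proof (induction rule: Test.induct)
  case (Test_ind a n)
  then show ?case using T_ind by blast
next
  case (Test_add f g)
  then have "T (\<lambda>x. f x + g x) = (\<lambda>x. T f x + T g x)"
    by (simp add: fun_eq_iff T_add Test_L2)
  then show ?case using Test_add
    by (simp add: FT_add Test_integrable L2_add distrib_left)
next
  case (Test_cmult f b)
  have "T (\<lambda>x. b * f x) = (\<lambda>x. b * T f x)" by (simp add: fun_eq_iff T_cmult)
  then show ?case using Test_cmult by (simp add: FT_cmult L2_cmult mult.left_commute)
qed

text \<open>Along test functions that converge to \<open>f\<close>, the convolutions converge pointwise because the kernel is square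
  integrable, and they are Cauchy in \<open>L2\<close> because their transforms are; so both limits agree.\<close>

lemma T_L2_F2:
  assumes f: "f \<in> L2 M"
  shows "T f \<in> L2 M" "L2_eq M (F2 (T f)) (\<lambda>\<xi>. of_real (K \<xi>) * F2 f \<xi>)"
proof -
  obtain g where g: "\<And>n. g n \<in> Test" "L2_tendsto M g f sequentially"
    using Test_dense_L2[OF f] by blast
  note T = T_Test[OF g(1)]
  have g2: "g n \<in> L2 M" for n by (rule Test_L2[OF g(1)])
  have KFT: "L2_tendsto M (\<lambda>n \<xi>. of_real (K \<xi>) * FT (g n) \<xi>) (\<lambda>\<xi>. of_real (K \<xi>) * F2 f \<xi>) sequentially"
  proof -
    have FTg: "L2_tendsto M (\<lambda>n. FT (g n)) (F2 f) sequentially"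
      by (intro FT_tendsto_F2 f g Test_integrable g2)
    have KL: "(\<lambda>\<xi>. of_real (K \<xi>) * h \<xi>) \<in> L2 M" "L2_norm M (\<lambda>\<xi>. of_real (K \<xi>) * h \<xi>) \<le> L2_norm M h"
      if h: "h \<in> L2 M" for h
    proof -
      have [measurable]: "h \<in> borel_measurable M" using h by (rule L2_measurable)
      have le: "cmod (of_real (K \<xi>) * h \<xi>) \<le> cmod (h \<xi>)" for \<xi>
        using K_nonneg[of \<xi>] K_le_1[of \<xi>] by (simp add: norm_mult mult_left_le_one_le)
      show "(\<lambda>\<xi>. of_real (K \<xi>) * h \<xi>) \<in> L2 M"
        by (rule L2_dominated[OF _ h]) (use le in auto)
      show "L2_norm M (\<lambda>\<xi>. of_real (K \<xi>) * h \<xi>) \<le> L2_norm M h"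
        by (rule L2_norm_mono[OF h]) (use le in auto)
    qed
    show ?thesis
    proof (rule L2_tendsto_le[OF KL(1)[OF F2_L2[OF f]]])
      show "\<forall>\<^sub>F n in sequentially. (\<lambda>\<xi>. of_real (K \<xi>) * FT (g n) \<xi>) \<in> L2 M"
        by (intro always_eventually allI KL FT_Test_L2 g)
      show "\<forall>\<^sub>F n in sequentially. L2_norm M (\<lambda>\<xi>. of_real (K \<xi>) * FT (g n) \<xi> - of_real (K \<xi>) * F2 f \<xi>)
          \<le> L2_norm M (\<lambda>\<xi>. FT (g n) \<xi> - F2 f \<xi>)"
        using KL(2)[OF L2_diff[OF FT_Test_L2[OF g(1)] F2_L2[OF f]]]
        by (simp add: right_diff_distrib)
    qed (rule L2_tendstoD(3)[OF FTg])
  qed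
  have FTT: "(\<lambda>\<xi>. of_real (K \<xi>) * FT (g n) \<xi>) = FT (T (g n))" for n
    using T by (simp add: fun_eq_iff)
  have KFT': "L2_tendsto M (\<lambda>n. FT (T (g n))) (\<lambda>\<xi>. of_real (K \<xi>) * F2 f \<xi>) sequentially"
    using KFT by (simp only: FTT)
  have FTT_L2: "FT (T (g n)) \<in> L2 M" for n using T Plancherel(1) by blast
  have KC: "L2_Cauchy M (\<lambda>n. FT (T (g n)))"
    by (rule L2_tendsto_imp_Cauchy[OF KFT' FTT_L2])
  have "L2_norm M (\<lambda>x. T (g k) x - T (g n) x) = L2_norm M (\<lambda>x. FT (T (g k)) x - FT (T (g n)) x)" for k n
  proof -
    have "(\<lambda>x. FT (T (g k)) x - FT (T (g n)) x) = FT (\<lambda>x. T (g k) x - T (g n) x)"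
      using T by (simp add: fun_eq_iff FT_diff)
    then show ?thesis using T by (simp add: Plancherel L2_diff)
  qed
  then have TC: "L2_Cauchy M (\<lambda>n. T (g n))"
    using KC T by (simp add: L2_Cauchy_def)
  have lim: "(\<lambda>n. T (g n) x) \<longlonglongrightarrow> T f x" for x
  proof -
    have "cmod (T (g n) x - T f x) \<le> L2_norm M (\<lambda>y. Z (x - y)) * L2_norm M (\<lambda>y. g n y - f y)" for n
      using T_pointwise_bound[OF L2_diff[OF g2[of n] f], of x] by (simp add: T_diff g2 f)
    then have "\<forall>\<^sub>F n in sequentially. cmod (T (g n) x - T f x)
        \<le> L2_norm M (\<lambda>y. Z (x - y)) * L2_norm M (\<lambda>y. g n y - f y)"
      by (intro always_eventually allI)
    moreover have "(\<lambda>n. L2_norm M (\<lambda>y. Z (x - y)) * L2_norm M (\<lambda>y. g n y - f y)) \<longlonglongrightarrow> 0"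
      by (intro tendsto_mult_right_zero L2_tendstoD(3)[OF g(2)])
    ultimately have "(\<lambda>n. T (g n) x - T f x) \<longlonglongrightarrow> 0"
      by (rule Lim_null_comparison)
    then show ?thesis by (simp add: LIM_zero_iff)
  qed
  have "T f \<in> borel_measurable M"
    by (rule borel_measurable_LIMSEQ_metric[OF _ lim]) (use T in \<open>auto dest: L2_measurable\<close>)
  then have TL: "L2_tendsto M (\<lambda>n. T (g n)) (T f) sequentially"
    by (intro L2_Cauchy_pointwise[OF TC]) (use lim in auto)
  then show Tf: "T f \<in> L2 M" by (rule L2_tendstoD)
  have "L2_tendsto M (\<lambda>n. FT (T (g n))) (F2 (T f)) sequentially"
    using T by (intro FT_tendsto_F2 Tf TL) auto
  then show "L2_eq M (F2 (T f)) (\<lambda>\<xi>. of_real (K \<xi>) * F2 f \<xi>)"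
    by (rule L2_tendsto_unique[OF _ KFT']) simp
qed

end

section \<open>The heat semigroup on the finite adeles\<close>

lemma (in adele_haar) heat_representation:
  assumes \<alpha>: "\<alpha> > 0"
  shows "heat_representation M F2 (\<lambda>\<xi>. adele_norm E \<iota> \<xi> powr \<alpha>) (heat_operator E \<iota> M \<alpha>)"
proof (intro heat_representation.intro spectral_representation.intro heat_representation_axioms.intro)
  show "(\<lambda>\<xi>. adele_norm E \<iota> \<xi> powr \<alpha>) \<in> borel_measurable M"
  proof -
    have [measurable]: "nrm \<in> borel_measurable M" by (rule measurable_continuous) (intro continuous_intros)
    show ?thesis unfolding adele_norm_eq by measurable
  qed
  fix t :: real and f assume "t \<ge> 0" and f: "f \<in> L2 M"
  have "heat_operator E \<iota> M \<alpha> t f \<in> L2 M \<and> L2_eq M (F2 (heat_operator E \<iota> M \<alpha> t f))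
      (\<lambda>\<xi>. of_real (exp (- t * adele_norm E \<iota> \<xi> powr \<alpha>)) * F2 f \<xi>)"
  proof (cases "t = 0")
    case True
    then show ?thesis using f by (simp add: heat_operator_def)
  next
    case False
    then interpret H: adele_heat E \<iota> M \<alpha> t
      using \<alpha> \<open>t \<ge> 0\<close> by unfold_locales auto
    have "heat_operator E \<iota> M \<alpha> t f = H.T f"
      using False by (simp add: fun_eq_iff heat_operator_def convolution_def H.T_def)
    then show ?thesis using H.T_L2_F2[OF f] by (simp add: H.K_def adele_norm_eq)
  qed
  then show "heat_operator E \<iota> M \<alpha> t f \<in> L2 M"
    and "L2_eq M (F2 (heat_operator E \<iota> M \<alpha> t f))
      (\<lambda>\<xi>. of_real (exp (- t * adele_norm E \<iota> \<xi> powr \<alpha>)) * F2 f \<xi>)" by auto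
qed (auto simp: heat_operator_def intro: F2_L2 F2_add F2_cmult F2_norm F2_surj)

theorem theorem2p9:
  fixes E :: "nat \<Rightarrow> nat"
    and \<iota> :: "rat \<Rightarrow> 'a::{comm_ring_1, topological_ab_group_add,
      topological_semigroup_mult, complete_space}"
    and M :: "'a measure"
    and \<alpha> :: real
  assumes "adelic_sequence E"
    and "finite_adeles E \<iota>"
    and "normalized_haar E \<iota> M"
    and "\<alpha> > 0"
  shows "(\<exists>S. C0_semigroup M S \<and> generated_by M S (Dom_D E \<iota> M \<alpha>) (\<lambda>f x. - D_op E \<iota> M \<alpha> f x)) \<and>
    (\<forall>S. C0_semigroup M S \<and> generated_by M S (Dom_D E \<iota> M \<alpha>) (\<lambda>f x. - D_op E \<iota> M \<alpha> f x) \<longrightarrow>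
      (\<forall>t\<ge>0. \<forall>f\<in>L2 M. heat_operator E \<iota> M \<alpha> t f \<in> L2 M \<and>
         L2_eq M (S t f) (heat_operator E \<iota> M \<alpha> t f))) \<and>
    (\<forall>f\<in>Dom_D E \<iota> M \<alpha>.
      cauchy_solution E \<iota> M \<alpha> f (\<lambda>x t. heat_operator E \<iota> M \<alpha> t f x) \<and>
      (\<forall>u. cauchy_solution E \<iota> M \<alpha> f u \<longrightarrow>
        (\<forall>t>0. AE x in M. u x t = (\<integral>y. heat_kernel E \<iota> M \<alpha> (x - y) t * f y \<partial>M))))"
proof -
  have "adele_haar E \<iota> M"
    using assms by unfold_locales
  from adele_haar.heat_representation[OF this assms(4)]
  interpret R: heat_representation M "fourier_L2 E \<iota> M" "\<lambda>\<xi>. adele_norm E \<iota> \<xi> powr \<alpha>" "heat_operator E \<iota> M \<alpha>" .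
  have Dom: "Dom_D E \<iota> M \<alpha> = R.Dom"
    by (simp add: Dom_D_def R.Dom_def)
  have D: "D_op E \<iota> M \<alpha> = R.D"
    by (simp add: fun_eq_iff D_op_def R.D_def inverse_fourier_L2_def)
  show ?thesis
    unfolding Dom D
  proof (intro conjI allI impI ballI)
    show "\<exists>S. C0_semigroup M S \<and> generated_by M S R.Dom (\<lambda>f x. - R.D f x)"
      using R.T_C0_semigroup R.T_generated_by by blast
    show "heat_operator E \<iota> M \<alpha> t f \<in> L2 M" if "t \<ge> 0" "f \<in> L2 M" for t f
      using that by (rule R.T_L2)
    show "L2_eq M (S t f) (heat_operator E \<iota> M \<alpha> t f)"
      if "C0_semigroup M S \<and> generated_by M S R.Dom (\<lambda>f x. - R.D f x)" "t \<ge> 0" "f \<in> L2 M" for S t f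
      using that by (intro R.generated_semigroup_eq) auto
    fix f assume f: "f \<in> R.Dom"
    show "cauchy_solution E \<iota> M \<alpha> f (\<lambda>x t. heat_operator E \<iota> M \<alpha> t f x)"
      unfolding cauchy_solution_def Dom D
      by (intro exI[of _ "\<lambda>t x. - R.D (heat_operator E \<iota> M \<alpha> t f) x"] conjI allI impI
            R.T_differentiable R.T_derivative_continuous R.T_Dom f) (auto simp: R.T_0)
    fix u and t :: real assume u: "cauchy_solution E \<iota> M \<alpha> f u" and t: "t > 0"
    then obtain v where v:
      "\<And>t. t \<ge> 0 \<Longrightarrow> L2_tendsto M (\<lambda>s x. (u x s - u x t) / of_real (s - t)) (v t) (at t within {0..})"
      "\<And>t. t \<ge> 0 \<Longrightarrow> (\<lambda>x. u x t) \<in> R.Dom"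
      "\<And>t. t \<ge> 0 \<Longrightarrow> L2_eq M (\<lambda>x. v t x + R.D (\<lambda>x. u x t) x) (\<lambda>x. 0)"
      "L2_eq M (\<lambda>x. u x 0) f"
      unfolding cauchy_solution_def Dom D by blast
    have "R.flow (\<lambda>t x. u x t) v"
      unfolding R.flow_def
    proof (intro allI impI conjI)
      fix t :: real assume t: "t \<ge> 0"
      show u2: "(\<lambda>x. u x t) \<in> L2 M" by (rule R.D_properties[OF v(2)[OF t]])
      show "L2_tendsto M (\<lambda>s x. (u x s - u x t) / of_real (s - t)) (v t) (at t within {0..})"
        by (rule v(1)[OF t])
      have "L2_eq M (v t) (\<lambda>x. - R.D (\<lambda>x. u x t) x)"
        using v(3)[OF t] unfolding L2_eq_def by eventually_elim (simp add: eq_neg_iff_add_eq_0)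
      then show "L2_eq M (fourier_L2 E \<iota> M (v t)) (\<lambda>\<xi>. - of_real (adele_norm E \<iota> \<xi> powr \<alpha>) * fourier_L2 E \<iota> M (\<lambda>x. u x t) \<xi>)"
        using R.minus_D_iff[OF u2 L2_tendstoD(1)[OF v(1)[OF t]]] v(2)[OF t] by blast
    qed
    from R.flow_unique[OF this R.T_flow[OF f], of t] v(4) t
    have "L2_eq M (\<lambda>x. u x t) (heat_operator E \<iota> M \<alpha> t f)"
      by (simp add: R.T_0)
    then show "AE x in M. u x t = (\<integral>y. heat_kernel E \<iota> M \<alpha> (x - y) t * f y \<partial>M)"
      using t by (simp add: L2_eq_def heat_operator_def convolution_def)
  qed
qed

end
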